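(* Let $M,N,P$ be indecomposable $\mathbf{W}$-modules of the class $\mathcal{S}$ and let $\pi:M\times N\to P$ be a non-zero $\mathbf{W}$-equivariant degenerate bilinear map. Then, up to the $\mathfrak{S}_3$-symmetry, $\pi$ is conjugate to one of the following: (i) a trivial bilinear map $A_{\xi_1}\times A_{\xi_2}\to B_{\xi_3}$, where $\xi_1,\xi_2,\xi_3\in\mathbb{P}^1$; (ii) the map $A_\xi\times N\to P$, $(m,n)\mapsto\mathrm{Res}(m)\psi(n)$, where $\xi\in\mathbb{P}^1$ and $\psi:N\to P$ is an almost-isomorphism; (iii) the map $\eta(\xi_1,\xi_2,\xi_3)$ for some $\xi_1,\xi_2,\xi_3\in\mathbb{P}^1$ with $\xi_3\notin\{\xi_1,\xi_2\}$, or the map $\eta^t_\xi$ for some $\xi\in\mathbb{P}^1$ and some $t\in\mathbb{C}$, $t\ne0$; (iv) $\Theta_\xi+\tau$, where $\xi\in\mathbb{P}^1$ and $\tau:A_\xi\times A_\xi\to B_\xi$ is a trivial map.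
   Context: $\mathbf{W}$ is the Witt algebra with basis $L_n=z^{n+1}\frac{d}{dz}$ ($n\in\mathbb{Z}$), $[L_m,L_n]=(n-m)L_{m+n}$. For a $\mathbf{W}$-module $M$ put $M_s=\{m: L_0.m=sm\}$ and $\mathrm{Supp}\,M=\{s:M_s\ne0\}$. The class $\mathcal{S}$ consists of the $\mathbf{W}$-modules $M=\bigoplus_{s\in\mathbb{C}}M_s$ such that $\mathrm{Supp}\,M$ is exactly one $\mathbb{Z}$-coset of $\mathbb{C}$ and $\dim M_s=1$ for $s\in\mathrm{Supp}\,M$. For $(a,b)\in\mathbb{C}^2$: - $A_{a,b}$ has basis $(e^A_n)_{n\in\mathbb{Z}}$, with $L_m.e^A_n=(m+n)e^A_{m+n}$ if $n\ne0$ and $L_m.e^A_0=(am^2+bm)e^A_m$; - $B_{a,b}$ has basis $(e^B_n)_{n\in\mathbb{Z}}$, with $L_m.e^B_n=n\,e^B_{m+n}$ if $m+n\ne0$ and $L_m.e^B_{-m}=(am^2+bm)e^B_0$. For $(a,b)\neq(0,0)$, up to isomorphism they depend only on the point $\xi\in\mathbb{P}^1$ with projective coordinates $(a,b)$; write $A_\xi$, $B_\xi$ for these modules (which are indecomposable). $\mathrm{Res}:A_{a,b}\to\mathbb{C}$ is the $\mathbf{W}$-equivariant map with $\mathrm{Res}(e^A_0)=1$, $\mathrm{Res}(e^A_n)=0$ for $n\ne0$; the span of $e_0^B$ is a trivial submodule of $B_\xi$. Definitions. - The support of a bilinear map $\pi:M\times N\to P$ is $\{(x,y)\in\mathbb{C}^2:\pi(M_x\times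 N_y)\ne0\}$; $\pi$ is degenerate if its support is not Zariski dense in $\mathbb{C}^2$. - $\pi$ is $\mathbf{W}$-equivariant if $L.\pi(m,n)=\pi(L.m,n)+\pi(m,L.n)$ for all $L\in\mathbf{W}$. - A $\mathbf{W}$-equivariant bilinear map is trivial if its support is contained in $\{(0,0)\}$; equivalently it has the form $(m,n)\mapsto c(a(m)b(n))$ with $\mathbf{W}$-equivariant maps $a:M\to\mathbb{C}$, $b:N\to\mathbb{C}$, $c:\mathbb{C}\to P$. - An almost-isomorphism between modules of the class $\mathcal S$ is a $\mathbf{W}$-equivariant map whose kernel has dimension $\le1$. - Two bilinear maps are conjugate if one is obtained from the other by composing with $\mathbf{W}$-isomorphisms of the two source modules and of the target module. - $\mathfrak{S}_3$-symmetry: with $P^*=\bigoplus_s (P^* )_s$, $(P^* )_s=(P_{-s})^*$, the restricted dual (again in the class $\mathcal{S}$), a $\mathbf{W}$-equivariant bilinear map $M\times N\to P$ is the same as a $\mathbf{W}$-invariant trilinear form on $M\times N\times P^*$; permuting the three modules $M,N,P^*$ gives $\mathbf{W}$-equivariant bilinear maps such as $N\times M\to P$, $M\times P^*\to N^*$, etc. "Up to the $\mathfrak{S}_3$-symmetry" means after possibly replacing $\pi$ by one of these. The maps: - $\eta(\xi_1,\xi_2,\xi_3):A_{\xi_1}\times A_{\xi_2}\to A_{\xi_3}$, for $\xi_1,\xi_2,\xi_3\in\mathbb{P}^1$ not all equal, with projective coordinates $(a_1,b_1),(a_2,b_2),(a_3,b_3)$: choose a non-zero triple $(x,y,z)$ of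 scalars such that $z(a_3,b_3)=x(a_1,b_1)+y(a_2,b_2)$. All the modules $A_{a,b}$ have the same underlying vector space (with basis $(e^A_n)_{n\in\mathbb{Z}}$), and $\eta(\xi_1,\xi_2,\xi_3)$ is the map $y\,\mathrm{Res}\times\mathrm{id}+x\,\mathrm{id}\times\mathrm{Res}:A_{a_1,b_1}\times A_{a_2,b_2}\to A_{a_3,b_3}$, that is, $(m,n)\mapsto y\,\mathrm{Res}(m)\,n+x\,\mathrm{Res}(n)\,m$. It is defined up to a scalar multiple. - $\eta^t_\xi:A_\xi\times A_\xi\to A_\xi$, $\eta^t_\xi(m,n)=\mathrm{Res}(m)\,n+t\,\mathrm{Res}(n)\,m$. - $\Theta_\xi:A_{a,b}\times A_{a,b}\to B_{a,b}$ ($\xi$ having projective coordinates $(a,b)$): $\Theta_\xi(e^A_m,e^A_n)=0$ if $mn(m+n)\ne0$ or $m=n=0$; $\Theta_\xi(e^A_0,e^A_m)=-\Theta_\xi(e^A_m,e^A_0)=\frac1m e^B_m$ and $\Theta_\xi(e^A_{-m},e^A_m)=\frac1m e^B_0$ for $m\ne0$. *)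

theory Defs
  imports Complex_Main "HOL-Library.Poly_Mapping" "HOL-Library.Function_Algebras"
    "HOL-Computational_Algebra.Polynomial"
begin

section \<open>Complex spaces with an integer-indexed basis; the Witt algebra\<close>

type_synonym zvec = "int \<Rightarrow>\<^sub>0 complex"

definition basis_vec :: "int \<Rightarrow> zvec" where
  "basis_vec n = Poly_Mapping.single n 1"

definition zscale :: "complex \<Rightarrow> zvec \<Rightarrow> zvec" where
  "zscale c v = Poly_Mapping.map ((*) c) v"

definition bilinear_extension :: "(int \<Rightarrow> int \<Rightarrow> zvec) \<Rightarrow> zvec \<Rightarrow> zvec \<Rightarrow> zvec" where
  "bilinear_extension f v w =
     (\<Sum>m\<in>Poly_Mapping.keys v. \<Sum>n\<in>Poly_Mapping.keys w.
        zscale (Poly_Mapping.lookup v m * Poly_Mapping.lookup w n) (f m n))"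

text \<open>An element of the Witt algebra is its finite coefficient family in the basis
  \<open>(L_n)\<close>; thus \<open>L_n\<close> is \<open>basis_vec n\<close>.\<close>

type_synonym witt = zvec

definition witt_L :: "int \<Rightarrow> witt" where
  "witt_L n = basis_vec n"

definition witt_bracket :: "witt \<Rightarrow> witt \<Rightarrow> witt" where
  "witt_bracket = bilinear_extension (\<lambda>m n. zscale (of_int (n - m)) (basis_vec (m + n)))"

section \<open>Modules over the Witt algebra\<close>

text \<open>A module lives on a subspace \<open>carr\<close> of a complex vector space whose scalar
  multiplication is \<open>scal\<close>. A carrier set is used, rather than a full type, because
  restricted duals are proper subspaces of a function space.\<close>

record 'v wmod =
  carr :: "'v set"
  scal :: "complex \<Rightarrow> 'v \<Rightarrow> 'v"
  act :: "witt \<Rightarrow> 'v \<Rightarrow> 'v"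

definition witt_module :: "'v::ab_group_add wmod \<Rightarrow> bool" where
  "witt_module M \<longleftrightarrow>
     vector_space (scal M) \<and> module.subspace (scal M) (carr M) \<and>
     (\<forall>x. \<forall>v\<in>carr M. act M x v \<in> carr M) \<and>
     (\<forall>x. \<forall>v\<in>carr M. \<forall>w\<in>carr M. act M x (v + w) = act M x v + act M x w) \<and>
     (\<forall>x c. \<forall>v\<in>carr M. act M x (scal M c v) = scal M c (act M x v)) \<and>
     (\<forall>x y. \<forall>v\<in>carr M. act M (x + y) v = act M x v + act M y v) \<and>
     (\<forall>x c. \<forall>v\<in>carr M. act M (zscale c x) v = scal M c (act M x v)) \<and>
     (\<forall>x y. \<forall>v\<in>carr M.
        act M (witt_bracket x y) v = act M x (act M y v) - act M y (act M x v))"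

definition wt :: "'v::ab_group_add wmod \<Rightarrow> complex \<Rightarrow> 'v set" where
  "wt M s = {m \<in> carr M. act M (witt_L 0) m = scal M s m}"

definition Supp :: "'v::ab_group_add wmod \<Rightarrow> complex set" where
  "Supp M = {s. wt M s \<noteq> {0}}"

definition weight_module :: "'v::ab_group_add wmod \<Rightarrow> bool" where
  "weight_module M \<longleftrightarrow>
     (\<forall>m\<in>carr M. \<exists>!f. (\<forall>s. f s \<in> wt M s) \<and> finite {s. f s \<noteq> 0} \<and>
                        m = (\<Sum>s\<in>{s. f s \<noteq> 0}. f s))"

definition class_S :: "'v::ab_group_add wmod \<Rightarrow> bool" where
  "class_S M \<longleftrightarrow> witt_module M \<and> weight_module M \<and>
     (\<exists>u. Supp M = {u + of_int n |n. True}) \<and>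
     (\<forall>s\<in>Supp M. vector_space.dim (scal M) (wt M s) = 1)"

definition submodule :: "'v::ab_group_add wmod \<Rightarrow> 'v set \<Rightarrow> bool" where
  "submodule M U \<longleftrightarrow> module.subspace (scal M) U \<and> U \<subseteq> carr M \<and>
     (\<forall>x. \<forall>v\<in>U. act M x v \<in> U)"

definition indecomposable :: "'v::ab_group_add wmod \<Rightarrow> bool" where
  "indecomposable M \<longleftrightarrow> carr M \<noteq> {0} \<and>
     (\<forall>U V. submodule M U \<and> submodule M V \<and> U \<inter> V = {0} \<and>
            carr M = {u + v |u v. u \<in> U \<and> v \<in> V} \<longrightarrow> U = {0} \<or> V = {0})"

definition equivariant_linear ::
  "'v::ab_group_add wmod \<Rightarrow> 'w::ab_group_add wmod \<Rightarrow> ('v \<Rightarrow> 'w) \<Rightarrow> bool" where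
  "equivariant_linear M N f \<longleftrightarrow>
     (\<forall>v\<in>carr M. f v \<in> carr N) \<and>
     (\<forall>v\<in>carr M. \<forall>w\<in>carr M. f (v + w) = f v + f w) \<and>
     (\<forall>c. \<forall>v\<in>carr M. f (scal M c v) = scal N c (f v)) \<and>
     (\<forall>x. \<forall>v\<in>carr M. f (act M x v) = act N x (f v))"

definition witt_iso ::
  "'v::ab_group_add wmod \<Rightarrow> 'w::ab_group_add wmod \<Rightarrow> ('v \<Rightarrow> 'w) \<Rightarrow> bool" where
  "witt_iso M N f \<longleftrightarrow> equivariant_linear M N f \<and> bij_betw f (carr M) (carr N)"

text \<open>The dimension bound on the kernel is expressed by a spanning set, since
  \<^const>\<open>vector_space.dim\<close> takes the value 0 on infinite-dimensional spaces.\<close>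

definition almost_iso ::
  "'v::ab_group_add wmod \<Rightarrow> 'w::ab_group_add wmod \<Rightarrow> ('v \<Rightarrow> 'w) \<Rightarrow> bool" where
  "almost_iso M N f \<longleftrightarrow> equivariant_linear M N f \<and>
     (\<exists>B. finite B \<and> card B \<le> 1 \<and>
          {v \<in> carr M. f v = 0} \<subseteq> module.span (scal M) B)"

text \<open>Restricted dual: the linear forms on \<open>M\<close> that are non-zero on only finitely many
  weight spaces. For a weight module \<open>M\<close> these are the elements of the direct sum of the
  \<open>(M_{-s})^*\<close>. A form is represented by a function vanishing off \<open>carr M\<close>, so that
  distinct elements of the carrier are distinct forms.\<close>

definition rdual :: "'v::ab_group_add wmod \<Rightarrow> ('v \<Rightarrow> complex) wmod" where
  "rdual M =
     \<lparr>carr = {f. (\<forall>v\<in>carr M. \<forall>w\<in>carr M. f (v + w) = f v + f w) \<and>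
                 (\<forall>c. \<forall>v\<in>carr M. f (scal M c v) = c * f v) \<and>
                 (\<forall>v. v \<notin> carr M \<longrightarrow> f v = 0) \<and>
                 finite {s. \<exists>v\<in>wt M s. f v \<noteq> 0}},
      scal = (\<lambda>c f v. c * f v),
      act = (\<lambda>x f v. if v \<in> carr M then - f (act M x v) else 0)\<rparr>"

section \<open>Bilinear maps\<close>

definition equivariant_bilinear ::
  "'m::ab_group_add wmod \<Rightarrow> 'n::ab_group_add wmod \<Rightarrow> 'p::ab_group_add wmod
     \<Rightarrow> ('m \<Rightarrow> 'n \<Rightarrow> 'p) \<Rightarrow> bool" where
  "equivariant_bilinear M N P \<pi> \<longleftrightarrow>
     (\<forall>m\<in>carr M. \<forall>n\<in>carr N. \<pi> m n \<in> carr P) \<and>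
     (\<forall>m\<in>carr M. \<forall>m'\<in>carr M. \<forall>n\<in>carr N. \<pi> (m + m') n = \<pi> m n + \<pi> m' n) \<and>
     (\<forall>m\<in>carr M. \<forall>n\<in>carr N. \<forall>n'\<in>carr N. \<pi> m (n + n') = \<pi> m n + \<pi> m n') \<and>
     (\<forall>c. \<forall>m\<in>carr M. \<forall>n\<in>carr N. \<pi> (scal M c m) n = scal P c (\<pi> m n)) \<and>
     (\<forall>c. \<forall>m\<in>carr M. \<forall>n\<in>carr N. \<pi> m (scal N c n) = scal P c (\<pi> m n)) \<and>
     (\<forall>x. \<forall>m\<in>carr M. \<forall>n\<in>carr N.
        act P x (\<pi> m n) = \<pi> (act M x m) n + \<pi> m (act N x n))"

definition bisupport ::
  "'m::ab_group_add wmod \<Rightarrow> 'n::ab_group_add wmod \<Rightarrow> ('m \<Rightarrow> 'n \<Rightarrow> 'p::zero)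
     \<Rightarrow> (complex \<times> complex) set" where
  "bisupport M N \<pi> = {(x, y). \<exists>m\<in>wt M x. \<exists>n\<in>wt N y. \<pi> m n \<noteq> 0}"

text \<open>A polynomial in two variables is an element of \<open>\<complex>[X][Y]\<close>.\<close>

definition poly2 :: "complex poly poly \<Rightarrow> complex \<Rightarrow> complex \<Rightarrow> complex" where
  "poly2 p x y = poly (poly p [:y:]) x"

definition zariski_closed :: "(complex \<times> complex) set \<Rightarrow> bool" where
  "zariski_closed Z \<longleftrightarrow> (\<exists>F. Z = {(x, y). \<forall>p\<in>F. poly2 p x y = 0})"

definition zariski_dense :: "(complex \<times> complex) set \<Rightarrow> bool" where
  "zariski_dense S \<longleftrightarrow> (\<forall>Z. zariski_closed Z \<and> S \<subseteq> Z \<longrightarrow> Z = UNIV)"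

definition degenerate ::
  "'m::ab_group_add wmod \<Rightarrow> 'n::ab_group_add wmod \<Rightarrow> ('m \<Rightarrow> 'n \<Rightarrow> 'p::zero) \<Rightarrow> bool" where
  "degenerate M N \<pi> \<longleftrightarrow> \<not> zariski_dense (bisupport M N \<pi>)"

definition trivial_map ::
  "'m::ab_group_add wmod \<Rightarrow> 'n::ab_group_add wmod \<Rightarrow> 'p::ab_group_add wmod
     \<Rightarrow> ('m \<Rightarrow> 'n \<Rightarrow> 'p) \<Rightarrow> bool" where
  "trivial_map M N P \<pi> \<longleftrightarrow>
     equivariant_bilinear M N P \<pi> \<and> bisupport M N \<pi> \<subseteq> {(0, 0)}"

definition conjugate ::
  "'m::ab_group_add wmod \<Rightarrow> 'n::ab_group_add wmod \<Rightarrow> 'p::ab_group_add wmod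
     \<Rightarrow> ('m \<Rightarrow> 'n \<Rightarrow> 'p)
     \<Rightarrow> 'm2::ab_group_add wmod \<Rightarrow> 'n2::ab_group_add wmod \<Rightarrow> 'p2::ab_group_add wmod
     \<Rightarrow> ('m2 \<Rightarrow> 'n2 \<Rightarrow> 'p2) \<Rightarrow> bool" where
  "conjugate M N P \<pi> M' N' P' \<pi>' \<longleftrightarrow>
     (\<exists>\<alpha> \<beta> \<gamma>. witt_iso M M' \<alpha> \<and> witt_iso N N' \<beta> \<and> witt_iso P P' \<gamma> \<and>
        (\<forall>m\<in>carr M. \<forall>n\<in>carr N. \<gamma> (\<pi> m n) = \<pi>' (\<alpha> m) (\<beta> n)))"

section \<open>The families A and B\<close>

text \<open>A point of the projective line is given by homogeneous coordinates, that is by a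
  pair different from \<open>(0, 0)\<close>, up to \<open>same_point\<close>.\<close>

definition same_point :: "complex \<times> complex \<Rightarrow> complex \<times> complex \<Rightarrow> bool" where
  "same_point \<xi> \<zeta> \<longleftrightarrow> (\<exists>k. k \<noteq> 0 \<and> fst \<zeta> = k * fst \<xi> \<and> snd \<zeta> = k * snd \<xi>)"

definition A_action :: "complex \<times> complex \<Rightarrow> int \<Rightarrow> int \<Rightarrow> zvec" where
  "A_action \<xi> m n =
     (if n \<noteq> 0 then zscale (of_int (m + n)) (basis_vec (m + n))
      else zscale (fst \<xi> * of_int m ^ 2 + snd \<xi> * of_int m) (basis_vec m))"

definition B_action :: "complex \<times> complex \<Rightarrow> int \<Rightarrow> int \<Rightarrow> zvec" where
  "B_action \<xi> m n =
     (if m + n \<noteq> 0 then zscale (of_int n) (basis_vec (m + n))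
      else zscale (fst \<xi> * of_int m ^ 2 + snd \<xi> * of_int m) (basis_vec 0))"

definition A_mod :: "complex \<times> complex \<Rightarrow> zvec wmod" where
  "A_mod \<xi> = \<lparr>carr = UNIV, scal = zscale, act = bilinear_extension (A_action \<xi>)\<rparr>"

definition B_mod :: "complex \<times> complex \<Rightarrow> zvec wmod" where
  "B_mod \<xi> = \<lparr>carr = UNIV, scal = zscale, act = bilinear_extension (B_action \<xi>)\<rparr>"

definition Res :: "zvec \<Rightarrow> complex" where
  "Res v = Poly_Mapping.lookup v 0"

section \<open>The maps of the classification\<close>

definition eta_map :: "complex \<Rightarrow> complex \<Rightarrow> zvec \<Rightarrow> zvec \<Rightarrow> zvec" where
  "eta_map x y m n = zscale (y * Res m) n + zscale (x * Res n) m"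

definition eta_t_map :: "complex \<Rightarrow> zvec \<Rightarrow> zvec \<Rightarrow> zvec" where
  "eta_t_map t m n = zscale (Res m) n + zscale (t * Res n) m"

definition theta_basis :: "int \<Rightarrow> int \<Rightarrow> zvec" where
  "theta_basis i j =
     (if i = 0 \<and> j \<noteq> 0 then zscale (1 / of_int j) (basis_vec j)
      else if i \<noteq> 0 \<and> j = 0 then - zscale (1 / of_int i) (basis_vec i)
      else if j \<noteq> 0 \<and> i = - j then zscale (1 / of_int j) (basis_vec 0)
      else 0)"

definition Theta :: "zvec \<Rightarrow> zvec \<Rightarrow> zvec" where
  "Theta = bilinear_extension theta_basis"

definition conj_trivial ::
  "'m::ab_group_add wmod \<Rightarrow> 'n::ab_group_add wmod \<Rightarrow> 'p::ab_group_add wmod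
     \<Rightarrow> ('m \<Rightarrow> 'n \<Rightarrow> 'p) \<Rightarrow> bool" where
  "conj_trivial M N P \<pi> \<longleftrightarrow>
     (\<exists>\<xi>1 \<xi>2 \<xi>3 \<tau>. \<xi>1 \<noteq> (0, 0) \<and> \<xi>2 \<noteq> (0, 0) \<and> \<xi>3 \<noteq> (0, 0) \<and>
        trivial_map (A_mod \<xi>1) (A_mod \<xi>2) (B_mod \<xi>3) \<tau> \<and>
        conjugate M N P \<pi> (A_mod \<xi>1) (A_mod \<xi>2) (B_mod \<xi>3) \<tau>)"

text \<open>In the next definition the second and third modules need not be changed, because an
  isomorphism composed with an almost-isomorphism is an almost-isomorphism.\<close>

definition conj_Res_almost_iso ::
  "'m::ab_group_add wmod \<Rightarrow> 'n::ab_group_add wmod \<Rightarrow> 'p::ab_group_add wmod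
     \<Rightarrow> ('m \<Rightarrow> 'n \<Rightarrow> 'p) \<Rightarrow> bool" where
  "conj_Res_almost_iso M N P \<pi> \<longleftrightarrow>
     (\<exists>\<xi> \<psi>. \<xi> \<noteq> (0, 0) \<and> almost_iso N P \<psi> \<and>
        conjugate M N P \<pi> (A_mod \<xi>) N P (\<lambda>m n. scal P (Res m) (\<psi> n)))"

text \<open>The homogeneous coordinates of the three points belong to the existential choice.
  Evaluating at \<open>(e_0, e_0)\<close> shows that \<open>eta_map x y\<close> is equivariant for the chosen
  coordinates exactly when \<open>z = x + y\<close>; for points as below, coordinates can be normalised
  so that this holds, and \<open>conjugate\<close> forces it when \<open>\<pi>\<close> is equivariant.\<close>

definition conj_eta ::
  "'m::ab_group_add wmod \<Rightarrow> 'n::ab_group_add wmod \<Rightarrow> 'p::ab_group_add wmod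
     \<Rightarrow> ('m \<Rightarrow> 'n \<Rightarrow> 'p) \<Rightarrow> bool" where
  "conj_eta M N P \<pi> \<longleftrightarrow>
     (\<exists>a1 b1 a2 b2 a3 b3 x y z.
        (a1, b1) \<noteq> (0, 0) \<and> (a2, b2) \<noteq> (0, 0) \<and> (a3, b3) \<noteq> (0, 0) \<and>
        \<not> same_point (a3, b3) (a1, b1) \<and> \<not> same_point (a3, b3) (a2, b2) \<and>
        (x, y, z) \<noteq> (0, 0, 0) \<and>
        z * a3 = x * a1 + y * a2 \<and> z * b3 = x * b1 + y * b2 \<and>
        conjugate M N P \<pi> (A_mod (a1, b1)) (A_mod (a2, b2)) (A_mod (a3, b3)) (eta_map x y))"

definition conj_eta_t ::
  "'m::ab_group_add wmod \<Rightarrow> 'n::ab_group_add wmod \<Rightarrow> 'p::ab_group_add wmod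
     \<Rightarrow> ('m \<Rightarrow> 'n \<Rightarrow> 'p) \<Rightarrow> bool" where
  "conj_eta_t M N P \<pi> \<longleftrightarrow>
     (\<exists>\<xi> t. \<xi> \<noteq> (0, 0) \<and> t \<noteq> 0 \<and>
        conjugate M N P \<pi> (A_mod \<xi>) (A_mod \<xi>) (A_mod \<xi>) (eta_t_map t))"

definition conj_Theta_plus_trivial ::
  "'m::ab_group_add wmod \<Rightarrow> 'n::ab_group_add wmod \<Rightarrow> 'p::ab_group_add wmod
     \<Rightarrow> ('m \<Rightarrow> 'n \<Rightarrow> 'p) \<Rightarrow> bool" where
  "conj_Theta_plus_trivial M N P \<pi> \<longleftrightarrow>
     (\<exists>\<xi> \<tau>. \<xi> \<noteq> (0, 0) \<and> trivial_map (A_mod \<xi>) (A_mod \<xi>) (B_mod \<xi>) \<tau> \<and>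
        conjugate M N P \<pi> (A_mod \<xi>) (A_mod \<xi>) (B_mod \<xi>) (\<lambda>m n. Theta m n + \<tau> m n))"

definition conj_to_listed ::
  "'m::ab_group_add wmod \<Rightarrow> 'n::ab_group_add wmod \<Rightarrow> 'p::ab_group_add wmod
     \<Rightarrow> ('m \<Rightarrow> 'n \<Rightarrow> 'p) \<Rightarrow> bool" where
  "conj_to_listed M N P \<pi> \<longleftrightarrow>
     conj_trivial M N P \<pi> \<or> conj_Res_almost_iso M N P \<pi> \<or>
     conj_eta M N P \<pi> \<or> conj_eta_t M N P \<pi> \<or> conj_Theta_plus_trivial M N P \<pi>"

text \<open>Attached to \<open>\<pi> : M \<times> N \<rightarrow> P\<close> is the invariant trilinear form \<open>f (\<pi> m n)\<close> on
  \<open>M \<times> N \<times> P^*\<close>. Fixing two of its arguments gives an element of the restricted dual of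
  the third module, which is extended by 0 off the carrier as in \<open>rdual\<close>.\<close>

definition rotate_M_Pdual ::
  "'n::ab_group_add wmod \<Rightarrow> ('m \<Rightarrow> 'n \<Rightarrow> 'p) \<Rightarrow> 'm \<Rightarrow> ('p \<Rightarrow> complex) \<Rightarrow> ('n \<Rightarrow> complex)" where
  "rotate_M_Pdual N \<pi> = (\<lambda>m f n. if n \<in> carr N then f (\<pi> m n) else 0)"

definition rotate_N_Pdual ::
  "'m::ab_group_add wmod \<Rightarrow> ('m \<Rightarrow> 'n \<Rightarrow> 'p) \<Rightarrow> 'n \<Rightarrow> ('p \<Rightarrow> complex) \<Rightarrow> ('m \<Rightarrow> complex)" where
  "rotate_N_Pdual M \<pi> = (\<lambda>n f m. if m \<in> carr M then f (\<pi> m n) else 0)"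

definition S3_conj_to_listed ::
  "'m::ab_group_add wmod \<Rightarrow> 'n::ab_group_add wmod \<Rightarrow> 'p::ab_group_add wmod
     \<Rightarrow> ('m \<Rightarrow> 'n \<Rightarrow> 'p) \<Rightarrow> bool" where
  "S3_conj_to_listed M N P \<pi> \<longleftrightarrow>
     conj_to_listed M N P \<pi> \<or>
     conj_to_listed N M P (\<lambda>n m. \<pi> m n) \<or>
     conj_to_listed M (rdual P) (rdual N) (rotate_M_Pdual N \<pi>) \<or>
     conj_to_listed (rdual P) M (rdual N) (\<lambda>f m. rotate_M_Pdual N \<pi> m f) \<or>
     conj_to_listed N (rdual P) (rdual M) (rotate_N_Pdual M \<pi>) \<or>
     conj_to_listed (rdual P) N (rdual M) (\<lambda>f n. rotate_N_Pdual M \<pi> n f)"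

end

theory Submission
  imports Defs
begin

text \<open>Write \<open>x, y, z\<close> for the weights in the three arguments of the invariant trilinear form on
  \<open>M \<times> N \<times> P^*\<close>; its support lies in the plane \<open>x + y + z = 0\<close>. Because
  \<open>[L_{-k}, L_k] = 2k L_0\<close>, a weight vector of non-zero weight is hit by \<open>L_k\<close> for infinitely many
  \<open>k\<close>, so each point of the support with \<open>x \<noteq> 0\<close> lies on a line \<open>y = const\<close> or \<open>z = const\<close>
  containing infinitely many points of the support, and likewise for the other variables. A
  polynomial vanishing on the support allows only finitely many such lines, which confines the
  support to \<open>x y z = 0\<close>.

  If the support contains a point with \<open>x = 0\<close> other than the origin, it contains infinitely many,
  and invariance forces \<open>M\<close> to have a trivial quotient, whence \<open>M\<close> is some \<open>A_\<xi>\<close>. The number of lines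
  among \<open>x = 0\<close>, \<open>y = 0\<close>, \<open>z = 0\<close> that carry a point of the support besides the origin
  separates the four cases: none gives the trivial maps, one gives \<open>Res\<close> times an
  almost-isomorphism, two give \<open>\<eta>\<close>, three give \<open>\<Theta>\<close>.\<close>

section \<open>Structure constants\<close>

text \<open>With a single line, the form is a map from \<open>N\<close> to \<open>P\<close>, and its
  kernel must be shown to have dimension at most 1. The kernel is spanned by weight vectors, so the
  question is which sets of indices span submodules. Finite and cofinite sets yield to
  \<open>[L_{-k}, L_k] = 2k L_0\<close> with \<open>k\<close> large. The obstacle is a set unbounded
  in only one direction: it produces an extremal vector in the submodule and another one in the
  annihilator. An extremal vector of a module with one-dimensional weight spaces has a weight on a
  short list, because the weight space two steps away has no room for both \<open>L_1^2\<close> and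
  \<open>L_2\<close>; this is the origin of 5/8. The weights at the two ends differ by an integer,
  which 5/8 and 5/4 are not. Indecomposability enters only through the fact that the line of weight
  0 does not split off, which excludes the coordinates \<open>(0, 0)\<close>. The dual of
  \<open>P\<close> is used throughout so that the symmetric group merely permutes the arguments of a
  coefficient family.\<close>

text \<open>A module with one-dimensional weight spaces is given by \<open>L_k e_i = a k i e_{i+k}\<close>, where
  \<open>e_i\<close> has weight \<open>u + i\<close>. The family \<open>dual_coeff a\<close> describes the restricted dual in the
  basis whose \<open>i\<close>-th member is dual to \<open>e_{-i}\<close>, and \<open>rescales r a b\<close> says that
  \<open>e_i \<mapsto> r i e_i\<close> is an isomorphism from \<open>a\<close> to \<open>b\<close>.\<close>

locale structure_constants =
  fixes u :: complex and a :: "int \<Rightarrow> int \<Rightarrow> complex"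
  assumes L0: "a 0 i = u + of_int i"
    and bracket: "a l i * a k (i + l) - a k i * a l (i + k) = of_int (l - k) * a (k + l) i"

definition dual_coeff :: "(int \<Rightarrow> int \<Rightarrow> complex) \<Rightarrow> int \<Rightarrow> int \<Rightarrow> complex" where
  "dual_coeff a k i = - a k (- i - k)"

definition rescales ::
  "(int \<Rightarrow> complex) \<Rightarrow> (int \<Rightarrow> int \<Rightarrow> complex) \<Rightarrow> (int \<Rightarrow> int \<Rightarrow> complex) \<Rightarrow> bool" where
  "rescales r a b \<longleftrightarrow> (\<forall>i. r i \<noteq> 0) \<and> (\<forall>k i. a k i * r (k + i) = r i * b k i)"

definition A_coeff :: "complex \<times> complex \<Rightarrow> int \<Rightarrow> int \<Rightarrow> complex" where
  "A_coeff \<xi> k i =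
     (if i \<noteq> 0 then of_int (k + i) else fst \<xi> * of_int k ^ 2 + snd \<xi> * of_int k)"

definition B_coeff :: "complex \<times> complex \<Rightarrow> int \<Rightarrow> int \<Rightarrow> complex" where
  "B_coeff \<xi> k i =
     (if k + i \<noteq> 0 then of_int i else fst \<xi> * of_int k ^ 2 + snd \<xi> * of_int k)"

lemma dual_coeff_dual_coeff [simp]: "dual_coeff (dual_coeff a) = a"
  by (simp add: dual_coeff_def fun_eq_iff)

lemma dual_coeff_A: "dual_coeff (A_coeff \<xi>) = B_coeff (- fst \<xi>, - snd \<xi>)"
proof (intro ext)
  fix k i :: int
  have "- i - k = 0 \<longleftrightarrow> k + i = 0" by linarith
  then show "dual_coeff (A_coeff \<xi>) k i = B_coeff (- fst \<xi>, - snd \<xi>) k i"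
    by (simp add: dual_coeff_def A_coeff_def B_coeff_def)
qed

lemma rescales_dual:
  assumes "rescales r a b"
  shows "rescales (\<lambda>i. 1 / r (- i)) (dual_coeff a) (dual_coeff b)"
proof -
  have nz: "r i \<noteq> 0" and eq: "a k i * r (k + i) = r i * b k i" for k i
    using assms by (auto simp: rescales_def)
  have "- a k (- i - k) * (1 / r (- (k + i))) = 1 / r (- i) * - b k (- i - k)" for k i
  proof -
    have "r (- (k + i)) = r (- i - k)" by (rule arg_cong[of _ _ r]) simp
    then show ?thesis using eq[of k "- i - k"] nz by (simp add: divide_simps mult.commute)
  qed
  then show ?thesis
    using nz by (simp add: rescales_def dual_coeff_def)
qed

lemma rescales_refl: "rescales (\<lambda>i. 1) a a"
  by (simp add: rescales_def)

context structure_constants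
begin

lemma dual: "structure_constants (- u) (dual_coeff a)"
proof
  show "dual_coeff a 0 i = - u + of_int i" for i
    by (simp add: dual_coeff_def L0)
  show "dual_coeff a l i * dual_coeff a k (i + l) - dual_coeff a k i * dual_coeff a l (i + k)
      = of_int (l - k) * dual_coeff a (k + l) i" for l i k
    using bracket[of l "- i - l - k" k] by (simp add: dual_coeff_def algebra_simps)
qed

text \<open>This is the twist by the automorphism \<open>L_k \<mapsto> - L_{-k}\<close>, with
  \<open>e_i\<close> renamed \<open>e_{-i}\<close>. It exchanges the two ends of the index line, so
  that one-sided arguments need to be given only once.\<close>

lemma reflect: "structure_constants (- u) (\<lambda>k i. - a (- k) (- i))"
proof
  show "- a (- 0) (- i) = - u + of_int i" for i
    by (simp add: L0)
  show "- a (- l) (- i) * - a (- k) (- (i + l)) - - a (- k) (- i) * - a (- l) (- (i + k))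
      = of_int (l - k) * - a (- (k + l)) (- i)" for l i k
    using bracket[of "- l" "- i" "- k"] by (simp add: algebra_simps)
qed

lemma rescale:
  assumes "\<And>i. r i \<noteq> 0"
  shows "structure_constants u (\<lambda>k i. a k i * r (k + i) / r i)"
proof
  show "a 0 i * r (0 + i) / r i = u + of_int i" for i
    using assms by (simp add: L0)
  fix l i k :: int
  have "a l i * r (l + i) / r i * (a k (i + l) * r (k + (i + l)) / r (i + l))
      - a k i * r (k + i) / r i * (a l (i + k) * r (l + (i + k)) / r (i + k))
      = (a l i * a k (i + l) - a k i * a l (i + k)) * r (k + l + i) / r i"
    using assms by (simp add: divide_simps) (simp add: algebra_simps)
  then show "a l i * r (l + i) / r i * (a k (i + l) * r (k + (i + l)) / r (i + l))
      - a k i * r (k + i) / r i * (a l (i + k) * r (l + (i + k)) / r (i + k))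
      = of_int (l - k) * (a (k + l) i * r (k + l + i) / r i)"
    by (simp add: bracket)
qed

lemma casimir: "a k i * a (- k) (i + k) - a (- k) i * a k (i - k) = 2 * of_int k * (u + of_int i)"
  using bracket[of k i "- k"] L0[of i] by simp

lemma some_nonzero_out:
  assumes "u + of_int i \<noteq> 0" "k \<noteq> 0"
  shows "a k i \<noteq> 0 \<or> a (- k) i \<noteq> 0"
  using casimir[of k i] assms by auto

lemma some_nonzero_in:
  assumes "u + of_int i \<noteq> 0" "k \<noteq> 0"
  shows "a k (i - k) \<noteq> 0 \<or> a (- k) (i + k) \<noteq> 0"
  using casimir[of k i] assms by auto

lemma infinite_nonzero_in:
  assumes "u + of_int i \<noteq> 0"
  shows "infinite {k. a k (i - k) \<noteq> 0}"
proof
  assume fin: "finite {k. a k (i - k) \<noteq> 0}" (is "finite ?K")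
  have "k \<in> ?K \<union> uminus ` ?K" if "k \<noteq> 0" for k
  proof (cases "a k (i - k) = 0")
    case True
    then have "- k \<in> ?K" using some_nonzero_in[OF assms that] by simp
    then have "- (- k) \<in> uminus ` ?K" by (rule imageI)
    then have "k \<in> uminus ` ?K" by (simp only: minus_minus)
    then show ?thesis by (rule UnI2)
  qed simp
  then have "- {0} \<subseteq> ?K \<union> uminus ` ?K" by blast
  moreover have "finite (?K \<union> uminus ` ?K)" using fin by simp
  ultimately have "finite (- {0 :: int})" by (rule finite_subset)
  then show False
    by simp
qed

text \<open>Up to sign, \<open>C\<close> is the eigenvalue of the Casimir operator of the copy of
  \<open>sl_2\<close> spanned by \<open>L_{-1}\<close>, \<open>L_0\<close>, \<open>L_1\<close>. What
  matters later is that the product is a monic quadratic polynomial in the weight, so it vanishes at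
  no more than two weights.\<close>

lemma casimir_1: "\<exists>C. \<forall>i. a 1 i * a (- 1) (i + 1) = (u + of_int i) * (u + of_int i + 1) + C"
proof -
  let ?d = "\<lambda>i. a 1 i * a (- 1) (i + 1) - (u + of_int i) * (u + of_int i + 1)"
  have step: "?d i = ?d (i - 1)" for i
    using casimir[of 1 i] by (simp add: algebra_simps)
  have "?d i = ?d 0" for i
  proof (induction i rule: int_induct[of _ 0])
    case (step1 i) then show ?case using step[of "i + 1"] by simp
  next
    case (step2 i) then show ?case using step[of i] by simp
  qed simp
  then show ?thesis
    by (intro exI[of _ "?d 0"]) (metis add.commute diff_add_cancel)
qed

text \<open>The vectors \<open>L_1 L_1 e_i\<close> and \<open>L_2 e_i\<close> lie on one line, so
  the matrix obtained by lowering them back to \<open>e_i\<close> is singular. Its determinant is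
  the Kac determinant of level 2 at central charge 0, a multiple of
  \<open>h^2 (8h - 5)\<close>.\<close>

lemma lowest_weight:
  assumes "a (- 1) i = 0" "a (- 2) i = 0"
  shows "u + of_int i = 0 \<or> u + of_int i = 5 / 8"
proof (rule disjCI)
  define h where "h = u + of_int i"
  assume "u + of_int i \<noteq> 5 / 8"
  have 1: "a 1 i * a (- 1) (i + 1) = 2 * h"
    using bracket[of 1 i "- 1"] assms by (simp add: L0 h_def)
  have 2: "a 2 i * a (- 2) (i + 2) = 4 * h"
    using bracket[of 2 i "- 2"] assms by (simp add: L0 h_def)
  have 3: "a 2 i * a (- 1) (i + 2) = 3 * a 1 i"
    using bracket[of 2 i "- 1"] assms by simp
  have 4: "a 1 (i + 1) * a (- 1) (i + 2) = a (- 1) (i + 1) * a 1 i + 2 * (h + 1)"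
    using bracket[of 1 "i + 1" "- 1"] by (simp add: L0 h_def algebra_simps)
  have 5: "a 1 i * a (- 2) (i + 1) = 0"
    using bracket[of 1 i "- 2"] assms by simp
  have 6: "a 1 (i + 1) * a (- 2) (i + 2) = a (- 2) (i + 1) * a 1 (i - 1) + 3 * a (- 1) (i + 1)"
    using bracket[of 1 "i + 1" "- 2"] by (simp add: algebra_simps)
  have "h = 0"
  proof (rule ccontr)
    assume h: "h \<noteq> 0"
    have nz: "a 1 i \<noteq> 0" using 1 h by auto
    then have 7: "a (- 2) (i + 1) = 0" using 5 by simp
    \<comment> \<open>The same four scalars are read in two ways: as two round trips, from
      \<open>e_{i+1}\<close> to \<open>e_{i+2}\<close> and back and from \<open>e_i\<close> to
      \<open>e_{i+2}\<close> and back, and as the paths of \<open>L_{-1} L_2 e_i\<close> and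
      \<open>L_{-2} L_1 e_{i+1}\<close>. The regrouping is legitimate because the weight space at
      \<open>i + 2\<close> is a line.\<close>
    have "(a 1 (i + 1) * a (- 1) (i + 2)) * (a 2 i * a (- 2) (i + 2))
        = (a 2 i * a (- 1) (i + 2)) * (a 1 (i + 1) * a (- 2) (i + 2))" by simp
    then have "(2 * h + 2 * (h + 1)) * (4 * h) = (3 * a 1 i) * (3 * a (- 1) (i + 1))"
      unfolding 2 3 4 6 7 using 1 by (simp add: mult.commute)
    also have "\<dots> = 18 * h" using 1 by simp
    finally have "8 * h = 5" using h by (simp add: algebra_simps)
    then show False using \<open>u + of_int i \<noteq> 5 / 8\<close> by (simp add: h_def field_simps)
  qed
  then show "u + of_int i = 0" by (simp add: h_def)
qed

end

section \<open>Submodules spanned by weight vectors, as sets of indices\<close>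

definition invariant_indices :: "(int \<Rightarrow> int \<Rightarrow> complex) \<Rightarrow> int set \<Rightarrow> bool" where
  "invariant_indices a U \<longleftrightarrow> (\<forall>k i. i \<in> U \<longrightarrow> a k i \<noteq> 0 \<longrightarrow> i + k \<in> U)"

text \<open>The new set describes the annihilator of the submodule in the restricted dual.\<close>

lemma invariant_indices_dual:
  "invariant_indices a U \<Longrightarrow> invariant_indices (dual_coeff a) {i. - i \<notin> U}"
  unfolding invariant_indices_def dual_coeff_def
  by clarsimp (metis diff_add_cancel)

lemma invariant_indices_reflect:
  "invariant_indices a U \<Longrightarrow> invariant_indices (\<lambda>k i. - a (- k) (- i)) {i. - i \<in> U}"
  unfolding invariant_indices_def by fastforce

lemma int_set_constant_above:
  fixes U :: "int set"
  assumes "\<And>i. b \<le> i \<Longrightarrow> i \<in> U \<longleftrightarrow> i + 1 \<in> U" "b \<le> i"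
  shows "i \<in> U \<longleftrightarrow> b \<in> U"
  using assms(2)
proof (induction rule: int_ge_induct)
  case (step i)
  then show ?case using assms(1)[of i] by blast
qed blast

lemma int_set_constant_below:
  fixes U :: "int set"
  assumes "\<And>i. i \<le> b \<Longrightarrow> i \<in> U \<longleftrightarrow> i - 1 \<in> U" "i \<le> b"
  shows "i \<in> U \<longleftrightarrow> b \<in> U"
  using assms(2)
proof (induction rule: int_le_induct)
  case (step i)
  then show ?case using assms(1)[of i] by blast
qed blast

lemma int_set_least:
  fixes U :: "int set"
  assumes "j \<in> U" "\<And>i. i \<le> b \<Longrightarrow> i \<notin> U"
  obtains m where "m \<in> U" "\<And>i. i < m \<Longrightarrow> i \<notin> U"
proof -
  let ?n = "LEAST n. b + int n \<in> U"
  have "b + int (nat (j - b)) \<in> U"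
    using assms by (cases "j \<le> b") auto
  then have "b + int ?n \<in> U" by (rule LeastI)
  moreover have "i \<notin> U" if "i < b + int ?n" for i
  proof
    assume "i \<in> U"
    then have "b \<le> i" using assms(2)[of i] by linarith
    then have "b + int (nat (i - b)) \<in> U" using \<open>i \<in> U\<close> by simp
    then have "?n \<le> nat (i - b)" by (rule Least_le)
    then show False using that \<open>b \<le> i\<close> by linarith
  qed
  ultimately show thesis using that by blast
qed

context structure_constants
begin

text \<open>Where membership changes between \<open>i\<close> and \<open>i + 1\<close>, either
  \<open>L_1 e_i\<close> or \<open>L_{-1} e_{i+1}\<close> must vanish, so \<open>i\<close> is a root
  of the quadratic polynomial of \<open>casimir_1\<close>.\<close>

lemma invariant_finite_boundary:
  assumes "invariant_indices a U"
  shows "finite {i. (i \<in> U) \<noteq> (i + 1 \<in> U)}"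
proof -
  obtain C where C: "\<And>i. a 1 i * a (- 1) (i + 1) = (u + of_int i) * (u + of_int i + 1) + C"
    using casimir_1 by blast
  \<comment> \<open>This is \<open>(u + X) (u + X + 1) + C\<close>, expanded in
    \<open>X\<close>.\<close>
  let ?p = "[:u * (u + 1) + C, 2 * u + 1, 1:]"
  have "poly ?p (of_int i) = 0" if "(i \<in> U) \<noteq> (i + 1 \<in> U)" for i
  proof -
    have "a 1 i = 0 \<or> a (- 1) (i + 1) = 0"
      using that assms unfolding invariant_indices_def by (metis add_diff_cancel diff_conv_add_uminus)
    then have "a 1 i * a (- 1) (i + 1) = 0" by auto
    then show ?thesis unfolding C by (simp add: algebra_simps)
  qed
  then have "of_int ` {i. (i \<in> U) \<noteq> (i + 1 \<in> U)} \<subseteq> {x. poly ?p x = 0}" by blast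
  moreover have "finite {x. poly ?p x = 0}" by (rule poly_roots_finite) simp
  ultimately have "finite ((of_int :: int \<Rightarrow> complex) ` {i. (i \<in> U) \<noteq> (i + 1 \<in> U)})"
    by (rule finite_subset)
  then show ?thesis by (rule finite_imageD) (simp add: inj_on_def)
qed

lemma invariant_constant_at_ends:
  assumes "invariant_indices a U"
  obtains b where "b \<ge> 0" "\<And>i. b \<le> i \<Longrightarrow> i \<in> U \<longleftrightarrow> b \<in> U"
    "\<And>i. i \<le> - b \<Longrightarrow> i \<in> U \<longleftrightarrow> - b \<in> U"
proof -
  let ?B = "{i. (i \<in> U) \<noteq> (i + 1 \<in> U)}"
  obtain b where b: "\<And>i. i \<in> ?B \<Longrightarrow> \<bar>i\<bar> < b"
  proof -
    have fin: "finite (abs ` ?B)" using invariant_finite_boundary[OF assms] by simp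
    have "\<bar>i\<bar> < Max (abs ` ?B) + 1" if "i \<in> ?B" for i
      using Max_ge[OF fin] that by fastforce
    then show thesis using that by blast
  qed
  define c where "c = max b 0"
  have step: "i \<in> U \<longleftrightarrow> i + 1 \<in> U" if "\<bar>i\<bar> \<ge> c" for i
    using b[of i] that unfolding c_def by force
  show thesis
  proof
    show "c \<ge> 0" by (simp add: c_def)
    show "i \<in> U \<longleftrightarrow> c \<in> U" if "c \<le> i" for i
      by (rule int_set_constant_above[OF _ that]) (rule step, linarith)
    show "i \<in> U \<longleftrightarrow> - c \<in> U" if "i \<le> - c" for i
    proof (rule int_set_constant_below[OF _ that])
      fix j assume "j \<le> - c"
      then have "c \<le> \<bar>j - 1\<bar>" by linarith
      from step[OF this] show "j \<in> U \<longleftrightarrow> j - 1 \<in> U" by simp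
    qed
  qed
qed

lemma invariant_lowest:
  assumes inv: "invariant_indices a U"
    and "j \<in> U" "\<And>i. i \<le> b \<Longrightarrow> i \<notin> U"
  obtains m where "m \<in> U" "u + of_int m = 0 \<or> u + of_int m = 5 / 8"
proof -
  obtain m where m: "m \<in> U" "\<And>i. i < m \<Longrightarrow> i \<notin> U"
    using int_set_least[OF assms(2,3)] by metis
  have "a (- 1) m = 0" "a (- 2) m = 0"
    using inv m(1) m(2)[of "m - 1"] m(2)[of "m - 2"] unfolding invariant_indices_def by force+
  then show thesis using lowest_weight[of m] m(1) that by blast
qed

text \<open>A step \<open>k\<close> longer than the whole set leaves it in both directions. Hence
  \<open>L_k\<close> and \<open>L_{-k}\<close> kill \<open>e_i\<close>, and so does their
  commutator, a non-zero multiple of \<open>L_0\<close>.\<close>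

lemma finite_invariant_weight:
  assumes inv: "invariant_indices a U" and fin: "\<And>j. j \<in> U \<Longrightarrow> \<bar>j\<bar> < b" and i: "i \<in> U"
  shows "u + of_int i = 0"
proof (rule ccontr)
  assume nz: "u + of_int i \<noteq> 0"
  have "b > 0" using fin[OF i] by linarith
  then have "i + 2 * b \<notin> U" "i - 2 * b \<notin> U"
    using fin[of "i + 2 * b"] fin[of "i - 2 * b"] fin[OF i] by force+
  then have "a (2 * b) i = 0" "a (- (2 * b)) i = 0"
    using inv i unfolding invariant_indices_def by force+
  then show False using some_nonzero_out[OF nz, of "2 * b"] \<open>b > 0\<close> by simp
qed

text \<open>A set that is unbounded in exactly one direction has a least element \<open>m\<close> and its
  complement a greatest one \<open>n\<close>; both are extremal weights, so they lie in \<open>{0, 5/8}\<close> and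
  \<open>{0, - 5/8}\<close>, which forces \<open>m = n\<close>.\<close>

lemma not_half_infinite:
  assumes inv: "invariant_indices a U"
    and lo: "\<And>i. i \<le> - b \<Longrightarrow> i \<notin> U" and hi: "\<And>i. b \<le> i \<Longrightarrow> i \<in> U"
  shows False
proof -
  obtain m where m: "m \<in> U" "u + of_int m = 0 \<or> u + of_int m = 5 / 8"
    using invariant_lowest[OF inv, of b "- b"] lo hi by blast
  interpret D: structure_constants "- u" "dual_coeff a" by (rule dual)
  obtain n where n: "- n \<notin> U" "- u + of_int n = 0 \<or> - u + of_int n = 5 / 8"
    using D.invariant_lowest[OF invariant_indices_dual[OF inv], of b "- b"] lo hi by auto
  have sum: "of_int (m + n) = (u + of_int m) + (- u + of_int n)" by simp
  have "of_int (m + n) \<in> {0, 5 / 8, 5 / 4 :: complex}"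
    unfolding sum using m(2) n(2) by (elim disjE) (simp_all only:, simp_all)
  moreover have "8 * z \<in> {of_int 0, of_int 5, of_int 10}" if "z \<in> {0, 5 / 8, 5 / 4}" for z :: complex
    using that by (elim insertE emptyE; hypsubst; simp)
  ultimately have "of_int (8 * (m + n)) \<in> {of_int 0, of_int 5, of_int 10 :: complex}"
    unfolding of_int_mult[of 8] of_int_numeral by blast
  then have "8 * (m + n) \<in> {0, 5, 10}"
    unfolding insert_iff of_int_eq_iff empty_iff .
  then have "m + n = 0" by (elim insertE emptyE) presburger+
  then have "m = - n" by simp
  then show False using m(1) n(1) by simp
qed

text \<open>An invariant set is eventually constant at both ends, which leaves four patterns. A
  finite set has only the weight 0; a cofinite one has a finite annihilator, to which the same
  argument applies; the two remaining patterns are mirror images excluded by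
  \<open>not_half_infinite\<close>. The lemma later bounds the kernel of an intertwining
  map.\<close>

lemma invariant_cases:
  assumes inv: "invariant_indices a U"
    and "j \<notin> U" "u + of_int j \<noteq> 0" "i \<in> U"
  shows "u + of_int i = 0"
proof -
  obtain b where b: "b \<ge> 0" "\<And>i. b \<le> i \<Longrightarrow> i \<in> U \<longleftrightarrow> b \<in> U"
    "\<And>i. i \<le> - b \<Longrightarrow> i \<in> U \<longleftrightarrow> - b \<in> U"
    using invariant_constant_at_ends[OF inv] by metis
  interpret D: structure_constants "- u" "dual_coeff a" by (rule dual)
  interpret R: structure_constants "- u" "\<lambda>k i. - a (- k) (- i)" by (rule reflect)
  consider "b \<notin> U" "- b \<notin> U" | "b \<in> U" "- b \<in> U" | "b \<in> U" "- b \<notin> U" | "b \<notin> U" "- b \<in> U"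
    by blast
  then show ?thesis
  proof cases
    case 1
    have "\<bar>j\<bar> < b" if "j \<in> U" for j
      using b(2)[of j] b(3)[of j] 1 that by (cases "b \<le> j"; cases "j \<le> - b") auto
    then show ?thesis using finite_invariant_weight[OF inv] assms(4) by blast
  next
    case 2
    have "\<bar>j\<bar> < b" if "j \<in> {i. - i \<notin> U}" for j
      using b(2)[of "- j"] b(3)[of "- j"] 2 that by (cases "b \<le> j"; cases "j \<le> - b") auto
    then have "- u + of_int (- j) = 0"
      using D.finite_invariant_weight[OF invariant_indices_dual[OF inv], of b "- j"] assms(2) by simp
    moreover have "u + of_int j = - (- u + of_int (- j))" by simp
    ultimately have "u + of_int j = 0" by simp
    then show ?thesis using assms(3) by simp
  next
    case 3
    then show ?thesis using not_half_infinite[OF inv, of b] b by blast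
  next
    case 4
    have "i \<notin> {i. - i \<in> U}" if "i \<le> - b" for i using b(2)[of "- i"] 4 that by simp
    moreover have "i \<in> {i. - i \<in> U}" if "b \<le> i" for i using b(3)[of "- i"] 4 that by simp
    ultimately show ?thesis
      using R.not_half_infinite[OF invariant_indices_reflect[OF inv], of b] by blast
  qed
qed

end

section \<open>Modules with a trivial quotient\<close>

text \<open>No \<open>L_k\<close> leads into index 0, so the \<open>e_i\<close> with
  \<open>i \<noteq> 0\<close> span a submodule with trivial quotient. The coefficients out of index
  0 are not controlled at first, which is why the lemmas below treat that index separately.\<close>

locale structure_constants_0 = structure_constants 0 a for a +
  assumes to_0: "a k (- k) = 0"
begin

lemma reflect_0: "structure_constants_0 (\<lambda>k i. - a (- k) (- i))"
proof -
  interpret R: structure_constants "- 0" "\<lambda>k i. - a (- k) (- i)" by (rule reflect)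
  show ?thesis
    using R.structure_constants_axioms to_0[of "- k" for k]
    by (simp add: structure_constants_0_def structure_constants_0_axioms_def)
qed

lemma rescale_0:
  assumes "\<And>i. r i \<noteq> 0"
  shows "structure_constants_0 (\<lambda>k i. a k i * r (k + i) / r i)"
  using rescale[OF assms] to_0
  by (simp add: structure_constants_0_def structure_constants_0_axioms_def)

lemma casimir_1_eq: "a 1 i * a (- 1) (i + 1) = of_int i * of_int (i + 1)"
proof -
  obtain C where C: "\<And>i. a 1 i * a (- 1) (i + 1) = (0 + of_int i) * (0 + of_int i + 1) + C"
    using casimir_1 by blast
  have "C = 0" using C[of "- 1"] to_0[of 1] by simp
  then show ?thesis using C by simp
qed

text \<open>The relation \<open>[L_{-1}, L_2] = 3 L_1\<close> is a recursion for \<open>L_2\<close>.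
  It needs no initial value, because \<open>L_{-1} e_1 = 0\<close> makes it start by itself at
  \<open>e_1\<close>.\<close>

lemma up_2_right:
  assumes up: "\<And>i. i \<ge> 1 \<Longrightarrow> a 1 i = of_int (i + 1)" and "i \<ge> 1"
  shows "a 2 i = of_int (i + 2)"
  using \<open>i \<ge> 1\<close>
proof (induction rule: int_ge_induct)
  case base
  show ?case using bracket[of 2 1 "- 1"] to_0[of "- 1"] casimir_1_eq[of 2] up[of 1] up[of 2] by simp
next
  case (step i)
  have down: "a (- 1) (j + 1) = of_int j" if "j \<ge> 1" for j
  proof -
    have "of_int (j + 1) * (a (- 1) (j + 1) - of_int j) = 0"
      using casimir_1_eq[of j] up[OF that] by (simp only: right_diff_distrib) (simp add: mult.commute)
    moreover have "of_int (j + 1) \<noteq> (0 :: complex)"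
      using that by (subst of_int_eq_0_iff) linarith
    ultimately show ?thesis by simp
  qed
  have "a 2 (i + 1) * of_int (i + 2) - of_int i * of_int (i + 2) = 3 * of_int (i + 2)"
    using bracket[of 2 "i + 1" "- 1"] down[of i] down[of "i + 2"] up[of "i + 1"] step
    by (simp add: algebra_simps)
  then have "(a 2 (i + 1) - of_int (i + 3)) * of_int (i + 2) = 0"
    by (simp add: algebra_simps)
  moreover have "of_int (i + 2) \<noteq> (0 :: complex)"
    using step.hyps by (subst of_int_eq_0_iff) linarith
  ultimately show ?case by simp
qed

text \<open>The same recursion runs downwards on the negative side, where it starts from
  \<open>L_2 e_{-2} = 0\<close>. Neither recursion reaches \<open>L_2 e_{-1}\<close>.\<close>

lemma up_2_left:
  assumes up: "\<And>i. i \<noteq> 0 \<Longrightarrow> a 1 i = of_int (i + 1)"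
    and down: "\<And>i. i \<noteq> 0 \<Longrightarrow> a (- 1) i = of_int (i - 1)" and "i \<le> - 2"
  shows "a 2 i = of_int (i + 2)"
  using \<open>i \<le> - 2\<close>
proof (induction rule: int_le_induct)
  case base
  show ?case using to_0[of 2] by simp
next
  case (step i)
  \<comment> \<open>For \<open>i = - 2\<close> the factor \<open>a (- 1) 0\<close> is unknown, but
    it is multiplied by \<open>a 2 (- 2) = 0\<close>.\<close>
  have e: "a (- 1) (i + 2) * a 2 i = of_int (i + 1) * a 2 i"
    using down[of "i + 2"] step.IH by (cases "i = - 2") (use to_0[of 2] in simp_all)
  have "i \<noteq> 0" using step.hyps by simp
  have "a 2 i * a (- 1) (i + 2) - a (- 1) i * a 2 (i - 1) = 3 * a 1 i"
    using bracket[of 2 i "- 1"] by simp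
  then have "of_int (i + 1) * a 2 i - of_int (i - 1) * a 2 (i - 1) = 3 * of_int (i + 1)"
    unfolding mult.commute[of "a 2 i"] e down[OF \<open>i \<noteq> 0\<close>] up[OF \<open>i \<noteq> 0\<close>] .
  then have "of_int (i - 1) * (a 2 (i - 1) - of_int (i + 1)) = 0"
    unfolding step.IH by (simp add: algebra_simps)
  moreover have "of_int (i - 1) \<noteq> (0 :: complex)"
    using step.hyps by (subst of_int_eq_0_iff) linarith
  ultimately show ?case by simp
qed

lemma up_all:
  assumes up1: "\<And>i. i \<noteq> 0 \<Longrightarrow> a 1 i = of_int (i + 1)"
    and up2: "\<And>i. i \<noteq> 0 \<Longrightarrow> a 2 i = of_int (i + 2)"
    and "k \<ge> 2" "i \<noteq> 0"
  shows "a k i = of_int (k + i)"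
  using \<open>k \<ge> 2\<close> \<open>i \<noteq> 0\<close>
proof (induction arbitrary: i rule: int_ge_induct)
  case base
  then show ?case using up2[of i] by (simp add: add.commute)
next
  case (step k)
  \<comment> \<open>When the path passes through index 0, here and in the next fact, the unknown
    coefficient out of 0 is multiplied by a coefficient into 0, which vanishes.\<close>
  have 1: "a k i * a 1 (i + k) = of_int (k + i) * of_int (i + k + 1)"
  proof (cases "i + k = 0")
    case True
    then have "i = - k" by simp
    then show ?thesis using to_0[of k] by simp
  qed (use step up1[of "i + k"] in simp)
  have 2: "a 1 i * a k (i + 1) = of_int (i + 1) * of_int (k + i + 1)"
  proof (cases "i = - 1")
    case False
    then have "i + 1 \<noteq> 0" by simp
    then have "a k (i + 1) = of_int (k + i + 1)" using step.IH[of "i + 1"] by (simp add: add.assoc)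
    then show ?thesis using up1[OF step.prems] by simp
  qed (use to_0[of 1] in simp)
  have "of_int (k - 1) * a (k + 1) i = of_int (k + i) * of_int (i + k + 1) - of_int (i + 1) * of_int (k + i + 1)"
    using bracket[of k i 1] unfolding 1 2 by (simp add: add.commute)
  then have "of_int (k - 1) * (a (k + 1) i - of_int (k + 1 + i)) = 0"
    by (simp add: algebra_simps)
  moreover have "of_int (k - 1) \<noteq> (0 :: complex)"
    using step.hyps by (subst of_int_eq_0_iff) linarith
  ultimately show ?case by simp
qed

text \<open>The vectors \<open>L_k e_0\<close> form a 1-cocycle, and the cocycle relation determines
  all coefficients from those at \<open>k = 1\<close> and \<open>k = 2\<close>. Both
  \<open>k\<close> and \<open>k^2\<close> solve the relation, so subtracting the combination that
  agrees at 1 and 2, with factors \<open>\<beta>\<close> and \<open>\<alpha>\<close>, leaves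
  nothing.\<close>

lemma from_0_quadratic:
  assumes "\<And>k i. i \<noteq> 0 \<Longrightarrow> a k i = of_int (k + i)"
  obtains \<xi> where "\<And>k. a k 0 = fst \<xi> * of_int k ^ 2 + snd \<xi> * of_int k"
proof -
  define \<alpha> \<beta> where "\<alpha> = a 2 0 / 2 - a 1 0" and "\<beta> = 2 * a 1 0 - a 2 0 / 2"
  define d where "d k = a k 0 - (\<alpha> * of_int k ^ 2 + \<beta> * of_int k)" for k
  have d012: "d 0 = 0" "d 1 = 0" "d 2 = 0"
    by (simp_all add: d_def \<alpha>_def \<beta>_def L0 field_simps)
  have rel: "of_int (k + l) * (d l - d k) = of_int (l - k) * d (k + l)" if "k \<noteq> 0" "l \<noteq> 0" for k l
  proof -
    have "a l 0 * of_int (k + l) - a k 0 * of_int (l + k) = of_int (l - k) * a (k + l) 0"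
      using bracket[of l 0 k] assms[of k l] assms[of l k] that by simp
    then show ?thesis by (simp add: d_def algebra_simps power2_eq_square)
  qed
  have pos: "d k = 0" if "k \<ge> 2" for k
    using that
  proof (induction rule: int_ge_induct)
    case base
    show ?case using d012 by simp
  next
    case (step k)
    have "of_int (k - 1) * d (1 + k) = 0"
      using rel[of 1 k] step d012 by simp
    moreover have "of_int (k - 1) \<noteq> (0 :: complex)"
      using step.hyps by (subst of_int_eq_0_iff) linarith
    ultimately show ?case by (simp add: add.commute)
  qed
  have neg1: "d (- 1) = 0" using rel[of "- 1" 2] d012 by simp
  have neg2: "d (- 2) = 0" using rel[of "- 2" 1] d012 neg1 by simp
  have neg: "d k = 0" if "k \<le> - 2" for k
    using that
  proof (induction rule: int_le_induct)
    case base
    show ?case using neg2 by simp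
  next
    case (step k)
    have "of_int (k + 1) * d (k - 1) = 0"
      using rel[of "- 1" k] step neg1 by simp
    moreover have "of_int (k + 1) \<noteq> (0 :: complex)"
      using step.hyps by (subst of_int_eq_0_iff) linarith
    ultimately show ?case by simp
  qed
  have "d k = 0" for k
  proof -
    consider "k \<ge> 2" | "k \<le> - 2" | "k = 1" | "k = 0" | "k = - 1" by linarith
    then show ?thesis by cases (simp_all add: pos neg neg1 d012)
  qed
  then show thesis using that[of "(\<alpha>, \<beta>)"] by (simp add: d_def)
qed

text \<open>The hypotheses fix the action of \<open>L_1, L_{-1}, L_2, L_{-2}\<close> away from index 0; these
  generate the Witt algebra.\<close>

lemma eq_A_coeff:
  assumes up1: "\<And>i. i \<noteq> 0 \<Longrightarrow> a 1 i = of_int (i + 1)"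
    and up2: "\<And>i. i \<noteq> 0 \<Longrightarrow> a 2 i = of_int (i + 2)"
    and down1: "\<And>i. i \<noteq> 0 \<Longrightarrow> a (- 1) i = of_int (i - 1)"
    and down2: "\<And>i. i \<noteq> 0 \<Longrightarrow> a (- 2) i = of_int (i - 2)"
  obtains \<xi> where "a = A_coeff \<xi>"
proof -
  interpret R: structure_constants_0 "\<lambda>k i. - a (- k) (- i)" by (rule reflect_0)
  have pos: "a k i = of_int (k + i)" if "k \<ge> 2" "i \<noteq> 0" for k i
    using up_all[OF up1 up2] that by blast
  have neg: "a k i = of_int (k + i)" if "k \<le> - 2" "i \<noteq> 0" for k i
  proof -
    have "- a (- (- k)) (- (- i)) = of_int (- k + - i)"
      by (rule R.up_all) (use that down1 down2 in simp_all)
    then have "- a k i = - of_int (k + i)" by simp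
    then show ?thesis by (simp only: neg_equal_iff_equal)
  qed
  have all: "a k i = of_int (k + i)" if "i \<noteq> 0" for k i
  proof -
    consider "k \<ge> 2" | "k \<le> - 2" | "k = 1" | "k = 0" | "k = - 1" by linarith
    then show ?thesis
      by cases (simp_all add: pos neg up1 down1 L0 that)
  qed
  obtain \<xi> where "\<And>k. a k 0 = fst \<xi> * of_int k ^ 2 + snd \<xi> * of_int k"
    using from_0_quadratic[OF all] by metis
  with all have "a = A_coeff \<xi>"
    by (auto simp: A_coeff_def fun_eq_iff)
  then show thesis using that by blast
qed

end

lemma rescales_trans:
  "rescales r a b \<Longrightarrow> rescales s b c \<Longrightarrow> rescales (\<lambda>i. r i * s i) a c"
  unfolding rescales_def by (simp add: mult.assoc[symmetric])

lemma rescales_self: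
  assumes "\<And>i. r i \<noteq> 0"
  shows "rescales r a (\<lambda>k i. a k i * r (k + i) / r i)"
  using assms by (simp add: rescales_def)

text \<open>Only \<open>e_0\<close> is rescaled. This is the freedom in the choice of homogeneous
  coordinates, on which all later normalisations draw.\<close>

lemma rescales_A:
  assumes "s \<noteq> 0"
  shows "rescales (\<lambda>i. if i = 0 then s else 1) (A_coeff \<xi>) (A_coeff (fst \<xi> / s, snd \<xi> / s))"
  using assms by (auto simp: rescales_def A_coeff_def add_divide_distrib add_eq_0_iff distrib_left)

lemma rescales_B:
  assumes "s \<noteq> 0"
  shows "rescales (\<lambda>i. if i = 0 then s else 1) (B_coeff \<xi>) (B_coeff (fst \<xi> * s, snd \<xi> * s))"
  using assms by (auto simp: rescales_def B_coeff_def algebra_simps)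

context structure_constants_0
begin

lemma up_1_nonzero:
  assumes "i \<noteq> 0" "i \<noteq> - 1"
  shows "a 1 i \<noteq> 0"
proof
  assume "a 1 i = 0"
  then have "of_int i * of_int (i + 1) = (0 :: complex)" using casimir_1_eq[of i] by simp
  then have "of_int (i * (i + 1)) = (0 :: complex)" by (simp only: of_int_mult)
  then have "i * (i + 1) = 0" by (subst (asm) of_int_eq_0_iff)
  then show False using assms by auto
qed

lemma rescale_up_1:
  obtains r where "\<And>i. r i \<noteq> 0" "\<And>i. i \<ge> 1 \<Longrightarrow> a 1 i * r (1 + i) / r i = of_int (i + 1)"
    "\<And>i. i \<ge> 1 \<Longrightarrow> a (- 1) (- i) * r (- 1 + - i) / r (- i) = - of_int (i + 1)"
proof -
  interpret R: structure_constants_0 "\<lambda>k i. - a (- k) (- i)" by (rule reflect_0)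
  \<comment> \<open>The product solves \<open>r (i + 1) = r i * (i + 1) / b i\<close> outward from
    1. It is used once on each side of 0, and the empty product gives
    \<open>r 0 = r 1 = r (- 1) = 1\<close>.\<close>
  define p where "p b i = (\<Prod>n\<in>{1..<i}. of_int (n + 1) / b n)" for b :: "int \<Rightarrow> complex" and i
  have p_step: "p b (i + 1) = p b i * (of_int (i + 1) / b i)" if "i \<ge> 1" for b i
  proof -
    have "{1..<i + 1} = insert i {1..<i}" using that by auto
    then show ?thesis by (simp add: p_def mult.commute)
  qed
  have p_nz: "p b i \<noteq> 0" if "\<And>n. n \<ge> 1 \<Longrightarrow> b n \<noteq> 0" for b i
  proof -
    have "of_int (n + 1) / b n \<noteq> 0" if "n \<ge> 1" for n
    proof -
      have "of_int (n + 1) \<noteq> (0 :: complex)" using that by (subst of_int_eq_0_iff) linarith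
      then show ?thesis using \<open>\<And>n. n \<ge> 1 \<Longrightarrow> b n \<noteq> 0\<close>[OF that] by simp
    qed
    then show ?thesis by (simp add: p_def)
  qed
  define r where "r i = (if i \<ge> 0 then p (a 1) i else p (\<lambda>n. - a (- 1) (- n)) (- i))" for i
  have a1: "a 1 n \<noteq> 0" and a2: "- a (- 1) (- n) \<noteq> 0" if "n \<ge> 1" for n
    using up_1_nonzero[of n] R.up_1_nonzero[of n] that by auto
  show thesis
  proof
    show nz: "r i \<noteq> 0" for i using p_nz a1 a2 by (auto simp: r_def)
    show "a 1 i * r (1 + i) / r i = of_int (i + 1)" if "i \<ge> 1" for i
    proof -
      have "r (1 + i) = r i * (of_int (i + 1) / a 1 i)"
        using p_step[OF that, of "a 1"] that by (simp add: r_def add.commute)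
      then show ?thesis using nz[of i] a1[OF that] by simp
    qed
    show "a (- 1) (- i) * r (- 1 + - i) / r (- i) = - of_int (i + 1)" if "i \<ge> 1" for i
    proof -
      have "- (- 1 + - i) = i + 1" by simp
      then have "r (- 1 + - i) = r (- i) * (of_int (i + 1) / - a (- 1) (- i))"
        using p_step[OF that, of "\<lambda>n. - a (- 1) (- n)"] that unfolding r_def by simp
      then show ?thesis using nz[of "- i"] a2[OF that] by simp
    qed
  qed
qed

text \<open>With \<open>L_1\<close> and \<open>L_{-1}\<close> normalised, the positive and the
  negative indices can still be scaled independently, because \<open>L_1 e_{-1} = 0\<close> and
  \<open>L_{-1} e_1 = 0\<close> keep the two sides apart. The recursions for \<open>L_2\<close> and
  \<open>L_{-2}\<close> leave out just the crossings \<open>L_2 e_{-1}\<close> and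
  \<open>L_{-2} e_1\<close>, and the remaining scalar is spent on them.\<close>

lemma rescale_up_2:
  assumes up: "\<And>i. i \<ge> 1 \<Longrightarrow> a 1 i = of_int (i + 1)"
    and down: "\<And>i. i \<ge> 1 \<Longrightarrow> a (- 1) (- i) = - of_int (i + 1)"
  obtains r \<xi> where "rescales r a (A_coeff \<xi>)"
proof -
  interpret R: structure_constants_0 "\<lambda>k i. - a (- k) (- i)" by (rule reflect_0)
  have cancel: "x = y" if "z * x = z * y" "z \<noteq> 0" for x y z :: complex using that by simp
  have up1: "a 1 i = of_int (i + 1)" if "i \<noteq> 0" for i
  proof -
    consider "i \<ge> 1" | "i = - 1" | "i \<le> - 2" using \<open>i \<noteq> 0\<close> by linarith
    then show ?thesis
    proof cases
      case 3
      have "a (- 1) (i + 1) = of_int i" using down[of "- i - 1"] 3 by (simp add: add.commute)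
      then have "of_int i * a 1 i = of_int i * of_int (i + 1)"
        using casimir_1_eq[of i] by (simp add: mult.commute)
      then show ?thesis using cancel \<open>i \<noteq> 0\<close> by (metis of_int_eq_0_iff)
    qed (use up to_0[of 1] in simp_all)
  qed
  have down1: "a (- 1) i = of_int (i - 1)" if "i \<noteq> 0" for i
  proof -
    consider "i \<le> - 1" | "i = 1" | "i \<ge> 2" using \<open>i \<noteq> 0\<close> by linarith
    then show ?thesis
    proof cases
      case 1
      then show ?thesis using down[of "- i"] by simp
    next
      case 3
      have "of_int i * a (- 1) i = of_int i * of_int (i - 1)"
        using casimir_1_eq[of "i - 1"] up1[of "i - 1"] 3 by (simp add: mult.commute)
      then show ?thesis using cancel \<open>i \<noteq> 0\<close> by (metis of_int_eq_0_iff)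
    qed (use to_0[of "- 1"] in simp)
  qed
  have r_up1: "- a (- 1) (- i) = of_int (i + 1)" if "i \<noteq> 0" for i
    using down1[of "- i"] that by simp
  have r_down1: "- a (- (- 1)) (- i) = of_int (i - 1)" if "i \<noteq> 0" for i
    using up1[of "- i"] that by simp
  have up2: "a 2 i = of_int (i + 2)" if "i \<noteq> 0" "i \<noteq> - 1" for i
  proof -
    consider "i \<ge> 1" | "i \<le> - 2" using \<open>i \<noteq> 0\<close> \<open>i \<noteq> - 1\<close> by linarith
    then show ?thesis by cases (use up_2_right[OF up] up_2_left[OF up1 down1] in simp_all)
  qed
  have down2: "a (- 2) i = of_int (i - 2)" if "i \<noteq> 0" "i \<noteq> 1" for i
  proof -
    have "- a (- 2) (- (- i)) = of_int (- i + 2)"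
    proof -
      consider "- i \<ge> 1" | "- i \<le> - 2" using \<open>i \<noteq> 0\<close> \<open>i \<noteq> 1\<close> by linarith
      then show ?thesis by cases (use R.up_2_right[of "- i"] R.up_2_left[of "- i"] r_up1 r_down1 in simp_all)
    qed
    then have "- a (- 2) i = - of_int (i - 2)" by simp
    then show ?thesis by (simp only: neg_equal_iff_equal)
  qed
  define d where "d = a 2 (- 1)"
  \<comment> \<open>Evaluating \<open>[L_{-2}, L_2] = 4 L_0\<close> at \<open>e_1\<close> ties the
    two crossings together: both are non-zero, and scaling the negative side by \<open>d\<close>
    normalises both at once.\<close>
  have cd: "a (- 2) 1 * d = - 1"
    using casimir[of 2 1] up2[of 1] down2[of 3] by (simp add: d_def eq_neg_iff_add_eq_0 algebra_simps)
  then have "d \<noteq> 0" by auto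
  define r where "r i = (if i < 0 then d else 1)" for i :: int
  have r_nz: "r i \<noteq> 0" for i using \<open>d \<noteq> 0\<close> by (simp add: r_def)
  let ?a = "\<lambda>k i. a k i * r (k + i) / r i"
  interpret S: structure_constants_0 ?a using r_nz by (rule rescale_0)
  obtain \<xi> where "?a = A_coeff \<xi>"
  proof (rule S.eq_A_coeff)
    show "a 1 i * r (1 + i) / r i = of_int (i + 1)" if "i \<noteq> 0" for i
      using up1[OF that] that \<open>d \<noteq> 0\<close> by (cases "i = - 1") (auto simp: r_def)
    show "a (- 1) i * r (- 1 + i) / r i = of_int (i - 1)" if "i \<noteq> 0" for i
      using down1[OF that] that \<open>d \<noteq> 0\<close> by (cases "i = 1") (auto simp: r_def)
    show "a 2 i * r (2 + i) / r i = of_int (i + 2)" if "i \<noteq> 0" for i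
    proof -
      consider "i = - 1" | "i = - 2" | "i \<noteq> - 1" "i \<noteq> - 2" by blast
      then show ?thesis
        by cases (use up2[of i] to_0[of 2] that \<open>d \<noteq> 0\<close> in \<open>auto simp: r_def d_def\<close>)
    qed
    show "a (- 2) i * r (- 2 + i) / r i = of_int (i - 2)" if "i \<noteq> 0" for i
    proof -
      consider "i = 1" | "i = 2" | "i \<noteq> 1" "i \<noteq> 2" by blast
      then show ?thesis
        by cases (use down2[of i] to_0[of "- 2"] that \<open>d \<noteq> 0\<close> cd in \<open>auto simp: r_def\<close>)
    qed
  qed
  then have "rescales r a (A_coeff \<xi>)" using rescales_self[of r a] r_nz by simp
  then show thesis using that by blast
qed

lemma rescales_to_A:
  obtains r \<xi> where "rescales r a (A_coeff \<xi>)"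
proof -
  obtain r where r: "\<And>i. r i \<noteq> 0" "\<And>i. i \<ge> 1 \<Longrightarrow> a 1 i * r (1 + i) / r i = of_int (i + 1)"
    "\<And>i. i \<ge> 1 \<Longrightarrow> a (- 1) (- i) * r (- 1 + - i) / r (- i) = - of_int (i + 1)"
    using rescale_up_1 by metis
  interpret S: structure_constants_0 "\<lambda>k i. a k i * r (k + i) / r i" using r(1) by (rule rescale_0)
  obtain s \<xi> where "rescales s (\<lambda>k i. a k i * r (k + i) / r i) (A_coeff \<xi>)"
    by (rule S.rescale_up_2[OF r(2,3)])
  then show thesis using rescales_trans[OF rescales_self[of r a, OF r(1)]] that by blast
qed

end

section \<open>Invariant trilinear forms\<close>

definition invariant_form ::
  "(int \<Rightarrow> int \<Rightarrow> complex) \<Rightarrow> (int \<Rightarrow> int \<Rightarrow> complex) \<Rightarrow> (int \<Rightarrow> int \<Rightarrow> complex)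
     \<Rightarrow> (int \<Rightarrow> int \<Rightarrow> int \<Rightarrow> complex) \<Rightarrow> bool" where
  "invariant_form a b c f \<longleftrightarrow>
     (\<forall>i j l. i + j + l \<noteq> 0 \<longrightarrow> f i j l = 0) \<and>
     (\<forall>k i j l. i + j + l + k = 0 \<longrightarrow>
        a k i * f (i + k) j l + b k j * f i (j + k) l + c k l * f i j (l + k) = 0)"

lemma rescales_eq:
  assumes "rescales r a b"
  shows "b k i = a k i * r (i + k) / r i"
proof -
  have "r i \<noteq> 0" "a k i * r (i + k) = r i * b k i"
    using assms by (simp_all add: rescales_def add.commute[of i k])
  then show ?thesis by simp
qed

lemma invariant_form_rescale:
  assumes f: "invariant_form a b c f"
    and r: "rescales r a a'" and s: "rescales s b b'" and t: "rescales t c c'"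
  shows "invariant_form a' b' c' (\<lambda>i j l. f i j l / (r i * s j * t l))"
proof -
  have nz: "r i \<noteq> 0" "s i \<noteq> 0" "t i \<noteq> 0" for i
    using r s t by (simp_all add: rescales_def)
  have eq: "a' k i = a k i * r (i + k) / r i" "b' k i = b k i * s (i + k) / s i"
    "c' k i = c k i * t (i + k) / t i" for k i
    using rescales_eq[OF r] rescales_eq[OF s] rescales_eq[OF t] by simp_all
  show ?thesis
    unfolding invariant_form_def
  proof (intro conjI allI impI)
    show "f i j l / (r i * s j * t l) = 0" if "i + j + l \<noteq> 0" for i j l
      using f that by (simp add: invariant_form_def)
    fix k i j l :: int
    assume "i + j + l + k = 0"
    then have z: "a k i * f (i + k) j l + b k j * f i (j + k) l + c k l * f i j (l + k) = 0"
      using f by (simp add: invariant_form_def)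
    have 1: "a' k i * (f (i + k) j l / (r (i + k) * s j * t l)) = a k i * f (i + k) j l / (r i * s j * t l)"
      using nz[of i] nz[of "i + k"] by (simp add: eq)
    have 2: "b' k j * (f i (j + k) l / (r i * s (j + k) * t l)) = b k j * f i (j + k) l / (r i * s j * t l)"
      using nz[of j] nz[of "j + k"] by (simp add: eq)
    have 3: "c' k l * (f i j (l + k) / (r i * s j * t (l + k))) = c k l * f i j (l + k) / (r i * s j * t l)"
      using nz[of l] nz[of "l + k"] by (simp add: eq)
    show "a' k i * (f (i + k) j l / (r (i + k) * s j * t l)) + b' k j * (f i (j + k) l / (r i * s (j + k) * t l))
        + c' k l * (f i j (l + k) / (r i * s j * t (l + k))) = 0"
      unfolding 1 2 3 add_divide_distrib[symmetric] z by simp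
  qed
qed

lemma invariant_form_swap12:
  assumes "invariant_form a b c f"
  shows "invariant_form b a c (\<lambda>j i l. f i j l)"
proof -
  have supp: "f i j l \<noteq> 0 \<Longrightarrow> i + j + l = 0"
    and inv: "i + j + l + k = 0 \<Longrightarrow>
      a k i * f (i + k) j l + b k j * f i (j + k) l + c k l * f i j (l + k) = 0" for i j l k
    using assms by (auto simp: invariant_form_def)
  have "b k j * f i (j + k) l + a k i * f (i + k) j l + c k l * f i j (l + k) = 0"
    if "j + i + l + k = 0" for k i j l
    using inv[of i j l k] that by (simp add: ac_simps)
  moreover have "f i j l = 0" if "j + i + l \<noteq> 0" for i j l
    using supp[of i j l] that by linarith
  ultimately show ?thesis
    unfolding invariant_form_def by blast
qed

lemma invariant_form_swap23:
  assumes "invariant_form a b c f"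
  shows "invariant_form a c b (\<lambda>i l j. f i j l)"
proof -
  have supp: "f i j l \<noteq> 0 \<Longrightarrow> i + j + l = 0"
    and inv: "i + j + l + k = 0 \<Longrightarrow>
      a k i * f (i + k) j l + b k j * f i (j + k) l + c k l * f i j (l + k) = 0" for i j l k
    using assms by (auto simp: invariant_form_def)
  have "a k i * f (i + k) j l + c k l * f i j (l + k) + b k j * f i (j + k) l = 0"
    if "i + l + j + k = 0" for k i j l
    using inv[of i j l k] that by (simp add: ac_simps)
  moreover have "f i j l = 0" if "i + l + j \<noteq> 0" for i j l
    using supp[of i j l] that by linarith
  ultimately show ?thesis
    unfolding invariant_form_def by blast
qed

lemma finite_prod_swap: "finite {(y, x). P x y} \<longleftrightarrow> finite {(x, y). P x y}"
proof -
  have "{(y, x). P x y} = prod.swap ` {(x, y). P x y}" by (auto simp: image_iff)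
  then show ?thesis by (simp add: finite_image_iff)
qed

text \<open>The weight of the \<open>i\<close>-th basis vector of the first module is \<open>u + i\<close>. The condition
  \<open>u_normal\<close> normalises the index of the weight 0. By \<open>thin1\<close>, only finitely many of the lines
  on which the first weight is constant meet the support in an infinite set.\<close>

locale thin_invariant_form =
  A: structure_constants u a + B: structure_constants v b + C: structure_constants w c
  for u a v b w c +
  fixes f :: "int \<Rightarrow> int \<Rightarrow> int \<Rightarrow> complex"
  assumes invariant: "invariant_form a b c f"
    and weight_sum: "u + v + w = 0"
    and u_normal: "u + of_int i = 0 \<Longrightarrow> i = 0"
    and v_normal: "v + of_int i = 0 \<Longrightarrow> i = 0"
    and w_normal: "w + of_int i = 0 \<Longrightarrow> i = 0"
    and thin1: "finite {i. infinite {(j, l). f i j l \<noteq> 0}}"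
    and thin2: "finite {j. infinite {(i, l). f i j l \<noteq> 0}}"
    and thin3: "finite {l. infinite {(i, j). f i j l \<noteq> 0}}"
begin

lemma index_sum: "f i j l \<noteq> 0 \<Longrightarrow> i + j + l = 0"
  using invariant by (auto simp: invariant_form_def)

lemma invariance:
  "i + j + l + k = 0 \<Longrightarrow>
    a k i * f (i + k) j l + b k j * f i (j + k) l + c k l * f i j (l + k) = 0"
  using invariant by (simp add: invariant_form_def)

lemma weights_sum: "i + j + l = 0 \<Longrightarrow> (u + of_int i) + (v + of_int j) + (w + of_int l) = 0"
proof -
  assume "i + j + l = 0"
  then have "of_int (i + j + l) = (0 :: complex)" by simp
  moreover have "(u + of_int i) + (v + of_int j) + (w + of_int l) = (u + v + w) + of_int (i + j + l)"
    by simp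
  ultimately show ?thesis using weight_sum by simp
qed

lemma swap12: "thin_invariant_form v b u a w c (\<lambda>j i l. f i j l)"
proof
  show "invariant_form b a c (\<lambda>j i l. f i j l)"
    using invariant by (rule invariant_form_swap12)
  show "finite {l. infinite {(j, i). f i j l \<noteq> 0}}"
    using thin3 by (subst finite_prod_swap)
qed (use weight_sum u_normal v_normal w_normal thin1 thin2 in \<open>simp_all add: add.commute\<close>)

lemma swap23: "thin_invariant_form u a w c v b (\<lambda>i l j. f i j l)"
proof
  show "invariant_form a c b (\<lambda>i l j. f i j l)"
    using invariant by (rule invariant_form_swap23)
  show "finite {i. infinite {(l, j). f i j l \<noteq> 0}}"
    using thin1 by (subst finite_prod_swap)
qed (use weight_sum u_normal v_normal w_normal thin2 thin3 in \<open>simp_all add: add.commute add.left_commute\<close>)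

text \<open>If the first weight is non-zero at a point of the support, then for infinitely many \<open>k\<close>
  that point is hit by \<open>L_k\<close> in the first variable, and invariance yields another point of
  the support on one of the two lines through the given point.\<close>

lemma heavy_line:
  assumes "f i j l \<noteq> 0" "u + of_int i \<noteq> 0"
  shows "infinite {(i, l). f i j l \<noteq> 0} \<or> infinite {(i, j). f i j l \<noteq> 0}"
proof (rule ccontr)
  assume "\<not> ?thesis"
  then have fin: "finite {(i, l). f i j l \<noteq> 0}" "finite {(i, j). f i j l \<noteq> 0}" by auto
  let ?K1 = "{k. f (i - k) (j + k) l \<noteq> 0}" and ?K2 = "{k. f (i - k) j (l + k) \<noteq> 0}"
  have "(\<lambda>k. (i - k, j + k)) ` ?K1 \<subseteq> {(i, j). f i j l \<noteq> 0}" by auto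
  then have "finite ((\<lambda>k. (i - k, j + k)) ` ?K1)" using fin(2) by (rule finite_subset)
  then have "finite ?K1" by (rule finite_imageD) (simp add: inj_on_def)
  moreover have "(\<lambda>k. (i - k, l + k)) ` ?K2 \<subseteq> {(i, l). f i j l \<noteq> 0}" by auto
  then have "finite ((\<lambda>k. (i - k, l + k)) ` ?K2)" using fin(1) by (rule finite_subset)
  then have "finite ?K2" by (rule finite_imageD) (simp add: inj_on_def)
  moreover have "{k. a k (i - k) \<noteq> 0} \<subseteq> ?K1 \<union> ?K2"
  proof
    fix k assume "k \<in> {k. a k (i - k) \<noteq> 0}"
    moreover have "a k (i - k) * f i j l + b k j * f (i - k) (j + k) l + c k l * f (i - k) j (l + k) = 0"
      using invariance[of "i - k" j l k] index_sum[OF assms(1)] by simp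
    ultimately show "k \<in> ?K1 \<union> ?K2" using assms(1) by auto
  qed
  ultimately have "finite {k. a k (i - k) \<noteq> 0}" by (meson finite_UnI finite_subset)
  then show False using A.infinite_nonzero_in[OF assms(2)] by blast
qed

text \<open>Call a line heavy if it contains infinitely many points of the support. By
  \<open>heavy_line\<close> and its permuted versions, a point off the three lines of weight 0 lies
  on heavy lines of two different directions. There are finitely many heavy lines, hence finitely
  many such points. But a heavy line of non-zero weight meets the lines of weight 0 in at most two
  points of the support, so it would contain infinitely many of them. Thus no heavy line has
  non-zero weight, and no such point exists.\<close>

lemma support_on_lines:
  assumes "f i j l \<noteq> 0"
  shows "u + of_int i = 0 \<or> v + of_int j = 0 \<or> w + of_int l = 0"
proof (rule ccontr)
  assume "\<not> ?thesis"
  then have nz: "u + of_int i \<noteq> 0" "v + of_int j \<noteq> 0" "w + of_int l \<noteq> 0" by auto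
  interpret S: thin_invariant_form v b u a w c "\<lambda>j i l. f i j l" by (rule swap12)
  interpret T: thin_invariant_form u a w c v b "\<lambda>i l j. f i j l" by (rule swap23)
  interpret TS: thin_invariant_form w c u a v b "\<lambda>l i j. f i j l" by (rule T.swap12)
  let ?H1 = "{i. infinite {(j, l). f i j l \<noteq> 0}}"
  let ?H2 = "{j. infinite {(i, l). f i j l \<noteq> 0}}"
  let ?H3 = "{l. infinite {(i, j). f i j l \<noteq> 0}}"
  let ?S = "{(i, j, l). f i j l \<noteq> 0 \<and> u + of_int i \<noteq> 0 \<and> v + of_int j \<noteq> 0 \<and> w + of_int l \<noteq> 0}"
  have two: "(j \<in> ?H2 \<or> l \<in> ?H3) \<and> (i \<in> ?H1 \<or> l \<in> ?H3) \<and> (i \<in> ?H1 \<or> j \<in> ?H2)"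
    if "(i, j, l) \<in> ?S" for i j l
    using heavy_line[of i j l] S.heavy_line[of i j l] TS.heavy_line[of i j l] that
    by (simp add: finite_prod_swap[of "\<lambda>i j. f i j _ \<noteq> 0"] finite_prod_swap[of "\<lambda>i l. f i _ l \<noteq> 0"]
        finite_prod_swap[of "\<lambda>j l. f _ j l \<noteq> 0"])
  have "?S \<subseteq> (\<lambda>(i, j). (i, j, - i - j)) ` (?H1 \<times> ?H2) \<union> (\<lambda>(i, l). (i, - i - l, l)) ` (?H1 \<times> ?H3)
      \<union> (\<lambda>(j, l). (- j - l, j, l)) ` (?H2 \<times> ?H3)" (is "_ \<subseteq> ?R")
  proof
    fix p assume p: "p \<in> ?S"
    obtain i j l where [simp]: "p = (i, j, l)" by (cases p)
    have sum: "l = - i - j" "j = - i - l" "i = - j - l" using index_sum[of i j l] p by auto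
    consider "i \<in> ?H1" "j \<in> ?H2" | "i \<in> ?H1" "l \<in> ?H3" | "j \<in> ?H2" "l \<in> ?H3"
      using two[of i j l] p unfolding \<open>p = (i, j, l)\<close> by blast
    then show "p \<in> ?R"
    proof cases
      case 1
      then have "p \<in> (\<lambda>(i, j). (i, j, - i - j)) ` (?H1 \<times> ?H2)"
        by (intro image_eqI[of _ _ "(i, j)"]) (use sum(1) in auto)
      then show ?thesis by blast
    next
      case 2
      then have "p \<in> (\<lambda>(i, l). (i, - i - l, l)) ` (?H1 \<times> ?H3)"
        by (intro image_eqI[of _ _ "(i, l)"]) (use sum(2) in auto)
      then show ?thesis by blast
    next
      case 3
      then have "p \<in> (\<lambda>(j, l). (- j - l, j, l)) ` (?H2 \<times> ?H3)"
        by (intro image_eqI[of _ _ "(j, l)"]) (use sum(3) in auto)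
      then show ?thesis by blast
    qed
  qed
  moreover have "finite ?R" using thin1 thin2 thin3 by simp
  ultimately have finS: "finite ?S" by (rule finite_subset)
  have 1: False if "i \<in> ?H1" "u + of_int i \<noteq> 0" for i
  proof -
    have "{(j, l). f i j l \<noteq> 0} \<subseteq> snd ` ?S \<union> {(0, - i), (- i, 0)}"
    proof
      fix p assume "p \<in> {(j, l). f i j l \<noteq> 0}"
      then obtain j l where p: "p = (j, l)" and nz: "f i j l \<noteq> 0" by blast
      have sum: "i + j + l = 0" using index_sum[OF nz] .
      consider "j = 0" | "l = 0" | "v + of_int j \<noteq> 0" "w + of_int l \<noteq> 0"
        using v_normal w_normal by blast
      then show "p \<in> snd ` ?S \<union> {(0, - i), (- i, 0)}"
      proof cases
        case 3
        then have "(i, j, l) \<in> ?S" using nz that(2) by simp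
        then have "snd (i, j, l) \<in> snd ` ?S" by (rule imageI)
        then show ?thesis using p by simp
      qed (use p sum in auto)
    qed
    then have "finite {(j, l). f i j l \<noteq> 0}" by (rule finite_subset) (use finS in simp)
    then show False using that(1) by blast
  qed
  have 2: False if "j \<in> ?H2" "v + of_int j \<noteq> 0" for j
  proof -
    have "{(i, l). f i j l \<noteq> 0} \<subseteq> (\<lambda>(i, j, l). (i, l)) ` ?S \<union> {(0, - j), (- j, 0)}"
    proof
      fix p assume "p \<in> {(i, l). f i j l \<noteq> 0}"
      then obtain i l where p: "p = (i, l)" and nz: "f i j l \<noteq> 0" by blast
      have sum: "i + j + l = 0" using index_sum[OF nz] .
      consider "i = 0" | "l = 0" | "u + of_int i \<noteq> 0" "w + of_int l \<noteq> 0"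
        using u_normal w_normal by blast
      then show "p \<in> (\<lambda>(i, j, l). (i, l)) ` ?S \<union> {(0, - j), (- j, 0)}"
      proof cases
        case 3
        then have "(i, j, l) \<in> ?S" using nz that(2) by simp
        then have "(\<lambda>(i, j, l). (i, l)) (i, j, l) \<in> (\<lambda>(i, j, l). (i, l)) ` ?S" by (rule imageI)
        then show ?thesis using p by simp
      qed (use p sum in auto)
    qed
    then have "finite {(i, l). f i j l \<noteq> 0}" by (rule finite_subset) (use finS in simp)
    then show False using that(1) by blast
  qed
  have "(i, j, l) \<in> ?S" using assms nz by simp
  from two[OF this] have "(j \<in> ?H2 \<or> i \<in> ?H1)" by blast
  then show False using 1 2 nz by blast
qed

text \<open>\<open>off1\<close>: the support contains a point at which only the first weight vanishes.\<close>

definition off1 :: bool where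
  "off1 \<longleftrightarrow> u = 0 \<and> (\<exists>j l. f 0 j l \<noteq> 0 \<and> v + of_int j \<noteq> 0 \<and> w + of_int l \<noteq> 0)"

definition off2 :: bool where
  "off2 \<longleftrightarrow> v = 0 \<and> (\<exists>i l. f i 0 l \<noteq> 0 \<and> u + of_int i \<noteq> 0 \<and> w + of_int l \<noteq> 0)"

definition off3 :: bool where
  "off3 \<longleftrightarrow> w = 0 \<and> (\<exists>i j. f i j 0 \<noteq> 0 \<and> u + of_int i \<noteq> 0 \<and> v + of_int j \<noteq> 0)"

text \<open>One point of this kind generates infinitely many: in \<open>next_point\<close> the term
  that moves the first index falls off the three lines, so a move in the second variable must be
  compensated by a move in the third. For a given \<open>k\<close> a point can then be chosen far
  enough from the origin that, in the invariance under \<open>L_k\<close> at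
  \<open>(e_{-k}, e_j, e_{-j})\<close>, only the term \<open>a k (- k) * f 0 j (- j)\<close>
  survives.\<close>

lemma off1D:
  assumes "off1"
  shows "structure_constants_0 a"
proof -
  obtain j0 l0 where u: "u = 0" and f0: "f 0 j0 l0 \<noteq> 0" "v + of_int j0 \<noteq> 0" "w + of_int l0 \<noteq> 0"
    using assms off1_def by blast
  have l0: "l0 = - j0" using index_sum[OF f0(1)] by simp
  let ?J = "{j. f 0 j (- j) \<noteq> 0}"
  have next_point: "f 0 (j0 - k) (k - j0) \<noteq> 0"
    if k: "k \<noteq> 0" "v + of_int (j0 - k) \<noteq> 0" "b k (j0 - k) \<noteq> 0" for k
  proof -
    have "f k (j0 - k) (- j0) = 0"
      using support_on_lines[of k "j0 - k" "- j0"] k u f0(3) l0 by auto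
    then have "b k (j0 - k) * f 0 j0 (- j0) + c k (- j0) * f 0 (j0 - k) (k - j0) = 0"
      using invariance[of 0 "j0 - k" "- j0" k] by (simp add: add.commute)
    then show ?thesis using k f0 l0 by auto
  qed
  have "infinite ?J"
  proof
    assume fin: "finite ?J"
    have "- {0, j0, - j0} \<subseteq> (\<lambda>j. j0 - j) ` ?J \<union> (\<lambda>j. j - j0) ` ?J"
    proof
      fix k assume k: "k \<in> - {0, j0, - j0}"
      then have "v + of_int (j0 - k) \<noteq> 0" "v + of_int (j0 + k) \<noteq> 0"
        using v_normal[of "j0 - k"] v_normal[of "j0 + k"] by auto
      then have "f 0 (j0 - k) (k - j0) \<noteq> 0 \<or> f 0 (j0 + k) (- k - j0) \<noteq> 0"
        using next_point[of k] next_point[of "- k"] B.some_nonzero_in[OF f0(2), of k] k by auto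
      moreover have "- (j0 + k) = - k - j0" "- (j0 - k) = k - j0" by simp_all
      ultimately consider "j0 - k \<in> ?J" | "j0 + k \<in> ?J" unfolding mem_Collect_eq by metis
      then show "k \<in> (\<lambda>j. j0 - j) ` ?J \<union> (\<lambda>j. j - j0) ` ?J"
      proof cases
        case 1
        then show ?thesis by (intro UnI1 image_eqI[of _ _ "j0 - k"]) auto
      next
        case 2
        then show ?thesis by (intro UnI2 image_eqI[of _ _ "j0 + k"]) auto
      qed
    qed
    then have "finite (- {0, j0, - j0})" by (rule finite_subset) (use fin in simp)
    then show False by simp
  qed
  have "a k (- k) = 0" if "k \<noteq> 0" for k
  proof -
    have "\<not> ?J \<subseteq> {0, k, - k} \<union> {j. v + of_int j = 0 \<or> v + of_int (j + k) = 0 \<or> w + of_int (- j + k) = 0}"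
    proof
      assume "?J \<subseteq> {0, k, - k} \<union> {j. v + of_int j = 0 \<or> v + of_int (j + k) = 0 \<or> w + of_int (- j + k) = 0}"
      also have "\<dots> \<subseteq> {0, k, - k}"
        using v_normal w_normal by fastforce
      finally show False using \<open>infinite ?J\<close> by (meson finite.emptyI finite.insertI finite_subset)
    qed
    then obtain j where j: "f 0 j (- j) \<noteq> 0" "v + of_int j \<noteq> 0" "v + of_int (j + k) \<noteq> 0"
      "w + of_int (- j + k) \<noteq> 0" by blast
    have "w + of_int (- j) \<noteq> 0" using weights_sum[of 0 j "- j"] u j(2) by auto
    then have "f (- k) (j + k) (- j) = 0" "f (- k) j (- j + k) = 0"
      using support_on_lines[of "- k" "j + k" "- j"] support_on_lines[of "- k" j "- j + k"] u j \<open>k \<noteq> 0\<close>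
      by auto
    then show ?thesis using invariance[of "- k" j "- j" k] j(1) by simp
  qed
  moreover have "a 0 0 = 0" using A.L0[of 0] u by simp
  ultimately have "a k (- k) = 0" for k by (cases "k = 0") auto
  then show ?thesis
    using A.structure_constants_axioms u
    by (simp add: structure_constants_0_def structure_constants_0_axioms_def)
qed

end

section \<open>Values of an invariant form on the three lines, and the resulting normal
  forms\<close>

definition eta_coeff :: "complex \<Rightarrow> complex \<Rightarrow> complex \<Rightarrow> int \<Rightarrow> int \<Rightarrow> complex" where
  "eta_coeff x y e i j = (if i = 0 then if j = 0 then e else y else if j = 0 then x else 0)"

text \<open>Here and in \<open>eta_coeff\<close> the parameter \<open>e\<close> is the value at the
  pair of weight-0 vectors. For \<open>eta_map x y\<close> it is \<open>x + y\<close>, although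
  invariance alone gives another value before rescaling; for \<open>Theta\<close> it is 0, and other
  values account for the added trivial map.\<close>

definition theta_coeff :: "complex \<Rightarrow> int \<Rightarrow> int \<Rightarrow> complex" where
  "theta_coeff e i j =
     (if i = 0 then if j = 0 then e else 1 / of_int j
      else if j = 0 then - 1 / of_int i else if i = - j then 1 / of_int j else 0)"

lemma quadratic_eqI:
  fixes p q p' q' :: complex
  assumes "\<forall>k :: int. k \<noteq> 0 \<longrightarrow> p * of_int k ^ 2 + q * of_int k = p' * of_int k ^ 2 + q' * of_int k"
  shows "p = p'" "q = q'"
proof -
  have 1: "p + q = p' + q'" and 2: "p - q = p' - q'"
    using assms[rule_format, of 1] assms[rule_format, of "- 1"] by simp_all
  have "2 * p = (p + q) + (p - q)" "2 * q = (p + q) - (p - q)" by simp_all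
  then have "2 * p = 2 * p'" "2 * q = 2 * q'" unfolding 1 2 by simp_all
  then show "p = p'" "q = q'" by simp_all
qed

lemma rescales_A_A:
  assumes "rescales r a (A_coeff \<xi>)" "s \<noteq> 0"
  shows "rescales (\<lambda>i. r i * (if i = 0 then s else 1)) a (A_coeff (fst \<xi> / s, snd \<xi> / s))"
  by (rule rescales_trans[OF assms(1) rescales_A[OF assms(2)]])

lemma invariant_formD:
  "invariant_form a b c f \<Longrightarrow> i + j + l + k = 0 \<Longrightarrow>
    a k i * f (i + k) j l + b k j * f i (j + k) l + c k l * f i j (l + k) = 0"
  by (simp add: invariant_form_def)

text \<open>Away from index 0 the action on an \<open>A\<close> is transitive:
  \<open>L_{m-j} e_j = m e_m\<close>. In the invariance at \<open>(e_0, e_j, e_{-m})\<close> the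
  term moving the first index lies off the three lines, so a zero at \<open>j\<close> spreads to
  every non-zero \<open>m\<close>.\<close>

lemma A_form_vanishing:
  assumes inv: "invariant_form a (A_coeff \<xi>) c f"
    and lines: "\<And>i j l. f i j l \<noteq> 0 \<Longrightarrow> i = 0 \<or> j = 0 \<or> l = 0"
    and "f 0 j (- j) = 0" "j \<noteq> 0" "m \<noteq> 0"
  shows "f 0 m (- m) = 0"
proof (cases "m = j")
  case False
  have "f (m - j) j (- m) = 0" using lines[of "m - j" j "- m"] assms(4,5) False by auto
  moreover have "a (m - j) 0 * f (0 + (m - j)) j (- m) + A_coeff \<xi> (m - j) j * f 0 (j + (m - j)) (- m)
      + c (m - j) (- m) * f 0 j (- m + (m - j)) = 0"
    by (rule invariant_formD[OF inv]) simp
  ultimately show ?thesis using assms(3-5) by (simp add: A_coeff_def)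
qed (use assms in simp)

text \<open>In the invariance under \<open>L_k\<close> at \<open>(e_0, e_{-k}, e_0)\<close> only the
  third term can survive, and its form value \<open>f 0 (- k) k\<close> is non-zero by
  \<open>A_form_vanishing\<close>. When \<open>c\<close> describes the dual of \<open>P\<close>, the
  conclusion says that \<open>P\<close> has a trivial quotient, so that it is again an
  \<open>A\<close>.\<close>

lemma A_A_form_from_0:
  assumes inv: "invariant_form (A_coeff \<xi>\<^sub>1) (A_coeff \<xi>\<^sub>2) c f"
    and lines: "\<And>i j l. f i j l \<noteq> 0 \<Longrightarrow> i = 0 \<or> j = 0 \<or> l = 0"
    and off1: "f 0 j (- j) \<noteq> 0" "j \<noteq> 0" and off3: "\<And>i j. f i j 0 \<noteq> 0 \<Longrightarrow> i = 0"
    and "k \<noteq> 0"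
  shows "c k 0 = 0"
proof -
  have "f 0 (- k) k \<noteq> 0"
    using A_form_vanishing[OF inv lines, of "- k" j] off1 \<open>k \<noteq> 0\<close> by auto
  moreover have "f k (- k) 0 = 0" using off3[of k "- k"] \<open>k \<noteq> 0\<close> by auto
  moreover have "A_coeff \<xi>\<^sub>1 k 0 * f (0 + k) (- k) 0 + A_coeff \<xi>\<^sub>2 k (- k) * f 0 (- k + k) 0
      + c k 0 * f 0 (- k) (0 + k) = 0"
    by (rule invariant_formD[OF inv]) simp
  ultimately show ?thesis using \<open>k \<noteq> 0\<close> by (simp add: A_coeff_def)
qed

text \<open>The third argument is the dual of an \<open>A\<close>. Restricted to first index 0 and
  non-zero second index, the form is an intertwining map between the submodules of two
  \<open>A\<close> spanned by the \<open>e_j\<close> with \<open>j \<noteq> 0\<close>; these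
  submodules have the same structure constants, and the map is a scalar.\<close>

lemma A_dual_A_form_constant:
  assumes inv: "invariant_form a (A_coeff \<xi>\<^sub>2) (dual_coeff (A_coeff \<xi>\<^sub>3)) f"
    and lines: "\<And>i j l. f i j l \<noteq> 0 \<Longrightarrow> i = 0 \<or> j = 0 \<or> l = 0"
    and "j \<noteq> 0"
  shows "f 0 j (- j) = f 0 1 (- 1)"
proof (cases "j = 1")
  case False
  have "f (j - 1) 1 (- j) = 0" using lines[of "j - 1" 1 "- j"] False \<open>j \<noteq> 0\<close> by auto
  moreover have "a (j - 1) 0 * f (0 + (j - 1)) 1 (- j) + A_coeff \<xi>\<^sub>2 (j - 1) 1 * f 0 (1 + (j - 1)) (- j)
      + dual_coeff (A_coeff \<xi>\<^sub>3) (j - 1) (- j) * f 0 1 (- j + (j - 1)) = 0"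
    by (rule invariant_formD[OF inv]) simp
  ultimately show ?thesis using \<open>j \<noteq> 0\<close> by (simp add: A_coeff_def dual_coeff_def)
qed simp

text \<open>Now the target is a \<open>B\<close>. The factor \<open>1 / j\<close> comes from the
  isomorphism \<open>e_j \<mapsto> e_j / j\<close> between the submodule of \<open>A\<close> spanned
  by the \<open>e_j\<close> with \<open>j \<noteq> 0\<close> and the quotient of \<open>B\<close> by
  the line of \<open>e_0\<close>.\<close>

lemma A_A_form_reciprocal:
  assumes inv: "invariant_form a (A_coeff \<xi>\<^sub>2) (A_coeff \<xi>\<^sub>3) f"
    and lines: "\<And>i j l. f i j l \<noteq> 0 \<Longrightarrow> i = 0 \<or> j = 0 \<or> l = 0"
    and "j \<noteq> 0"
  shows "f 0 j (- j) = f 0 1 (- 1) / of_int j"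
proof (cases "j = 1")
  case False
  have "f (j - 1) 1 (- j) = 0" using lines[of "j - 1" 1 "- j"] False \<open>j \<noteq> 0\<close> by auto
  moreover have "a (j - 1) 0 * f (0 + (j - 1)) 1 (- j) + A_coeff \<xi>\<^sub>2 (j - 1) 1 * f 0 (1 + (j - 1)) (- j)
      + A_coeff \<xi>\<^sub>3 (j - 1) (- j) * f 0 1 (- j + (j - 1)) = 0"
    by (rule invariant_formD[OF inv]) simp
  ultimately show ?thesis using \<open>j \<noteq> 0\<close> by (simp add: A_coeff_def field_simps)
qed simp

text \<open>Rescaling the zero weight vectors turns the value \<open>e\<close> at the corner into the sum of the
  other two coefficients, which is its value for \<^const>\<open>eta_map\<close>.\<close>

lemma eta_normalise:
  fixes \<xi>\<^sub>1 \<xi>\<^sub>2 \<xi>\<^sub>3 :: "complex \<times> complex"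
  assumes r: "rescales r a (A_coeff \<xi>\<^sub>1)" and s: "rescales s b (A_coeff \<xi>\<^sub>2)"
    and t: "rescales t c (A_coeff \<xi>\<^sub>3)"
    and g: "\<And>i j. g i j * t (i + j) = r i * s j * eta_coeff x y e i j"
    and xy: "x \<noteq> 0" "y \<noteq> 0"
    and rel: "x * fst \<xi>\<^sub>1 + y * fst \<xi>\<^sub>2 = e * fst \<xi>\<^sub>3" "x * snd \<xi>\<^sub>1 + y * snd \<xi>\<^sub>2 = e * snd \<xi>\<^sub>3"
  obtains s' t' \<xi>\<^sub>2' \<xi>\<^sub>3' x' where "rescales s' b (A_coeff \<xi>\<^sub>2')" "rescales t' c (A_coeff \<xi>\<^sub>3')"
    "\<And>i j. g i j * t' (i + j) = r i * s' j * eta_coeff x' y (x' + y) i j" "x' \<noteq> 0"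
    "x' * fst \<xi>\<^sub>1 + y * fst \<xi>\<^sub>2' = (x' + y) * fst \<xi>\<^sub>3'" "x' * snd \<xi>\<^sub>1 + y * snd \<xi>\<^sub>2' = (x' + y) * snd \<xi>\<^sub>3'"
proof -
  obtain \<mu> \<nu> where mn: "\<mu> \<noteq> 0" "\<nu> \<noteq> 0" "e * \<nu> = x + \<mu> * y"
  proof (cases "e = 0")
    case True
    then show ?thesis using that[of "- x / y" 1] xy by simp
  next
    case False
    \<comment> \<open>The value 2 is taken only if \<open>x + y = 0\<close>, where
      \<open>x + 2 * y = y\<close> is non-zero. A non-zero \<open>x + \<mu> * y\<close> is what
      makes \<open>\<nu>\<close> non-zero.\<close>
    define \<mu> where "\<mu> = (if x + y \<noteq> 0 then 1 else 2 :: complex)"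
    have "x + \<mu> * y \<noteq> 0"
    proof (cases "x + y = 0")
      case True
      then have "x + \<mu> * y = y" by (simp add: \<mu>_def algebra_simps)
      then show ?thesis using xy by simp
    qed (simp add: \<mu>_def)
    moreover have "\<mu> \<noteq> 0" by (simp add: \<mu>_def)
    ultimately show ?thesis using that[of \<mu> "(x + \<mu> * y) / e"] False by simp
  qed
  have corner: "e * \<nu> = \<mu> * (x / \<mu> + y)" using mn by (simp add: distrib_left)
  have rel': "x / \<mu> * z1 + y * (z2 / \<mu>) = (x / \<mu> + y) * (z3 / \<nu>)" if "x * z1 + y * z2 = e * z3" for z1 z2 z3
  proof -
    have "x / \<mu> * z1 + y * (z2 / \<mu>) = (x * z1 + y * z2) / \<mu>" by (simp add: add_divide_distrib)
    also have "\<dots> = (e * \<nu>) * z3 / (\<mu> * \<nu>)" using mn(1,2) that by simp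
    also have "\<dots> = (x / \<mu> + y) * (z3 / \<nu>)" unfolding corner using mn(1,2) by simp
    finally show ?thesis .
  qed
  show thesis
  proof (rule that[of "\<lambda>i. s i * (if i = 0 then \<mu> else 1)" "(fst \<xi>\<^sub>2 / \<mu>, snd \<xi>\<^sub>2 / \<mu>)"
        "\<lambda>i. t i * (if i = 0 then \<nu> else 1)" "(fst \<xi>\<^sub>3 / \<nu>, snd \<xi>\<^sub>3 / \<nu>)" "x / \<mu>"])
    show "g i j * (t (i + j) * (if i + j = 0 then \<nu> else 1))
        = r i * (s j * (if j = 0 then \<mu> else 1)) * eta_coeff (x / \<mu>) y (x / \<mu> + y) i j" for i j
    proof -
      have "g i j * (t (i + j) * (if i + j = 0 then \<nu> else 1))
          = r i * s j * (eta_coeff x y e i j * (if i + j = 0 then \<nu> else 1))"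
        using g[of i j] by simp
      also have "eta_coeff x y e i j * (if i + j = 0 then \<nu> else 1)
          = (if j = 0 then \<mu> else 1) * eta_coeff (x / \<mu>) y (x / \<mu> + y) i j"
        using corner mn by (auto simp: eta_coeff_def)
      finally show ?thesis by simp
    qed
  qed (use rescales_A_A[OF s] rescales_A_A[OF t] mn xy rel' rel in simp_all)
qed

context thin_invariant_form
begin

lemma off2D: "off2 \<Longrightarrow> structure_constants_0 b"
proof -
  interpret S: thin_invariant_form v b u a w c "\<lambda>j i l. f i j l" by (rule swap12)
  show "off2 \<Longrightarrow> structure_constants_0 b"
    using S.off1D unfolding S.off1_def off2_def .
qed

lemma off3D: "off3 \<Longrightarrow> structure_constants_0 c"
proof -
  interpret T: thin_invariant_form u a w c v b "\<lambda>i l j. f i j l" by (rule swap23)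
  show "off3 \<Longrightarrow> structure_constants_0 c"
    using T.off2D unfolding T.off2_def off3_def .
qed

lemma lines: "f i j l \<noteq> 0 \<Longrightarrow> i = 0 \<or> j = 0 \<or> l = 0"
  using support_on_lines u_normal v_normal w_normal by blast

lemma not_off1_corner:
  assumes "f i j l \<noteq> 0" "u + of_int i = 0" "\<not> off1"
  shows "v + of_int j = 0" "w + of_int l = 0"
proof -
  have i: "i = 0" "u = 0" using u_normal[OF assms(2)] assms(2) by simp_all
  have "(v + of_int j) + (w + of_int l) = 0"
    using weights_sum[OF index_sum[OF assms(1)]] assms(2) by simp
  moreover have "v + of_int j = 0 \<or> w + of_int l = 0"
    using assms i unfolding off1_def by blast
  ultimately show "v + of_int j = 0" "w + of_int l = 0" by auto
qed

lemma not_off2_corner: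
  assumes "f i j l \<noteq> 0" "v + of_int j = 0" "\<not> off2"
  shows "u + of_int i = 0" "w + of_int l = 0"
proof -
  interpret S: thin_invariant_form v b u a w c "\<lambda>j i l. f i j l" by (rule swap12)
  show "u + of_int i = 0" "w + of_int l = 0"
    using S.not_off1_corner[of i j l] assms unfolding S.off1_def off2_def by blast+
qed

lemma not_off3_corner:
  assumes "f i j l \<noteq> 0" "w + of_int l = 0" "\<not> off3"
  shows "u + of_int i = 0" "v + of_int j = 0"
proof -
  interpret T: thin_invariant_form u a w c v b "\<lambda>i l j. f i j l" by (rule swap23)
  show "u + of_int i = 0" "v + of_int j = 0"
    using T.not_off2_corner[of i j l] assms unfolding T.off2_def off3_def by blast+
qed

lemma off1_nonzero:
  assumes "off1"
  obtains j where "f 0 j (- j) \<noteq> 0" "v + of_int j \<noteq> 0" "j \<noteq> 0 \<or> v \<noteq> 0"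
proof -
  obtain j l where jl: "f 0 j l \<noteq> 0" "v + of_int j \<noteq> 0" using assms off1_def by blast
  then have "l = - j" using index_sum[of 0 j l] by simp
  with jl show thesis by (intro that[of j]) auto
qed

lemma no_off:
  assumes "\<not> off1" "\<not> off2" "\<not> off3" "f i j l \<noteq> 0"
  shows "u = 0 \<and> v = 0 \<and> w = 0 \<and> i = 0 \<and> j = 0 \<and> l = 0"
proof -
  have "u + of_int i = 0 \<and> v + of_int j = 0 \<and> w + of_int l = 0"
    using support_on_lines[OF assms(4)] not_off1_corner not_off2_corner not_off3_corner assms by blast
  then show ?thesis using u_normal v_normal w_normal by fastforce
qed

text \<open>The form lives at the origin only, so the invariance under \<open>L_k\<close> at
  \<open>(e_{-k}, e_0, e_0)\<close> reduces to \<open>a k (- k) * f 0 0 0 = 0\<close>.\<close>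

lemma no_off_trivial_quotient:
  assumes "\<not> off1" "\<not> off2" "\<not> off3" "f i j l \<noteq> 0"
  shows "structure_constants_0 a"
proof -
  have z: "f i j l = 0" if "i \<noteq> 0 \<or> j \<noteq> 0 \<or> l \<noteq> 0" for i j l
    using no_off[OF assms(1-3), of i j l] that by blast
  have u: "u = 0" "f 0 0 0 \<noteq> 0" using no_off[OF assms] assms(4) by auto
  have "a k (- k) = 0" for k
  proof (cases "k = 0")
    case False
    then show ?thesis using invariance[of "- k" 0 0 k] u z[of "- k"] by simp
  qed (use A.L0[of 0] u in simp)
  then show ?thesis
    using A.structure_constants_axioms u
    by (simp add: structure_constants_0_def structure_constants_0_axioms_def)
qed

lemma no_off_normal_form:
  assumes "\<not> off1" "\<not> off2" "\<not> off3" "f i j l \<noteq> 0"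
  obtains r s t \<xi>\<^sub>1 \<xi>\<^sub>2 \<xi>\<^sub>3 where "rescales r a (A_coeff \<xi>\<^sub>1)" "rescales s b (A_coeff \<xi>\<^sub>2)"
    "rescales t (dual_coeff c) (B_coeff \<xi>\<^sub>3)" "\<And>i j l. i \<noteq> 0 \<or> j \<noteq> 0 \<Longrightarrow> f i j l = 0"
proof -
  interpret S: thin_invariant_form v b u a w c "\<lambda>j i l. f i j l" by (rule swap12)
  interpret T: thin_invariant_form u a w c v b "\<lambda>i l j. f i j l" by (rule swap23)
  interpret TS: thin_invariant_form w c u a v b "\<lambda>l i j. f i j l" by (rule T.swap12)
  have S_off: "S.off1 \<longleftrightarrow> off2" "S.off2 \<longleftrightarrow> off1" "S.off3 \<longleftrightarrow> off3"
    unfolding S.off1_def S.off2_def S.off3_def off1_def off2_def off3_def by blast+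
  have TS_off: "TS.off1 \<longleftrightarrow> off3" "TS.off2 \<longleftrightarrow> off1" "TS.off3 \<longleftrightarrow> off2"
    unfolding TS.off1_def TS.off2_def TS.off3_def off1_def off2_def off3_def by blast+
  have "structure_constants_0 b"
    using S.no_off_trivial_quotient[of i j l] assms unfolding S_off by blast
  moreover have "structure_constants_0 c"
    using TS.no_off_trivial_quotient[of i j l] assms unfolding TS_off by blast
  ultimately obtain r s t \<xi>\<^sub>1 \<xi>\<^sub>2 \<xi>\<^sub>3 where "rescales r a (A_coeff \<xi>\<^sub>1)"
    "rescales s b (A_coeff \<xi>\<^sub>2)" "rescales t c (A_coeff \<xi>\<^sub>3)"
    using structure_constants_0.rescales_to_A no_off_trivial_quotient[OF assms] by metis
  then show thesis
    using that[of r \<xi>\<^sub>1 s \<xi>\<^sub>2 "\<lambda>i. 1 / t (- i)" "(- fst \<xi>\<^sub>3, - snd \<xi>\<^sub>3)"] no_off[OF assms(1-3)]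
      rescales_dual[of t c "A_coeff \<xi>\<^sub>3"] unfolding dual_coeff_A by blast
qed

text \<open>All of the support has first index 0, so \<open>j \<mapsto> f 0 j (- j)\<close> gives an
  intertwining map from \<open>N\<close> to \<open>P\<close>. Its zeros form an invariant set that
  misses a non-zero weight, and \<open>invariant_cases\<close> leaves only the weight 0.\<close>

lemma only_off1_normal_form:
  assumes "off1" "\<not> off2" "\<not> off3"
  obtains r \<xi> where "rescales r a (A_coeff \<xi>)"
    "\<And>i j l. i \<noteq> 0 \<Longrightarrow> f i j l = 0"
    "\<And>k j. b k j * f 0 (j + k) (- j - k) = dual_coeff c k j * f 0 j (- j)"
    "\<And>j. f 0 j (- j) = 0 \<Longrightarrow> v + of_int j = 0"
proof -
  interpret S: structure_constants_0 a using off1D[OF assms(1)] .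
  obtain r \<xi> where r: "rescales r a (A_coeff \<xi>)" using S.rescales_to_A .
  have i0: "f i j l = 0" if "i \<noteq> 0" for i j l
  proof (rule ccontr)
    assume nz: "f i j l \<noteq> 0"
    have "u + of_int i = 0"
      using support_on_lines[OF nz] not_off2_corner[OF nz] not_off3_corner[OF nz] assms by blast
    then show False using u_normal that by blast
  qed
  have inter: "b k j * f 0 (j + k) (- j - k) = dual_coeff c k j * f 0 j (- j)" for k j
  proof -
    have "a k 0 * f k j (- j - k) = 0" using i0[of k] S.L0[of 0] by (cases "k = 0") auto
    then show ?thesis
      using invariance[of 0 j "- j - k" k] by (auto simp: dual_coeff_def eq_neg_iff_add_eq_0)
  qed
  have "invariant_indices b {j. f 0 j (- j) = 0}"
    unfolding invariant_indices_def
  proof (intro allI impI, unfold mem_Collect_eq)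
    fix k j assume "f 0 j (- j) = 0" "b k j \<noteq> 0"
    moreover have "- (j + k) = - j - k" by simp
    ultimately show "f 0 (j + k) (- (j + k)) = 0" using inter[of k j] by simp
  qed
  then have "v + of_int j = 0" if "f 0 j (- j) = 0" for j
    using off1_nonzero[OF assms(1)] B.invariant_cases that by blast
  with r i0 inter that show thesis by blast
qed

lemma off12_weights:
  assumes "off1" "off2"
  shows "u = 0" "v = 0" "w = 0"
proof -
  show "u = 0" "v = 0" using assms unfolding off1_def off2_def by blast+
  then show "w = 0" using weight_sum by simp
qed

lemma off12_normal_form:
  assumes "off1" "off2" "\<not> off3"
  obtains r s t \<xi>\<^sub>1 \<xi>\<^sub>2 \<xi>\<^sub>3 x y where
    "rescales r a (A_coeff \<xi>\<^sub>1)" "rescales s b (A_coeff \<xi>\<^sub>2)"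
    "rescales t (dual_coeff c) (A_coeff \<xi>\<^sub>3)"
    "\<And>i j. f i j (- i - j) * t (i + j) = r i * s j * eta_coeff x y (x + y) i j"
    "x \<noteq> 0" "y \<noteq> 0"
    "x * fst \<xi>\<^sub>1 + y * fst \<xi>\<^sub>2 = (x + y) * fst \<xi>\<^sub>3" "x * snd \<xi>\<^sub>1 + y * snd \<xi>\<^sub>2 = (x + y) * snd \<xi>\<^sub>3"
proof -
  have uvw: "u = 0" "v = 0" "w = 0" using off12_weights[OF assms(1,2)] by simp_all
  interpret A0: structure_constants_0 a using off1D[OF assms(1)] .
  interpret B0: structure_constants_0 b using off2D[OF assms(2)] .
  obtain r \<xi>\<^sub>1 where r: "rescales r a (A_coeff \<xi>\<^sub>1)" using A0.rescales_to_A .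
  obtain s \<xi>\<^sub>2 where s: "rescales s b (A_coeff \<xi>\<^sub>2)" using B0.rescales_to_A .
  have nz: "r i \<noteq> 0" "s i \<noteq> 0" for i using r s by (simp_all add: rescales_def)
  obtain j where j: "f 0 j (- j) \<noteq> 0" "j \<noteq> 0" using off1_nonzero[OF assms(1)] uvw by blast
  have off3: "i = 0" if "f i j 0 \<noteq> 0" for i j
    using not_off3_corner[OF that _ assms(3)] uvw by simp
  have "c k 0 = 0" if "k \<noteq> 0" for k
  proof (rule A_A_form_from_0[OF invariant_form_rescale[OF invariant r s rescales_refl] _ _ j(2) _ that])
    show "f 0 j (- j) / (r 0 * s j * 1) \<noteq> 0" using j nz by simp
    show "i = 0 \<or> j = 0 \<or> l = 0" if "f i j l / (r i * s j * 1) \<noteq> 0" for i j l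
      using lines[of i j l] that by auto
    show "i = 0" if "f i j 0 / (r i * s j * 1) \<noteq> 0" for i j
      using off3[of i j] that by auto
  qed
  moreover have "c 0 0 = 0" using C.L0[of 0] uvw by simp
  ultimately have "c k 0 = 0" for k by (cases "k = 0") auto
  then have "structure_constants_0 (dual_coeff c)"
    using C.dual uvw
    by (simp add: structure_constants_0_def structure_constants_0_axioms_def dual_coeff_def[of c _ "- _"])
  then obtain t \<xi>\<^sub>3 where t: "rescales t (dual_coeff c) (A_coeff \<xi>\<^sub>3)"
    by (rule structure_constants_0.rescales_to_A)
  define h where "h i j l = f i j l / (r i * s j * (1 / t (- l)))" for i j l
  have "rescales (\<lambda>i. 1 / t (- i)) c (dual_coeff (A_coeff \<xi>\<^sub>3))"
    using rescales_dual[OF t] by simp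
  from invariant_form_rescale[OF invariant r s this]
  have inv: "invariant_form (A_coeff \<xi>\<^sub>1) (A_coeff \<xi>\<^sub>2) (dual_coeff (A_coeff \<xi>\<^sub>3)) h"
    unfolding h_def .
  have h_lines: "i = 0 \<or> j = 0 \<or> l = 0" if "h i j l \<noteq> 0" for i j l
    using lines[of i j l] that by (auto simp: h_def)
  have inv': "invariant_form (A_coeff \<xi>\<^sub>2) (A_coeff \<xi>\<^sub>1) (dual_coeff (A_coeff \<xi>\<^sub>3)) (\<lambda>j i l. h i j l)"
    using inv by (rule invariant_form_swap12)
  define x y e where "x = h 1 0 (- 1)" and "y = h 0 1 (- 1)" and "e = h 0 0 0"
  have hy: "h 0 j (- j) = y" if "j \<noteq> 0" for j
    using A_dual_A_form_constant[OF inv h_lines that] by (simp add: y_def)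
  have hx: "h i 0 (- i) = x" if "i \<noteq> 0" for i
    using A_dual_A_form_constant[OF inv', of i] h_lines that unfolding x_def by blast
  have tnz: "t i \<noteq> 0" for i using t by (simp add: rescales_def)
  have "y \<noteq> 0" using hy[OF j(2)] j nz tnz by (auto simp: h_def)
  have "x \<noteq> 0"
  proof -
    obtain i l where il: "f i 0 l \<noteq> 0" "u + of_int i \<noteq> 0" using assms(2) off2_def by blast
    then have "i \<noteq> 0" "l = - i" using uvw index_sum[of i 0 l] by auto
    then show ?thesis using hx[of i] il nz tnz by (auto simp: h_def)
  qed
  \<comment> \<open>The invariance under \<open>L_k\<close> at \<open>(e_0, e_0, e_{-k})\<close> is
    what ties the three points together. It is the linear relation in the definition of
    \<open>\<eta>\<close>, with the corner value \<open>e\<close> in the place of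
    \<open>z\<close>.\<close>
  have "x * A_coeff \<xi>\<^sub>1 k 0 + y * A_coeff \<xi>\<^sub>2 k 0 = e * A_coeff \<xi>\<^sub>3 k 0" if "k \<noteq> 0" for k
  proof -
    have "A_coeff \<xi>\<^sub>1 k 0 * h (0 + k) 0 (- k) + A_coeff \<xi>\<^sub>2 k 0 * h 0 (0 + k) (- k)
        + dual_coeff (A_coeff \<xi>\<^sub>3) k (- k) * h 0 0 (- k + k) = 0"
      by (rule invariant_formD[OF inv]) simp
    then have "A_coeff \<xi>\<^sub>1 k 0 * x + A_coeff \<xi>\<^sub>2 k 0 * y - A_coeff \<xi>\<^sub>3 k 0 * e = 0"
      using hx[OF that] hy[OF that] by (simp add: e_def dual_coeff_def)
    then show ?thesis by (simp add: mult.commute)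
  qed
  then have "\<forall>k :: int. k \<noteq> 0 \<longrightarrow> (x * fst \<xi>\<^sub>1 + y * fst \<xi>\<^sub>2) * of_int k ^ 2 + (x * snd \<xi>\<^sub>1 + y * snd \<xi>\<^sub>2) * of_int k
      = (e * fst \<xi>\<^sub>3) * of_int k ^ 2 + (e * snd \<xi>\<^sub>3) * of_int k"
    by (simp add: A_coeff_def algebra_simps)
  note rel = quadratic_eqI[OF this]
  have g: "f i j (- i - j) * t (i + j) = r i * s j * eta_coeff x y e i j" for i j
  proof -
    have "h i j (- i - j) = eta_coeff x y e i j"
    proof -
      consider "i = 0" "j = 0" | "i = 0" "j \<noteq> 0" | "i \<noteq> 0" "j = 0" | "i \<noteq> 0" "j \<noteq> 0" by blast
      then show ?thesis
      proof cases
        case 4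
        have "h i j (- i - j) = 0"
        proof (rule ccontr)
          assume nz: "h i j (- i - j) \<noteq> 0"
          then have "- i - j = 0" using h_lines 4 by blast
          then show False using nz off3[of i j] 4 by (auto simp: h_def)
        qed
        then show ?thesis using 4 by (simp add: eta_coeff_def)
      qed (simp_all add: eta_coeff_def hx hy e_def)
    qed
    moreover have "h i j (- i - j) = f i j (- i - j) * t (i + j) / (r i * s j)"
      by (simp add: h_def add.commute)
    ultimately show ?thesis using nz[of i] nz[of j] by (simp add: field_simps)
  qed
  show thesis
    by (rule eta_normalise[OF r s t g \<open>x \<noteq> 0\<close> \<open>y \<noteq> 0\<close> rel])
      (rule that[OF r _ _ _ _ \<open>y \<noteq> 0\<close>], assumption+)
qed

lemma off123_normal_form:
  assumes "off1" "off2" "off3"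
  obtains r s t \<xi> e where
    "rescales r a (A_coeff \<xi>)" "rescales s b (A_coeff \<xi>)" "rescales t (dual_coeff c) (B_coeff \<xi>)"
    "\<And>i j. f i j (- i - j) * t (i + j) = r i * s j * theta_coeff e i j"
proof -
  have uvw: "u = 0" "v = 0" "w = 0" using off12_weights[OF assms(1,2)] by simp_all
  obtain r \<xi>\<^sub>1 where r: "rescales r a (A_coeff \<xi>\<^sub>1)"
    using structure_constants_0.rescales_to_A[OF off1D[OF assms(1)]] .
  obtain s \<xi>\<^sub>2 where s: "rescales s b (A_coeff \<xi>\<^sub>2)"
    using structure_constants_0.rescales_to_A[OF off2D[OF assms(2)]] .
  obtain t \<xi>\<^sub>3 where t: "rescales t c (A_coeff \<xi>\<^sub>3)"
    using structure_constants_0.rescales_to_A[OF off3D[OF assms(3)]] .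
  have nz: "r i \<noteq> 0" "s i \<noteq> 0" "t i \<noteq> 0" for i using r s t by (simp_all add: rescales_def)
  define h where "h i j l = f i j l / (r i * s j * t l)" for i j l
  from invariant_form_rescale[OF invariant r s t]
  have inv: "invariant_form (A_coeff \<xi>\<^sub>1) (A_coeff \<xi>\<^sub>2) (A_coeff \<xi>\<^sub>3) h"
    unfolding h_def .
  have h_lines: "i = 0 \<or> j = 0 \<or> l = 0" if "h i j l \<noteq> 0" for i j l
    using lines[of i j l] that by (auto simp: h_def)
  define X Y Z e where "X = h 1 0 (- 1)" and "Y = h 0 1 (- 1)" and "Z = h 1 (- 1) 0" and "e = h 0 0 0"
  have hY: "h 0 j (- j) = Y / of_int j" if "j \<noteq> 0" for j
    using A_A_form_reciprocal[OF inv h_lines that] by (simp add: Y_def)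
  have hX: "h i 0 (- i) = X / of_int i" if "i \<noteq> 0" for i
    using A_A_form_reciprocal[OF invariant_form_swap12[OF inv], of i] h_lines that
    unfolding X_def by blast
  have hZ: "h i (- i) 0 = Z / of_int i" if "i \<noteq> 0" for i
    using A_A_form_reciprocal[OF invariant_form_swap12[OF invariant_form_swap23[OF inv]], of i] h_lines that
    unfolding Z_def by blast
  have "Y \<noteq> 0"
  proof -
    obtain j where "f 0 j (- j) \<noteq> 0" "j \<noteq> 0" using off1_nonzero[OF assms(1)] uvw by blast
    then show ?thesis using hY[of j] nz by (auto simp: h_def)
  qed
  have "X \<noteq> 0"
  proof -
    obtain i l where il: "f i 0 l \<noteq> 0" "u + of_int i \<noteq> 0" using assms(2) off2_def by blast
    then have "i \<noteq> 0" "l = - i" using uvw index_sum[of i 0 l] by auto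
    then show ?thesis using hX[of i] il nz by (auto simp: h_def)
  qed
  have "Z \<noteq> 0"
  proof -
    obtain i j where ij: "f i j 0 \<noteq> 0" "u + of_int i \<noteq> 0" using assms(3) off3_def by blast
    then have "i \<noteq> 0" "j = - i" using uvw index_sum[of i j 0] by auto
    then show ?thesis using hZ[of i] ij nz by (auto simp: h_def)
  qed
  \<comment> \<open>At \<open>(e_0, e_0, e_{-k})\<close>, and below at
    \<open>(e_0, e_{-k}, e_0)\<close>, the actions out of index 0 of two modules meet while the
    third module contributes nothing. This makes the three pairs of coordinates
    proportional.\<close>
  have rel1: "A_coeff \<xi>\<^sub>2 k 0 * Y = - A_coeff \<xi>\<^sub>1 k 0 * X" if "k \<noteq> 0" for k
  proof -
    have "A_coeff \<xi>\<^sub>1 k 0 * h (0 + k) 0 (- k) + A_coeff \<xi>\<^sub>2 k 0 * h 0 (0 + k) (- k)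
        + A_coeff \<xi>\<^sub>3 k (- k) * h 0 0 (- k + k) = 0"
      by (rule invariant_formD[OF inv]) simp
    moreover have "A_coeff \<xi>\<^sub>3 k (- k) = 0" using that by (simp add: A_coeff_def)
    ultimately have "(A_coeff \<xi>\<^sub>1 k 0 * X + A_coeff \<xi>\<^sub>2 k 0 * Y) / of_int k = 0"
      using hX[OF that] hY[OF that] by (simp add: add_divide_distrib)
    then have "A_coeff \<xi>\<^sub>1 k 0 * X + A_coeff \<xi>\<^sub>2 k 0 * Y = 0" using that by simp
    then show ?thesis by (simp add: eq_neg_iff_add_eq_0 add.commute)
  qed
  have rel2: "A_coeff \<xi>\<^sub>3 k 0 * Y = A_coeff \<xi>\<^sub>1 k 0 * Z" if "k \<noteq> 0" for k
  proof -
    have "A_coeff \<xi>\<^sub>1 k 0 * h (0 + k) (- k) 0 + A_coeff \<xi>\<^sub>2 k (- k) * h 0 (- k + k) 0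
        + A_coeff \<xi>\<^sub>3 k 0 * h 0 (- k) (0 + k) = 0"
      by (rule invariant_formD[OF inv]) simp
    moreover have "A_coeff \<xi>\<^sub>2 k (- k) = 0" using that by (simp add: A_coeff_def)
    ultimately have "(A_coeff \<xi>\<^sub>1 k 0 * Z - A_coeff \<xi>\<^sub>3 k 0 * Y) / of_int k = 0"
      using hZ[OF that] hY[of "- k"] that by (simp add: diff_divide_distrib)
    then show ?thesis using that by simp
  qed
  \<comment> \<open>Scaling the weight-0 vectors of \<open>M\<close>, \<open>N\<close> and
    \<open>P\<close> by \<open>Y\<close>, \<open>- X\<close> and \<open>- 1 / Z\<close> turns the
    values on the three lines into those of \<open>Theta\<close>. By the two relations above, the
    same factors bring the three pairs of coordinates to a common value.\<close>
  define \<xi> where "\<xi> = (fst \<xi>\<^sub>1 / Y, snd \<xi>\<^sub>1 / Y)"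
  have \<xi>2: "(fst \<xi>\<^sub>2 / - X, snd \<xi>\<^sub>2 / - X) = \<xi>"
  proof -
    have "\<forall>k :: int. k \<noteq> 0 \<longrightarrow> (fst \<xi>\<^sub>2 * Y) * of_int k ^ 2 + (snd \<xi>\<^sub>2 * Y) * of_int k
        = (- fst \<xi>\<^sub>1 * X) * of_int k ^ 2 + (- snd \<xi>\<^sub>1 * X) * of_int k"
      using rel1 by (simp add: A_coeff_def algebra_simps)
    note quadratic_eqI[OF this]
    then show ?thesis
      using \<open>X \<noteq> 0\<close> \<open>Y \<noteq> 0\<close> by (simp add: \<xi>_def divide_simps)
  qed
  have \<xi>3: "(- fst \<xi>\<^sub>3 * (- 1 / Z), - snd \<xi>\<^sub>3 * (- 1 / Z)) = \<xi>"
  proof -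
    have "\<forall>k :: int. k \<noteq> 0 \<longrightarrow> (fst \<xi>\<^sub>3 * Y) * of_int k ^ 2 + (snd \<xi>\<^sub>3 * Y) * of_int k
        = (fst \<xi>\<^sub>1 * Z) * of_int k ^ 2 + (snd \<xi>\<^sub>1 * Z) * of_int k"
      using rel2 by (simp add: A_coeff_def algebra_simps)
    note quadratic_eqI[OF this]
    then show ?thesis
      using \<open>Z \<noteq> 0\<close> \<open>Y \<noteq> 0\<close> by (simp add: \<xi>_def divide_simps)
  qed
  have "rescales (\<lambda>i. 1 / t (- i)) (dual_coeff c) (B_coeff (- fst \<xi>\<^sub>3, - snd \<xi>\<^sub>3))"
    using rescales_dual[OF t] by (simp add: dual_coeff_A)
  from rescales_trans[OF this rescales_B[of "- 1 / Z" "(- fst \<xi>\<^sub>3, - snd \<xi>\<^sub>3)"]]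
  have t': "rescales (\<lambda>i. 1 / t (- i) * (if i = 0 then - 1 / Z else 1)) (dual_coeff c) (B_coeff \<xi>)"
    using \<open>Z \<noteq> 0\<close> \<xi>3 by simp
  have r': "rescales (\<lambda>i. r i * (if i = 0 then Y else 1)) a (A_coeff \<xi>)"
    using rescales_A_A[OF r \<open>Y \<noteq> 0\<close>] by (simp add: \<xi>_def)
  have s': "rescales (\<lambda>i. s i * (if i = 0 then - X else 1)) b (A_coeff \<xi>)"
    using rescales_A_A[OF s, of "- X"] \<open>X \<noteq> 0\<close> \<xi>2 by simp
  have key: "h i j (- i - j) * (if i + j = 0 then - 1 / Z else 1)
      = (if i = 0 then Y else 1) * (if j = 0 then - X else 1) * theta_coeff (e / (X * Y * Z)) i j" for i j
  proof -
    consider "i = 0" "j = 0" | "i = 0" "j \<noteq> 0" | "i \<noteq> 0" "j = 0" | "i \<noteq> 0" "j \<noteq> 0" "i = - j"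
      | "i \<noteq> 0" "j \<noteq> 0" "i \<noteq> - j" by blast
    then show ?thesis
    proof cases
      case 1
      then show ?thesis using \<open>X \<noteq> 0\<close> \<open>Y \<noteq> 0\<close> \<open>Z \<noteq> 0\<close> by (simp add: theta_coeff_def e_def)
    next
      case 2
      then show ?thesis by (simp add: theta_coeff_def hY)
    next
      case 3
      then show ?thesis by (simp add: theta_coeff_def hX)
    next
      case 4
      then show ?thesis using hZ[of i] \<open>Z \<noteq> 0\<close> by (simp add: theta_coeff_def)
    next
      case 5
      then have "i + j \<noteq> 0" by linarith
      then have "h i j (- i - j) = 0" using h_lines[of i j "- i - j"] 5 by auto
      then show ?thesis using 5 by (simp add: theta_coeff_def)
    qed
  qed
  have "f i j (- i - j) * (1 / t (- (i + j)) * (if i + j = 0 then - 1 / Z else 1))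
      = r i * (if i = 0 then Y else 1) * (s j * (if j = 0 then - X else 1)) * theta_coeff (e / (X * Y * Z)) i j" for i j
  proof -
    have "- (i + j) = - i - j" by simp
    then have "f i j (- i - j) * (1 / t (- (i + j))) = r i * s j * h i j (- i - j)"
      using nz[of i] nz[of j] by (simp add: h_def)
    then have "f i j (- i - j) * (1 / t (- (i + j)) * (if i + j = 0 then - 1 / Z else 1))
        = r i * s j * (h i j (- i - j) * (if i + j = 0 then - 1 / Z else 1))"
      by (simp only: mult.assoc[symmetric])
    then show ?thesis unfolding key by (simp only: mult.assoc mult.left_commute)
  qed
  then show thesis using that[OF r' s' t'] by blast
qed

end

section \<open>Bilinear maps that add indices\<close>

lemma lookup_zscale [simp]: "Poly_Mapping.lookup (zscale c v) i = c * Poly_Mapping.lookup v i"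
  by (simp add: zscale_def map.rep_eq when_def)

lemma lookup_basis_vec: "Poly_Mapping.lookup (basis_vec n) i = (if i = n then 1 else 0)"
  by (simp add: basis_vec_def lookup_single when_def)

lemma vector_space_zscale: "vector_space zscale"
  by unfold_locales (auto intro!: poly_mapping_eqI simp: lookup_add algebra_simps)

lemma zscale_0 [simp]: "zscale 0 v = 0"
  by (rule poly_mapping_eqI) simp

lemma zvec_induct [case_names zero basis add scale]:
  assumes "P 0" "\<And>i. P (basis_vec i)" "\<And>v w. P v \<Longrightarrow> P w \<Longrightarrow> P (v + w)"
    "\<And>c v. P v \<Longrightarrow> P (zscale c v)"
  shows "P v"
proof -
  have "P (\<Sum>i\<in>I. zscale (Poly_Mapping.lookup v i) (basis_vec i))" if "finite I" for I
    using that by (induction I) (simp_all add: assms)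
  moreover have "v = (\<Sum>i\<in>Poly_Mapping.keys v. zscale (Poly_Mapping.lookup v i) (basis_vec i))"
    by (rule poly_mapping_eqI) (simp add: lookup_sum lookup_basis_vec in_keys_iff if_distrib cong: if_cong)
  ultimately show ?thesis by (metis finite_keys)
qed

definition bilinear :: "(zvec \<Rightarrow> zvec \<Rightarrow> zvec) \<Rightarrow> bool" where
  "bilinear F \<longleftrightarrow>
     (\<forall>v v' w. F (v + v') w = F v w + F v' w) \<and> (\<forall>v w w'. F v (w + w') = F v w + F v w') \<and>
     (\<forall>c v w. F (zscale c v) w = zscale c (F v w)) \<and> (\<forall>c v w. F v (zscale c w) = zscale c (F v w))"

lemma bilinear_eqI:
  assumes F: "bilinear F" and G: "bilinear G"
    and eq: "\<And>i j. F (basis_vec i) (basis_vec j) = G (basis_vec i) (basis_vec j)"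
  shows "F v w = G v w"
proof (induction v rule: zvec_induct)
  case zero
  have "F (zscale 0 0) w = G (zscale 0 0) w"
    using F G unfolding bilinear_def by (metis zscale_0)
  then show ?case by simp
next
  case (basis i)
  show ?case
  proof (induction w rule: zvec_induct)
    case zero
    have "F (basis_vec i) (zscale 0 0) = G (basis_vec i) (zscale 0 0)"
      using F G unfolding bilinear_def by (metis zscale_0)
    then show ?case by simp
  qed (use F G eq in \<open>simp_all add: bilinear_def\<close>)
qed (use F G in \<open>simp_all add: bilinear_def\<close>)

text \<open>One construction serves as the action on a module, as a weight-preserving bilinear map
  and as the source of the dual pairing, so that bilinearity and the coefficient formula are
  established once.\<close>

definition graded_product :: "(int \<Rightarrow> int \<Rightarrow> complex) \<Rightarrow> zvec \<Rightarrow> zvec \<Rightarrow> zvec" where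
  "graded_product f = bilinear_extension (\<lambda>i j. zscale (f i j) (basis_vec (i + j)))"

lemma lookup_graded_product:
  assumes "finite I" "Poly_Mapping.keys v \<subseteq> I"
  shows "Poly_Mapping.lookup (graded_product f v w) n =
    (\<Sum>i\<in>I. Poly_Mapping.lookup v i * Poly_Mapping.lookup w (n - i) * f i (n - i))"
proof -
  have inner: "(\<Sum>j\<in>Poly_Mapping.keys w. Poly_Mapping.lookup v i * Poly_Mapping.lookup w j *
      (f i j * (if n = i + j then 1 else 0)))
    = Poly_Mapping.lookup v i * Poly_Mapping.lookup w (n - i) * f i (n - i)" for i
  proof -
    have "(\<Sum>j\<in>Poly_Mapping.keys w. Poly_Mapping.lookup v i * Poly_Mapping.lookup w j *
      (f i j * (if n = i + j then 1 else 0))) =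
      (\<Sum>j\<in>Poly_Mapping.keys w. if j = n - i
        then Poly_Mapping.lookup v i * Poly_Mapping.lookup w (n - i) * f i (n - i) else 0)"
      by (rule sum.cong) (auto simp: algebra_simps)
    then show ?thesis by (simp add: in_keys_iff)
  qed
  have "Poly_Mapping.lookup (graded_product f v w) n =
    (\<Sum>i\<in>Poly_Mapping.keys v. Poly_Mapping.lookup v i * Poly_Mapping.lookup w (n - i) * f i (n - i))"
    by (simp add: graded_product_def bilinear_extension_def lookup_sum lookup_basis_vec inner)
  also have "\<dots> = (\<Sum>i\<in>I. Poly_Mapping.lookup v i * Poly_Mapping.lookup w (n - i) * f i (n - i))"
    by (rule sum.mono_neutral_left) (use assms in \<open>auto simp: in_keys_iff\<close>)
  finally show ?thesis .
qed

lemma bilinear_graded_product: "bilinear (graded_product f)"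
  unfolding bilinear_def
proof (intro conjI allI)
  fix v v' w w' :: zvec and c
  let ?I = "Poly_Mapping.keys v \<union> Poly_Mapping.keys v'"
  have *: "finite ?I" "Poly_Mapping.keys v \<subseteq> ?I" "Poly_Mapping.keys v' \<subseteq> ?I"
    "Poly_Mapping.keys (v + v') \<subseteq> ?I" "Poly_Mapping.keys (zscale c v) \<subseteq> ?I"
    using Poly_Mapping.keys_add[of v v'] by (auto simp: in_keys_iff)
  show "graded_product f (v + v') w = graded_product f v w + graded_product f v' w"
    by (rule poly_mapping_eqI)
      (simp add: lookup_add lookup_graded_product[OF *(1,2)] lookup_graded_product[OF *(1,3)]
        lookup_graded_product[OF *(1,4)] sum.distrib[symmetric] distrib_right)
  show "graded_product f v (w + w') = graded_product f v w + graded_product f v w'"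
    by (rule poly_mapping_eqI)
      (simp add: lookup_add lookup_graded_product[OF *(1,2)] sum.distrib[symmetric] distrib_left distrib_right)
  show "graded_product f (zscale c v) w = zscale c (graded_product f v w)"
    by (rule poly_mapping_eqI)
      (simp add: lookup_graded_product[OF *(1,2)] lookup_graded_product[OF *(1,5)]
        sum_distrib_left mult.assoc mult.left_commute)
  show "graded_product f v (zscale c w) = zscale c (graded_product f v w)"
    by (rule poly_mapping_eqI)
      (simp add: lookup_graded_product[OF *(1,2)] sum_distrib_left mult.assoc mult.left_commute)
qed

lemma graded_product_basis:
  "graded_product f (basis_vec i) (basis_vec j) = zscale (f i j) (basis_vec (i + j))"
proof (rule poly_mapping_eqI)
  fix n
  have "Poly_Mapping.keys (basis_vec i) \<subseteq> {i}" by (simp add: basis_vec_def)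
  from lookup_graded_product[OF _ this, of f "basis_vec j" n]
  show "Poly_Mapping.lookup (graded_product f (basis_vec i) (basis_vec j)) n
      = Poly_Mapping.lookup (zscale (f i j) (basis_vec (i + j))) n"
    by (auto simp: lookup_basis_vec)
qed

lemma graded_product_add:
  "graded_product (\<lambda>i j. f i j + g i j) v w = graded_product f v w + graded_product g v w"
  by (rule poly_mapping_eqI)
    (simp add: lookup_add lookup_graded_product[OF finite_keys order_refl] sum.distrib[symmetric] distrib_left)

lemma graded_product_swap: "graded_product f w v = graded_product (\<lambda>i j. f j i) v w"
proof -
  have "bilinear (\<lambda>v w. graded_product f w v)"
    using bilinear_graded_product[of f] unfolding bilinear_def by blast
  from bilinear_eqI[OF this bilinear_graded_product] show ?thesis
    by (simp add: graded_product_basis add.commute)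
qed

lemma lookup_graded_product_row_0:
  assumes "\<And>i j. i \<noteq> 0 \<Longrightarrow> f i j = 0"
  shows "Poly_Mapping.lookup (graded_product f v w) n = Res v * f 0 n * Poly_Mapping.lookup w n"
proof -
  let ?I = "insert 0 (Poly_Mapping.keys v)"
  have "Poly_Mapping.lookup (graded_product f v w) n
      = (\<Sum>i\<in>?I. Poly_Mapping.lookup v i * Poly_Mapping.lookup w (n - i) * f i (n - i))"
    by (rule lookup_graded_product) auto
  also have "\<dots> = (\<Sum>i\<in>{0}. Poly_Mapping.lookup v i * Poly_Mapping.lookup w (n - i) * f i (n - i))"
    by (rule sum.mono_neutral_right) (auto simp: assms)
  finally show ?thesis by (simp add: Res_def)
qed

section \<open>Coordinate modules\<close>

definition coord_mod :: "(int \<Rightarrow> int \<Rightarrow> complex) \<Rightarrow> zvec wmod" where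
  "coord_mod a = \<lparr>carr = UNIV, scal = zscale, act = graded_product a\<rparr>"

lemma coord_mod_simps [simp]:
  "carr (coord_mod a) = UNIV" "scal (coord_mod a) = zscale" "act (coord_mod a) = graded_product a"
  by (simp_all add: coord_mod_def)

lemma A_mod_eq: "A_mod \<xi> = coord_mod (A_coeff \<xi>)"
proof -
  have "A_action \<xi> = (\<lambda>k i. zscale (A_coeff \<xi> k i) (basis_vec (k + i)))"
    by (intro ext) (simp add: A_action_def A_coeff_def)
  then show ?thesis by (simp add: A_mod_def coord_mod_def graded_product_def)
qed

lemma B_mod_eq: "B_mod \<xi> = coord_mod (B_coeff \<xi>)"
proof -
  have "B_action \<xi> = (\<lambda>k i. zscale (B_coeff \<xi> k i) (basis_vec (k + i)))"
    by (intro ext) (simp add: B_action_def B_coeff_def)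
  then show ?thesis by (simp add: B_mod_def coord_mod_def graded_product_def)
qed

definition diagonal :: "(int \<Rightarrow> complex) \<Rightarrow> zvec \<Rightarrow> zvec" where
  "diagonal r = Poly_Mapping.mapp (\<lambda>i c. r i * c)"

lemma lookup_diagonal [simp]: "Poly_Mapping.lookup (diagonal r v) i = r i * Poly_Mapping.lookup v i"
  by (simp add: diagonal_def mapp.rep_eq in_keys_iff)

lemma keys_diagonal: "Poly_Mapping.keys (diagonal r v) \<subseteq> Poly_Mapping.keys v"
  by (auto simp: in_keys_iff)

lemma equivariant_diagonal:
  assumes "\<And>k i. a k i * r (k + i) = r i * b k i"
  shows "equivariant_linear (coord_mod a) (coord_mod b) (diagonal r)"
proof -
  have "diagonal r (graded_product a x v) = graded_product b x (diagonal r v)" for x v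
  proof (rule poly_mapping_eqI)
    fix n
    have e: "r n * (Poly_Mapping.lookup x i * Poly_Mapping.lookup v (n - i) * a i (n - i))
        = Poly_Mapping.lookup x i * (r (n - i) * Poly_Mapping.lookup v (n - i)) * b i (n - i)" for i
      using assms[of i "n - i"] by (simp add: mult.commute)
    show "Poly_Mapping.lookup (diagonal r (graded_product a x v)) n
        = Poly_Mapping.lookup (graded_product b x (diagonal r v)) n"
      unfolding lookup_diagonal lookup_graded_product[OF finite_keys order_refl] sum_distrib_left
      by (intro sum.cong refl e)
  qed
  moreover have "diagonal r (v + w) = diagonal r v + diagonal r w"
    "diagonal r (zscale c v) = zscale c (diagonal r v)" for c v w
    by (auto intro!: poly_mapping_eqI simp: lookup_add algebra_simps)
  ultimately show ?thesis by (simp add: equivariant_linear_def)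
qed

lemma witt_iso_diagonal:
  assumes "rescales r a b"
  shows "witt_iso (coord_mod a) (coord_mod b) (diagonal r)"
proof -
  have nz: "r i \<noteq> 0" for i using assms by (simp add: rescales_def)
  have "bij (diagonal r)"
  proof (rule bijI')
    show "(diagonal r v = diagonal r w) = (v = w)" for v w
      using nz by (auto simp: poly_mapping_eq_iff fun_eq_iff)
    show "\<exists>v. w = diagonal r v" for w
      by (rule exI[of _ "diagonal (\<lambda>i. 1 / r i) w"]) (rule poly_mapping_eqI, simp add: nz)
  qed
  then show ?thesis
    using equivariant_diagonal assms by (simp add: witt_iso_def rescales_def)
qed

lemma conjugate_diagonal:
  assumes r: "rescales r a a'" and s: "rescales s b b'" and t: "rescales t c c'"
    and eq: "\<And>i j. f i j * t (i + j) = r i * s j * g i j"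
  shows "conjugate (coord_mod a) (coord_mod b) (coord_mod c) (graded_product f)
    (coord_mod a') (coord_mod b') (coord_mod c') (graded_product g)"
proof -
  have "diagonal t (graded_product f v w) = graded_product g (diagonal r v) (diagonal s w)" for v w
  proof (rule poly_mapping_eqI)
    fix n
    have e: "t n * (Poly_Mapping.lookup v i * Poly_Mapping.lookup w (n - i) * f i (n - i))
        = r i * Poly_Mapping.lookup v i * (s (n - i) * Poly_Mapping.lookup w (n - i)) * g i (n - i)" for i
    proof -
      have "t n * (Poly_Mapping.lookup v i * Poly_Mapping.lookup w (n - i) * f i (n - i))
          = Poly_Mapping.lookup v i * Poly_Mapping.lookup w (n - i) * (f i (n - i) * t (i + (n - i)))"
        by simp
      also have "\<dots> = r i * Poly_Mapping.lookup v i * (s (n - i) * Poly_Mapping.lookup w (n - i)) * g i (n - i)"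
        unfolding eq by simp
      finally show ?thesis .
    qed
    show "Poly_Mapping.lookup (diagonal t (graded_product f v w)) n
        = Poly_Mapping.lookup (graded_product g (diagonal r v) (diagonal s w)) n"
      unfolding lookup_graded_product[OF finite_keys keys_diagonal] lookup_diagonal
      unfolding lookup_graded_product[OF finite_keys order_refl] sum_distrib_left
      by (intro sum.cong refl e)
  qed
  then show ?thesis
    unfolding conjugate_def
    by (intro exI[of _ "diagonal r"] exI[of _ "diagonal s"] exI[of _ "diagonal t"])
      (simp add: witt_iso_diagonal r s t)
qed

section \<open>The listed maps in coordinates\<close>

lemma eta_map_eq: "eta_map x y = graded_product (eta_coeff x y (x + y))"
proof (intro ext, rule bilinear_eqI[OF _ bilinear_graded_product])
  show "bilinear (eta_map x y)"
    unfolding bilinear_def eta_map_def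
    by (auto intro!: poly_mapping_eqI simp: lookup_add Res_def algebra_simps)
  show "eta_map x y (basis_vec i) (basis_vec j) = graded_product (eta_coeff x y (x + y)) (basis_vec i) (basis_vec j)" for i j
    by (rule poly_mapping_eqI)
      (auto simp: graded_product_basis eta_map_def eta_coeff_def lookup_add lookup_basis_vec Res_def)
qed

lemma eta_t_map_eq: "eta_t_map t = eta_map t 1"
  by (simp add: fun_eq_iff eta_t_map_def eta_map_def)

lemma Theta_eq: "Theta = graded_product (theta_coeff 0)"
proof -
  have "theta_basis = (\<lambda>i j. zscale (theta_coeff 0 i j) (basis_vec (i + j)))"
    by (intro ext poly_mapping_eqI) (auto simp: theta_basis_def theta_coeff_def lookup_uminus)
  then show ?thesis by (simp add: Theta_def graded_product_def)
qed

definition corner_coeff :: "complex \<Rightarrow> int \<Rightarrow> int \<Rightarrow> complex" where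
  "corner_coeff e i j = (if i = 0 \<and> j = 0 then e else 0)"

lemma Theta_plus_corner:
  "(\<lambda>v w. Theta v w + graded_product (corner_coeff e) v w) = graded_product (theta_coeff e)"
proof -
  have eq: "theta_coeff e = (\<lambda>i j. theta_coeff 0 i j + corner_coeff e i j)"
    by (intro ext) (simp add: theta_coeff_def corner_coeff_def)
  show ?thesis unfolding eq by (intro ext) (simp add: Theta_eq graded_product_add)
qed

lemma graded_product_corner: "graded_product (corner_coeff e) v w = zscale (e * Res v * Res w) (basis_vec 0)"
  by (rule poly_mapping_eqI)
    (subst lookup_graded_product_row_0, auto simp: corner_coeff_def lookup_basis_vec Res_def)

lemma Res_act_A: "Res (graded_product (A_coeff \<xi>) x v) = 0"
  unfolding Res_def lookup_graded_product[OF finite_keys order_refl]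
  by (rule sum.neutral) (auto simp: A_coeff_def)

lemma act_B_basis_0: "graded_product (B_coeff \<xi>) x (zscale c (basis_vec 0)) = 0"
  by (rule poly_mapping_eqI)
    (auto simp: lookup_graded_product[OF finite_keys order_refl] lookup_basis_vec B_coeff_def intro!: sum.neutral)

text \<open>\<open>Res\<close> vanishes on every vector of the form \<open>L.m\<close>, hence on
  every weight vector of non-zero weight, and \<open>e_0\<close> spans a trivial submodule of
  \<open>B\<close>. These two facts give the bound on the support and the equivariance.\<close>

lemma trivial_map_corner:
  "trivial_map (A_mod \<xi>\<^sub>1) (A_mod \<xi>\<^sub>2) (B_mod \<xi>\<^sub>3) (graded_product (corner_coeff e))"
proof -
  have "x = 0" if "m \<in> wt (A_mod \<xi>) x" "Res m \<noteq> 0" for \<xi> m x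
  proof -
    have "Res (zscale x m) = 0"
      using that(1) Res_act_A[of \<xi> "witt_L 0" m] by (simp add: wt_def A_mod_eq)
    then show ?thesis using that(2) by (simp add: Res_def)
  qed
  then have "bisupport (A_mod \<xi>\<^sub>1) (A_mod \<xi>\<^sub>2) (graded_product (corner_coeff e)) \<subseteq> {(0, 0)}"
    unfolding bisupport_def graded_product_corner by fastforce
  moreover have "equivariant_bilinear (A_mod \<xi>\<^sub>1) (A_mod \<xi>\<^sub>2) (B_mod \<xi>\<^sub>3) (graded_product (corner_coeff e))"
    using bilinear_graded_product[of "corner_coeff e"]
    by (simp add: equivariant_bilinear_def A_mod_eq B_mod_eq bilinear_def)
      (simp add: graded_product_corner Res_act_A act_B_basis_0)
  ultimately show ?thesis by (simp add: trivial_map_def)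
qed

section \<open>Transport from coordinate modules to arbitrary ones\<close>

lemma witt_iso_comp: "witt_iso M N f \<Longrightarrow> witt_iso N P g \<Longrightarrow> witt_iso M P (g \<circ> f)"
  unfolding witt_iso_def equivariant_linear_def
  by (intro conjI; (elim conjE)?) (simp_all add: bij_betw_trans)

lemma witt_iso_inv:
  assumes "witt_iso (coord_mod a) M f"
  shows "witt_iso M (coord_mod a) (inv f)"
proof -
  have bij: "bij_betw f UNIV (carr M)"
    and add: "f (v + w) = f v + f w" and scale: "f (zscale c v) = scal M c (f v)"
    and act: "f (graded_product a x v) = act M x (f v)" for v w c x
    using assms by (simp_all add: witt_iso_def equivariant_linear_def)
  have inj: "inj f" using bij by (simp add: bij_betw_def)
  have "bij_betw (inv f) (carr M) UNIV"
    using bij_betw_inv_into[OF bij] .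
  moreover have "\<exists>v. m = f v" if "m \<in> carr M" for m
    using that bij by (auto simp: bij_betw_def)
  then have "inv f (m + m') = inv f m + inv f m'" "inv f (scal M c m) = zscale c (inv f m)"
    "inv f (act M x m) = graded_product a x (inv f m)"
    if "m \<in> carr M" "m' \<in> carr M" for m m' c x
    using that by (metis inv_f_f[OF inj] add, metis inv_f_f[OF inj] scale, metis inv_f_f[OF inj] act)
  ultimately show ?thesis
    unfolding witt_iso_def equivariant_linear_def by simp
qed

lemma witt_iso_coordD:
  assumes "witt_iso (coord_mod a) M f"
  shows "f v \<in> carr M" "f (v + w) = f v + f w" "f (zscale c v) = scal M c (f v)"
    "f (graded_product a x v) = act M x (f v)" "inv f (f v) = v"
    "m \<in> carr M \<Longrightarrow> f (inv f m) = m" "f v = f w \<longleftrightarrow> v = w"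
proof -
  have bij: "bij_betw f UNIV (carr M)" using assms by (simp add: witt_iso_def)
  show "f v \<in> carr M" "f (v + w) = f v + f w" "f (zscale c v) = scal M c (f v)"
    "f (graded_product a x v) = act M x (f v)"
    using assms by (simp_all add: witt_iso_def equivariant_linear_def)
  show "inv f (f v) = v" "f v = f w \<longleftrightarrow> v = w" using bij by (auto simp: bij_betw_def inj_eq)
  show "m \<in> carr M \<Longrightarrow> f (inv f m) = m" using bij by (auto simp: bij_betw_def f_inv_into_f)
qed

text \<open>The isomorphisms go from coordinates to the modules, and \<open>f\<close> has two
  indices because the third is determined by them. The assumption \<open>vector_space_N\<close>
  serves the bound on the kernel of an almost-isomorphism, which speaks of spans in
  \<open>N\<close>.\<close>

locale coordinates =
  fixes M :: "'m::ab_group_add wmod" and N :: "'n::ab_group_add wmod" and P :: "'p::ab_group_add wmod"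
    and \<pi> :: "'m \<Rightarrow> 'n \<Rightarrow> 'p" and a b c :: "int \<Rightarrow> int \<Rightarrow> complex" and f :: "int \<Rightarrow> int \<Rightarrow> complex"
    and A B C
  assumes iso_A: "witt_iso (coord_mod a) M A" and iso_B: "witt_iso (coord_mod b) N B"
    and iso_C: "witt_iso (coord_mod c) P C"
    and \<pi>_eq: "\<pi> (A v) (B w) = C (graded_product f v w)"
    and vector_space_N: "vector_space (scal N)"
begin

lemma conjugate_transfer:
  assumes "conjugate (coord_mod a) (coord_mod b) (coord_mod c) (graded_product f) M' N' P' \<pi>'"
  shows "conjugate M N P \<pi> M' N' P' \<pi>'"
proof -
  obtain \<alpha> \<beta> \<gamma> where iso: "witt_iso (coord_mod a) M' \<alpha>" "witt_iso (coord_mod b) N' \<beta>"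
    "witt_iso (coord_mod c) P' \<gamma>" and eq: "\<And>v w. \<gamma> (graded_product f v w) = \<pi>' (\<alpha> v) (\<beta> w)"
    using assms unfolding conjugate_def by auto
  have "(\<gamma> \<circ> inv C) (\<pi> m n) = \<pi>' ((\<alpha> \<circ> inv A) m) ((\<beta> \<circ> inv B) n)"
    if "m \<in> carr M" "n \<in> carr N" for m n
    using \<pi>_eq[of "inv A m" "inv B n"] eq[of "inv A m" "inv B n"] that
      witt_iso_coordD(6)[OF iso_A] witt_iso_coordD(6)[OF iso_B] witt_iso_coordD(5)[OF iso_C]
    by simp
  then show ?thesis
    unfolding conjugate_def using witt_iso_comp[OF witt_iso_inv[OF iso_A] iso(1)]
      witt_iso_comp[OF witt_iso_inv[OF iso_B] iso(2)] witt_iso_comp[OF witt_iso_inv[OF iso_C] iso(3)]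
    by blast
qed

text \<open>Unlike the other listed forms, this one keeps \<open>N\<close> and \<open>P\<close>
  themselves, so the almost-isomorphism must be transported too. It becomes
  \<open>C \<circ> \<psi> \<circ> inv B\<close>, and \<open>B\<close> carries a spanning set for the
  old kernel to one for the new kernel.\<close>

lemma conj_Res_almost_iso_transfer:
  assumes "conj_Res_almost_iso (coord_mod a) (coord_mod b) (coord_mod c) (graded_product f)"
  shows "conj_Res_almost_iso M N P \<pi>"
proof -
  obtain \<xi> \<psi> where \<xi>: "\<xi> \<noteq> (0, 0)" and \<psi>: "almost_iso (coord_mod b) (coord_mod c) \<psi>" and conj:
    "conjugate (coord_mod a) (coord_mod b) (coord_mod c) (graded_product f)
      (A_mod \<xi>) (coord_mod b) (coord_mod c) (\<lambda>m n. zscale (Res m) (\<psi> n))"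
    using assms unfolding conj_Res_almost_iso_def by auto
  note B = witt_iso_coordD[OF iso_B] and C = witt_iso_coordD[OF iso_C]
  interpret N: vector_space "scal N" by (rule vector_space_N)
  let ?\<psi> = "C \<circ> \<psi> \<circ> inv B"
  have eq_\<psi>: "equivariant_linear (coord_mod b) (coord_mod c) \<psi>" using \<psi> by (simp add: almost_iso_def)
  have "equivariant_linear N P ?\<psi>"
    using witt_iso_inv[OF iso_B] eq_\<psi> iso_C unfolding witt_iso_def equivariant_linear_def
    by simp
  moreover obtain K where K: "finite K" "card K \<le> 1"
    "{v. \<psi> v = 0} \<subseteq> module.span zscale K"
    using \<psi> by (auto simp: almost_iso_def)
  have "C 0 = 0" using C(3)[of 0 0] C(2)[of 0 0] by simp
  have "{n \<in> carr N. ?\<psi> n = 0} \<subseteq> N.span (B ` K)"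
  proof
    fix n assume n: "n \<in> {n \<in> carr N. ?\<psi> n = 0}"
    then have "\<psi> (inv B n) = 0" using C(7)[of "\<psi> (inv B n)" 0] \<open>C 0 = 0\<close> by simp
    then have inK: "inv B n \<in> module.span zscale K" using K(3) by blast
    interpret Z: vector_space zscale by (rule vector_space_zscale)
    have image_span: "B v \<in> N.span (B ` K)" if "v \<in> Z.span K" for v
      using that
    proof (induction rule: Z.span_induct_alt)
      case base
      have "B 0 = 0" using B(2)[of 0 0] by simp
      then show ?case by (simp add: N.span_zero)
    next
      case (step c x y)
      then show ?case by (simp add: B(2,3) N.span_add N.span_scale N.span_base)
    qed
    have "B (inv B n) = n" using B(6)[of n] n by simp
    then show "n \<in> N.span (B ` K)" using image_span[OF inK] by simp
  qed
  moreover have "card (B ` K) \<le> 1" "finite (B ` K)" using K card_image_le[of K B] by auto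
  ultimately have "almost_iso N P ?\<psi>" unfolding almost_iso_def by blast
  moreover have "conjugate M N P \<pi> (A_mod \<xi>) N P (\<lambda>m n. scal P (Res m) (?\<psi> n))"
  proof -
    obtain \<alpha> \<beta> \<gamma> where iso: "witt_iso (coord_mod a) (A_mod \<xi>) \<alpha>"
      "witt_iso (coord_mod b) (coord_mod b) \<beta>" "witt_iso (coord_mod c) (coord_mod c) \<gamma>"
      and eq: "\<And>v w. \<gamma> (graded_product f v w) = zscale (Res (\<alpha> v)) (\<psi> (\<beta> w))"
      using conj unfolding conjugate_def by auto
    have "conjugate (coord_mod a) (coord_mod b) (coord_mod c) (graded_product f)
      (A_mod \<xi>) N P (\<lambda>m n. scal P (Res m) (?\<psi> n))"
      unfolding conjugate_def
      by (intro exI[of _ \<alpha>] exI[of _ "B \<circ> \<beta>"] exI[of _ "C \<circ> \<gamma>"])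
        (simp add: witt_iso_comp[OF _ iso_B] witt_iso_comp[OF _ iso_C] iso eq B(5) C(3))
    then show ?thesis by (rule conjugate_transfer)
  qed
  ultimately show ?thesis using \<xi> unfolding conj_Res_almost_iso_def by blast
qed

lemma conj_to_listed_transfer:
  assumes "conj_to_listed (coord_mod a) (coord_mod b) (coord_mod c) (graded_product f)"
  shows "conj_to_listed M N P \<pi>"
proof -
  consider "conj_trivial (coord_mod a) (coord_mod b) (coord_mod c) (graded_product f)"
    | "conj_Res_almost_iso (coord_mod a) (coord_mod b) (coord_mod c) (graded_product f)"
    | "conj_eta (coord_mod a) (coord_mod b) (coord_mod c) (graded_product f)"
    | "conj_eta_t (coord_mod a) (coord_mod b) (coord_mod c) (graded_product f)"
    | "conj_Theta_plus_trivial (coord_mod a) (coord_mod b) (coord_mod c) (graded_product f)"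
    using assms unfolding conj_to_listed_def by blast
  then show ?thesis
  proof cases
    case 1
    then have "conj_trivial M N P \<pi>" unfolding conj_trivial_def using conjugate_transfer by blast
    then show ?thesis by (simp add: conj_to_listed_def)
  next
    case 2
    then show ?thesis using conj_Res_almost_iso_transfer by (simp add: conj_to_listed_def)
  next
    case 3
    then have "conj_eta M N P \<pi>" unfolding conj_eta_def by (elim exE conjE) (intro exI conjI; (rule conjugate_transfer)?; assumption)
    then show ?thesis by (simp add: conj_to_listed_def)
  next
    case 4
    then have "conj_eta_t M N P \<pi>" unfolding conj_eta_t_def using conjugate_transfer by blast
    then show ?thesis by (simp add: conj_to_listed_def)
  next
    case 5
    then have "conj_Theta_plus_trivial M N P \<pi>"
      unfolding conj_Theta_plus_trivial_def using conjugate_transfer by blast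
    then show ?thesis by (simp add: conj_to_listed_def)
  qed
qed

end

section \<open>Restricted duals in coordinates\<close>

text \<open>This pairs \<open>e_i\<close> with \<open>e_{-i}\<close>, in accordance with
  \<open>dual_coeff\<close>. Writing it as the coefficient at 0 of a graded product makes it inherit
  bilinearity.\<close>

definition pairing :: "zvec \<Rightarrow> zvec \<Rightarrow> complex" where
  "pairing w v = Poly_Mapping.lookup (graded_product (\<lambda>_ _. 1) w v) 0"

lemma pairing_simps:
  "pairing (w + w') v = pairing w v + pairing w' v" "pairing w (v + v') = pairing w v + pairing w v'"
  "pairing (zscale c w) v = c * pairing w v" "pairing w (zscale c v) = c * pairing w v"
  using bilinear_graded_product[of "\<lambda>_ _. 1"]
  by (simp_all add: pairing_def bilinear_def lookup_add)

lemma pairing_0 [simp]: "pairing 0 v = 0" "pairing w 0 = 0"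
  using pairing_simps(3)[of 0 0 v] pairing_simps(4)[of w 0 0] by simp_all

lemma pairing_sum: "pairing w v = (\<Sum>i\<in>Poly_Mapping.keys w. Poly_Mapping.lookup w i * Poly_Mapping.lookup v (- i))"
  by (simp add: pairing_def lookup_graded_product[OF finite_keys order_refl])

lemma pairing_basis: "pairing (basis_vec i) (basis_vec j) = (if i + j = 0 then 1 else 0)"
  by (simp add: pairing_def graded_product_basis lookup_basis_vec)

lemma pairing_basis_right: "pairing w (basis_vec (- i)) = Poly_Mapping.lookup w i"
  by (induction w rule: zvec_induct)
    (auto simp: pairing_simps pairing_basis lookup_basis_vec lookup_add)

lemma graded_product_simps:
  "graded_product f (v + v') w = graded_product f v w + graded_product f v' w"
  "graded_product f v (w + w') = graded_product f v w + graded_product f v w'"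
  "graded_product f (zscale c v) w = zscale c (graded_product f v w)"
  "graded_product f v (zscale c w) = zscale c (graded_product f v w)"
  using bilinear_graded_product[of f] by (simp_all add: bilinear_def)

lemma graded_product_0 [simp]: "graded_product f 0 v = 0" "graded_product f w 0 = 0"
  using graded_product_simps(3)[of f 0 0 v] graded_product_simps(4)[of f w 0 0] by simp_all

text \<open>With \<open>e_l\<close> read as the form dual to \<open>e_{-l}\<close>, transposition
  replaces the index \<open>j\<close> by \<open>- i - l\<close>. Both the action on the dual and the
  rotation of \<open>\<pi>\<close> are instances.\<close>

lemma pairing_adjoint:
  assumes "\<And>i l. h i l = f i (- i - l)"
  shows "pairing (graded_product h v w) y = pairing w (graded_product f v y)"
proof (induction v rule: zvec_induct)
  case (basis i)
  show ?case
  proof (induction w rule: zvec_induct)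
    case (basis l)
    show ?case
    proof (induction y rule: zvec_induct)
      case (basis j)
      have "i + l + j = 0 \<longleftrightarrow> l + (i + j) = 0" by linarith
      moreover have "h i l = f i j" if "i + l + j = 0"
      proof -
        have "- i - l = j" using that by linarith
        then show ?thesis using assms[of i l] by simp
      qed
      ultimately show ?case
        by (auto simp: graded_product_basis pairing_simps pairing_basis)
    qed (simp_all add: pairing_simps graded_product_simps)
  qed (simp_all add: pairing_simps graded_product_simps)
qed (simp_all add: pairing_simps graded_product_simps)

definition dual_basis_map :: "'m::ab_group_add wmod \<Rightarrow> (zvec \<Rightarrow> 'm) \<Rightarrow> zvec \<Rightarrow> 'm \<Rightarrow> complex" where
  "dual_basis_map M A w = (\<lambda>m. if m \<in> carr M then pairing w (inv A m) else 0)"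

lemma weight_coordinates:
  assumes iso: "witt_iso (coord_mod a) M A" and "structure_constants u a" and wt: "A v \<in> wt M s"
  shows "Poly_Mapping.lookup v n = 0 \<or> s = u + of_int n"
proof -
  interpret structure_constants u a by fact
  note A = witt_iso_coordD[OF iso]
  have "A (graded_product a (basis_vec 0) v) = A (zscale s v)"
    using wt by (simp add: wt_def witt_L_def A)
  then have "Poly_Mapping.lookup (graded_product a (basis_vec 0) v) n = Poly_Mapping.lookup (zscale s v) n"
    unfolding A(7) by simp
  moreover have "Poly_Mapping.keys (basis_vec 0) \<subseteq> {0}" by (simp add: basis_vec_def)
  ultimately have "Poly_Mapping.lookup v n * (u + of_int n) = s * Poly_Mapping.lookup v n"
    using lookup_graded_product[of "{0}" "basis_vec 0" a v n] by (simp add: lookup_basis_vec L0)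
  then show ?thesis by (auto simp: mult.commute)
qed

lemma basis_vec_weight:
  assumes iso: "witt_iso (coord_mod a) M A" and "structure_constants u a"
  shows "A (basis_vec i) \<in> wt M (u + of_int i)"
proof -
  interpret structure_constants u a by fact
  note A = witt_iso_coordD[OF iso]
  show ?thesis
    using A(1)[of "basis_vec i"] A(4)[of "basis_vec 0" "basis_vec i"]
    by (simp add: wt_def witt_L_def graded_product_basis L0 A(3))
qed

text \<open>The finiteness condition in \<open>rdual\<close> is what makes a form a finite
  combination of the dual basis: its values at the vectors \<open>A (basis_vec (- i))\<close> have
  finite support and so define a coordinate vector. Conversely, a coordinate vector gives a form
  that is non-zero on finitely many weight spaces only.\<close>

lemma witt_iso_dual:
  assumes iso: "witt_iso (coord_mod a) M A" and "structure_constants u a"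
  shows "witt_iso (coord_mod (dual_coeff a)) (rdual M) (dual_basis_map M A)"
proof -
  interpret structure_constants u a by fact
  note A = witt_iso_coordD[OF iso]
  note weight = weight_coordinates[OF assms] and basis_wt = basis_vec_weight[OF assms]
  have \<delta>: "dual_basis_map M A w (A v) = pairing w v" for w v
    by (simp add: dual_basis_map_def A)
  have carr_cases: "\<exists>v. m = A v" if "m \<in> carr M" for m using A(6)[OF that] by metis
  have in_carr: "dual_basis_map M A w \<in> carr (rdual M)" for w
  proof -
    have "{s. \<exists>v\<in>wt M s. dual_basis_map M A w v \<noteq> 0} \<subseteq> (\<lambda>i. u - of_int i) ` Poly_Mapping.keys w"
    proof
      fix s assume "s \<in> {s. \<exists>v\<in>wt M s. dual_basis_map M A w v \<noteq> 0}"
      then obtain m where m: "m \<in> wt M s" "dual_basis_map M A w m \<noteq> 0" by blast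
      then obtain v where v: "m = A v" using carr_cases[of m] by (auto simp: wt_def)
      then have "pairing w v \<noteq> 0" using m \<delta> by simp
      then obtain i where "i \<in> Poly_Mapping.keys w" "Poly_Mapping.lookup v (- i) \<noteq> 0"
        unfolding pairing_sum by (metis (no_types, lifting) mult_zero_right sum.neutral)
      then show "s \<in> (\<lambda>i. u - of_int i) ` Poly_Mapping.keys w"
        using weight[of v s "- i"] m(1) v by auto
    qed
    then have "finite {s. \<exists>v\<in>wt M s. dual_basis_map M A w v \<noteq> 0}" by (rule finite_subset) simp
    moreover have "dual_basis_map M A w (m + m') = dual_basis_map M A w m + dual_basis_map M A w m'"
      "dual_basis_map M A w (scal M c m) = c * dual_basis_map M A w m"
      if m: "m \<in> carr M" "m' \<in> carr M" for m m' c
    proof -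
      obtain v v' where v: "m = A v" "m' = A v'" using carr_cases m by blast
      show "dual_basis_map M A w (m + m') = dual_basis_map M A w m + dual_basis_map M A w m'"
        unfolding v A(2)[symmetric] \<delta> by (simp add: pairing_simps)
      show "dual_basis_map M A w (scal M c m) = c * dual_basis_map M A w m"
        unfolding v A(3)[symmetric] \<delta> by (simp add: pairing_simps)
    qed
    moreover have "dual_basis_map M A w m = 0" if "m \<notin> carr M" for m
      using that by (simp add: dual_basis_map_def)
    ultimately show ?thesis unfolding rdual_def by simp
  qed
  have eqI: "g = h" if "\<And>v. g (A v) = h (A v)" "\<And>m. m \<notin> carr M \<Longrightarrow> g m = h m" for g h :: "'a \<Rightarrow> complex"
    using that carr_cases by (intro ext) metis
  have inj: "w = w'" if "dual_basis_map M A w = dual_basis_map M A w'" for w w'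
  proof (rule poly_mapping_eqI)
    fix i
    have "pairing w (basis_vec (- i)) = pairing w' (basis_vec (- i))"
      unfolding \<delta>[symmetric] that ..
    then show "Poly_Mapping.lookup w i = Poly_Mapping.lookup w' i"
      by (simp only: pairing_basis_right)
  qed
  have surj: "\<exists>w. g = dual_basis_map M A w" if g: "g \<in> carr (rdual M)" for g
  proof -
    have fin: "finite {s. \<exists>v\<in>wt M s. g v \<noteq> 0}" and out: "\<And>m. m \<notin> carr M \<Longrightarrow> g m = 0"
      and lin: "\<And>v w. g (A (v + w)) = g (A v) + g (A w)" "\<And>c v. g (A (zscale c v)) = c * g (A v)"
      using g A(1) by (auto simp: rdual_def A(2,3))
    have "(\<lambda>i. u - of_int i) ` {i. g (A (basis_vec (- i))) \<noteq> 0} \<subseteq> {s. \<exists>v\<in>wt M s. g v \<noteq> 0}"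
      using basis_wt[of "- i" for i] by fastforce
    then have "finite ((\<lambda>i. u - of_int i) ` {i. g (A (basis_vec (- i))) \<noteq> 0})"
      using fin by (rule finite_subset)
    then have "finite {i. g (A (basis_vec (- i))) \<noteq> 0}"
      by (rule finite_imageD) (simp add: inj_on_def)
    then have w: "Poly_Mapping.lookup (Abs_poly_mapping (\<lambda>i. g (A (basis_vec (- i))))) i = g (A (basis_vec (- i)))" for i
      by simp
    define w where "w = Abs_poly_mapping (\<lambda>i. g (A (basis_vec (- i))))"
    have "g (A v) = pairing w v" for v
    proof (induction v rule: zvec_induct)
      case zero
      show ?case using lin(2)[of 0 0] by simp
    next
      case (basis i)
      show ?case using pairing_basis_right[of w "- i"] w[of "- i"] by (simp add: w_def)
    qed (simp_all add: lin pairing_simps)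
    then have "g (A v) = dual_basis_map M A w (A v)" for v by (simp add: \<delta>)
    then have "g = dual_basis_map M A w"
      by (rule eqI) (simp add: out dual_basis_map_def)
    then show ?thesis by blast
  qed
  have act_eq: "dual_basis_map M A (graded_product (dual_coeff a) x w) = act (rdual M) x (dual_basis_map M A w)" for x w
  proof (rule eqI)
    fix v
    have "pairing (graded_product (dual_coeff a) x w) v = pairing w (graded_product (\<lambda>k i. - a k i) x v)"
      by (rule pairing_adjoint) (simp add: dual_coeff_def minus_diff_commute)
    also have "graded_product (\<lambda>k i. - a k i) x v = zscale (- 1) (graded_product a x v)"
      by (rule poly_mapping_eqI)
        (simp add: lookup_graded_product[OF finite_keys order_refl] sum_negf)
    finally have "pairing (graded_product (dual_coeff a) x w) v = - pairing w (graded_product a x v)"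
      by (simp add: pairing_simps)
    then show "dual_basis_map M A (graded_product (dual_coeff a) x w) (A v)
        = act (rdual M) x (dual_basis_map M A w) (A v)"
      by (simp add: \<delta> rdual_def A(1) A(4)[symmetric])
  qed (simp add: dual_basis_map_def rdual_def)
  have "bij_betw (dual_basis_map M A) UNIV (carr (rdual M))"
    unfolding bij_betw_def
  proof
    show "inj (dual_basis_map M A)" using inj by (rule injI)
    show "range (dual_basis_map M A) = carr (rdual M)" using surj in_carr by blast
  qed
  moreover have "dual_basis_map M A (v + w) = dual_basis_map M A v + dual_basis_map M A w"
    "dual_basis_map M A (zscale c v) = scal (rdual M) c (dual_basis_map M A v)" for v w c
    by (auto simp: dual_basis_map_def rdual_def fun_eq_iff pairing_simps)
  ultimately show ?thesis
    using in_carr act_eq by (simp add: witt_iso_def equivariant_linear_def)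
qed

lemma vector_space_rdual: "vector_space (scal (rdual M))"
  by unfold_locales (simp_all add: rdual_def fun_eq_iff algebra_simps)

lemma (in coordinates) rotate:
  assumes "structure_constants v b" "structure_constants w c"
  shows "coordinates M (rdual P) (rdual N) (rotate_M_Pdual N \<pi>) a (dual_coeff c) (dual_coeff b)
    (\<lambda>i l. f i (- i - l)) A (dual_basis_map P C) (dual_basis_map N B)"
proof (rule coordinates.intro)
  show "witt_iso (coord_mod a) M A" by (rule iso_A)
  show "witt_iso (coord_mod (dual_coeff c)) (rdual P) (dual_basis_map P C)"
    using iso_C assms(2) by (rule witt_iso_dual)
  show "witt_iso (coord_mod (dual_coeff b)) (rdual N) (dual_basis_map N B)"
    using iso_B assms(1) by (rule witt_iso_dual)
  show "vector_space (scal (rdual P))" by (rule vector_space_rdual)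
  note B = witt_iso_coordD[OF iso_B] and C = witt_iso_coordD[OF iso_C]
  fix x z
  show "rotate_M_Pdual N \<pi> (A x) (dual_basis_map P C z)
      = dual_basis_map N B (graded_product (\<lambda>i l. f i (- i - l)) x z)"
  proof
    fix n
    show "rotate_M_Pdual N \<pi> (A x) (dual_basis_map P C z) n
        = dual_basis_map N B (graded_product (\<lambda>i l. f i (- i - l)) x z) n"
    proof (cases "n \<in> carr N")
      case True
      then have n: "n = B (inv B n)" using B(6) by simp
      have "rotate_M_Pdual N \<pi> (A x) (dual_basis_map P C z) n = pairing z (graded_product f x (inv B n))"
        using \<pi>_eq[of x "inv B n"] n True by (simp add: rotate_M_Pdual_def dual_basis_map_def C)
      also have "\<dots> = pairing (graded_product (\<lambda>i l. f i (- i - l)) x z) (inv B n)"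
        by (rule pairing_adjoint[symmetric]) simp
      finally show ?thesis using True by (simp add: dual_basis_map_def)
    qed (simp add: rotate_M_Pdual_def dual_basis_map_def)
  qed
qed

lemma (in coordinates) swap:
  assumes "vector_space (scal M)"
  shows "coordinates N M P (\<lambda>n m. \<pi> m n) b a c (\<lambda>j i. f i j) B A C"
proof (rule coordinates.intro)
  show "\<pi> (A w) (B v) = C (graded_product (\<lambda>j i. f i j) v w)" for v w
    using \<pi>_eq[of w v] graded_product_swap[of f w v] by simp
qed (use iso_A iso_B iso_C assms in simp_all)

section \<open>Modules of class S in coordinates\<close>

lemma sum_over_keys:
  assumes "vector_space s" "finite I" "Poly_Mapping.keys v \<subseteq> I"
  shows "(\<Sum>i\<in>Poly_Mapping.keys v. s (Poly_Mapping.lookup v i) (E i)) = (\<Sum>i\<in>I. s (Poly_Mapping.lookup v i) (E i))"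
proof -
  interpret vector_space s by fact
  show ?thesis
    by (rule sum.mono_neutral_left) (use assms(2,3) in \<open>auto simp: in_keys_iff\<close>)
qed

lemma witt_bracket_L: "witt_bracket (witt_L k) (witt_L l) = zscale (of_int (l - k)) (witt_L (k + l))"
proof -
  have eq: "witt_bracket = graded_product (\<lambda>m n. of_int (n - m))"
    unfolding witt_bracket_def graded_product_def by simp
  show ?thesis unfolding eq witt_L_def graded_product_basis ..
qed

lemma class_S_weight_basis:
  assumes M: "class_S M" and s0: "s0 \<in> Supp M"
  obtains E where "\<And>i. E i \<in> wt M (s0 + of_int i)" "\<And>i. E i \<noteq> 0"
    "\<And>i m. m \<in> wt M (s0 + of_int i) \<Longrightarrow> \<exists>c. m = scal M c (E i)"
    "\<And>s. s \<notin> range (\<lambda>i. s0 + of_int i) \<Longrightarrow> wt M s = {0}"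
proof -
  have wm: "witt_module M" using M by (simp add: class_S_def)
  interpret V: vector_space "scal M" using wm by (simp add: witt_module_def)
  obtain u where u: "Supp M = {u + of_int n |n. True}" using M by (auto simp: class_S_def)
  obtain n0 where n0: "s0 = u + of_int n0" using s0 u by auto
  have supp: "s \<in> Supp M \<longleftrightarrow> s \<in> range (\<lambda>i. s0 + of_int i)" for s
  proof
    assume "s \<in> Supp M"
    then obtain n where "s = u + of_int n" using u by auto
    then have "s = s0 + of_int (n - n0)" using n0 by simp
    then show "s \<in> range (\<lambda>i. s0 + of_int i)" by (rule range_eqI)
  next
    assume "s \<in> range (\<lambda>i. s0 + of_int i)"
    then obtain i where "s = u + of_int (n0 + i)" using n0 by (auto simp: add.assoc)
    then show "s \<in> Supp M" using u by blast
  qed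
  have "\<exists>e. e \<in> wt M (s0 + of_int i) \<and> e \<noteq> 0 \<and> (\<forall>m\<in>wt M (s0 + of_int i). \<exists>c. m = scal M c e)" for i
  proof -
    let ?W = "wt M (s0 + of_int i)"
    have "V.dim ?W = 1" using M supp[of "s0 + of_int i"] by (auto simp: class_S_def)
    then obtain B where B: "B \<subseteq> ?W" "V.independent B" "?W \<subseteq> V.span B" "card B = 1"
      using V.basis_exists[of ?W] by metis
    then obtain e where e: "B = {e}" by (auto simp: card_1_singleton_iff)
    then have "e \<noteq> 0" using B(2) V.dependent_zero[of B] by auto
    moreover have "\<exists>c. m = scal M c e" if "m \<in> ?W" for m
      using B(3) that unfolding e V.span_singleton by auto
    ultimately show ?thesis using B(1) e by blast
  qed
  then obtain E where "\<And>i. E i \<in> wt M (s0 + of_int i) \<and> E i \<noteq> 0 \<and> (\<forall>m\<in>wt M (s0 + of_int i). \<exists>c. m = scal M c (E i))"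
    by metis
  moreover have "wt M s = {0}" if "s \<notin> range (\<lambda>i. s0 + of_int i)" for s
    using supp[of s] that by (auto simp: Supp_def)
  ultimately show thesis using that by blast
qed

text \<open>Structure constants exist because \<open>L_k\<close> raises the weight by
  \<open>k\<close> and weight spaces are lines. The existence of weight decompositions makes the
  coordinate map onto, and their uniqueness makes it injective.\<close>

lemma class_S_coordinates:
  assumes M: "class_S M" and s0: "s0 \<in> Supp M"
  obtains a A where "structure_constants s0 a" "witt_iso (coord_mod a) M A"
proof -
  have wm: "witt_module M" and weight: "weight_module M" using M by (simp_all add: class_S_def)
  interpret V: vector_space "scal M" using wm by (simp add: witt_module_def)
  have sub: "V.subspace (carr M)" using wm by (simp add: witt_module_def)
  have act_carr: "v \<in> carr M \<Longrightarrow> act M x v \<in> carr M" for x v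
    using wm unfolding witt_module_def by blast
  have act_add: "v \<in> carr M \<Longrightarrow> w \<in> carr M \<Longrightarrow> act M x (v + w) = act M x v + act M x w" for x v w
    using wm unfolding witt_module_def by blast
  have act_scale: "v \<in> carr M \<Longrightarrow> act M x (scal M c v) = scal M c (act M x v)" for x v c
    using wm unfolding witt_module_def by blast
  have add_act: "v \<in> carr M \<Longrightarrow> act M (x + y) v = act M x v + act M y v" for x y v
    using wm unfolding witt_module_def by blast
  have scale_act: "v \<in> carr M \<Longrightarrow> act M (zscale c x) v = scal M c (act M x v)" for x v c
    using wm unfolding witt_module_def by blast
  have bracket_act: "v \<in> carr M \<Longrightarrow> act M (witt_bracket x y) v = act M x (act M y v) - act M y (act M x v)" for x y v
    using wm unfolding witt_module_def by blast
  obtain E where E: "\<And>i. E i \<in> wt M (s0 + of_int i)" "\<And>i. E i \<noteq> 0"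
    "\<And>i m. m \<in> wt M (s0 + of_int i) \<Longrightarrow> \<exists>c. m = scal M c (E i)"
    "\<And>s. s \<notin> range (\<lambda>i. s0 + of_int i) \<Longrightarrow> wt M s = {0}"
    using class_S_weight_basis[OF M s0] by metis
  have E_carr: "E i \<in> carr M" and E_L0: "act M (witt_L 0) (E i) = scal M (s0 + of_int i) (E i)" for i
    using E(1)[of i] by (simp_all add: wt_def)
  have scale_carr: "m \<in> carr M \<Longrightarrow> scal M c m \<in> carr M" for c m
    using sub by (rule V.subspace_scale)
  have "act M (witt_L k) (E i) \<in> wt M (s0 + of_int (k + i))" for k i
  proof -
    have "act M (witt_L 0) (act M (witt_L k) (E i)) - act M (witt_L k) (act M (witt_L 0) (E i))
        = scal M (of_int k) (act M (witt_L k) (E i))"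
      using bracket_act[OF E_carr, of "witt_L 0" "witt_L k" i]
      by (simp add: witt_bracket_L scale_act E_carr)
    then have "act M (witt_L 0) (act M (witt_L k) (E i))
        = scal M (of_int k) (act M (witt_L k) (E i)) + scal M (s0 + of_int i) (act M (witt_L k) (E i))"
      by (simp only: E_L0 act_scale[OF E_carr] diff_eq_eq)
    also have "\<dots> = scal M (s0 + of_int (k + i)) (act M (witt_L k) (E i))"
      by (simp add: V.scale_left_distrib[symmetric] add.commute add.left_commute)
    finally show ?thesis by (simp add: wt_def act_carr E_carr)
  qed
  then have "\<exists>c. act M (witt_L k) (E i) = scal M c (E (k + i))" for k i using E(3) by blast
  then obtain a where a: "\<And>k i. act M (witt_L k) (E i) = scal M (a k i) (E (k + i))" by metis
  have E_cancel: "c = d" if "scal M c (E i) = scal M d (E i)" for c d i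
    using that E(2) by simp
  have sc: "structure_constants s0 a"
  proof
    show "a 0 i = s0 + of_int i" for i
      using a[of 0 i] E_L0[of i] by (intro E_cancel[of _ i]) auto
    fix l i k
    have "scal M (of_int (l - k) * a (k + l) i) (E (k + l + i))
        = scal M (of_int (l - k)) (act M (witt_L (k + l)) (E i))"
      by (simp add: a)
    also have "\<dots> = act M (witt_L k) (act M (witt_L l) (E i)) - act M (witt_L l) (act M (witt_L k) (E i))"
      using bracket_act[OF E_carr, of "witt_L k" "witt_L l" i] by (simp only: witt_bracket_L scale_act[OF E_carr])
    also have "\<dots> = scal M (a l i * a k (l + i)) (E (k + (l + i))) - scal M (a k i * a l (k + i)) (E (l + (k + i)))"
      by (simp add: a act_scale E_carr)
    also have "\<dots> = scal M (a l i * a k (i + l) - a k i * a l (i + k)) (E (k + l + i))"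
      by (simp add: V.scale_left_diff_distrib add.commute add.left_commute)
    finally show "a l i * a k (i + l) - a k i * a l (i + k) = of_int (l - k) * a (k + l) i"
      by (rule E_cancel[symmetric])
  qed
  define A where "A v = (\<Sum>i\<in>Poly_Mapping.keys v. scal M (Poly_Mapping.lookup v i) (E i))" for v
  note A_sum = sum_over_keys[OF V.vector_space_axioms, of _ _ E, folded A_def]
  have A_add: "A (v + w) = A v + A w" for v w
  proof -
    let ?I = "Poly_Mapping.keys v \<union> Poly_Mapping.keys w"
    have I: "finite ?I" "Poly_Mapping.keys v \<subseteq> ?I" "Poly_Mapping.keys w \<subseteq> ?I"
      "Poly_Mapping.keys (v + w) \<subseteq> ?I" using Poly_Mapping.keys_add[of v w] by auto
    show ?thesis
      by (simp add: A_sum[OF I(1,2)] A_sum[OF I(1,3)] A_sum[OF I(1,4)] lookup_add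
          V.scale_left_distrib sum.distrib)
  qed
  have A_scale: "A (zscale c v) = scal M c (A v)" for c v
  proof -
    have I: "Poly_Mapping.keys (zscale c v) \<subseteq> Poly_Mapping.keys v" by (auto simp: in_keys_iff)
    show ?thesis
      unfolding A_sum[OF finite_keys I] A_def[of v] V.scale_sum_right by simp
  qed
  have A_basis: "A (basis_vec i) = E i" for i
    using A_sum[of "{i}" "basis_vec i"] by (simp add: basis_vec_def)
  have A_carr: "A v \<in> carr M" for v
    unfolding A_def by (intro V.subspace_sum[OF sub] scale_carr E_carr)
  have A_0: "A 0 = 0" using A_scale[of 0 0] by simp
  have act_0: "act M x 0 = 0" for x using act_scale[OF E_carr, of x 0] by simp
  have zero_act: "act M 0 v = 0" if "v \<in> carr M" for v using scale_act[OF that, of 0 0] by simp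
  have A_act: "A (graded_product a x v) = act M x (A v)" for x v
  proof (induction x rule: zvec_induct)
    case (basis k)
    show ?case
    proof (induction v rule: zvec_induct)
      case (basis i)
      show ?case using a[of k i] by (simp add: graded_product_basis A_scale A_basis witt_L_def)
    qed (simp_all add: A_0 act_0 graded_product_simps A_add A_scale act_add act_scale A_carr)
  qed (simp_all add: A_0 zero_act graded_product_simps A_add A_scale add_act scale_act A_carr)
  have inj_idx: "inj_on (\<lambda>i. s0 + of_int i) I" for I :: "int set" by (simp add: inj_on_def)
  have decomp: "\<exists>!f. (\<forall>s. f s \<in> wt M s) \<and> finite {s. f s \<noteq> 0} \<and> m = (\<Sum>s\<in>{s. f s \<noteq> 0}. f s)"
    if "m \<in> carr M" for m
    using weight that by (simp add: weight_module_def)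
  have zero_wt: "0 \<in> wt M s" for s
    using act_0 V.subspace_0[OF sub] by (simp add: wt_def)
  have A_ker: "v = 0" if "A v = 0" for v
  proof -
    \<comment> \<open>The coordinates of \<open>v\<close> are spread out as a family indexed by all
      complex weights; \<open>idx\<close> recovers the index from the weight. The sum of this family
      is \<open>A v = 0\<close>, so uniqueness of the decomposition of 0 identifies it with the zero
      family.\<close>
    define idx where "idx s = (THE i. s = s0 + of_int i)" for s :: complex
    have idx: "idx (s0 + of_int i) = i" for i by (simp add: idx_def)
    define f where "f s = (if s \<in> range (\<lambda>i. s0 + of_int i)
        then scal M (Poly_Mapping.lookup v (idx s)) (E (idx s)) else 0)" for s
    have f_idx: "f (s0 + of_int i) = scal M (Poly_Mapping.lookup v i) (E i)" for i
      by (simp add: f_def idx)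
    have f_wt: "f s \<in> wt M s" for s
    proof (cases "s \<in> range (\<lambda>i. s0 + of_int i)")
      case True
      then obtain i where s: "s = s0 + of_int i" by blast
      show ?thesis unfolding s f_idx
        by (simp add: wt_def scale_carr E_carr act_scale E_L0 mult.commute)
    qed (simp add: f_def zero_wt)
    have supp: "{s. f s \<noteq> 0} \<subseteq> (\<lambda>i. s0 + of_int i) ` Poly_Mapping.keys v"
      by (auto simp: f_def idx in_keys_iff split: if_splits)
    then have fin: "finite {s. f s \<noteq> 0}" by (rule finite_subset) simp
    have "(\<Sum>s\<in>{s. f s \<noteq> 0}. f s) = (\<Sum>s\<in>(\<lambda>i. s0 + of_int i) ` Poly_Mapping.keys v. f s)"
      by (rule sum.mono_neutral_left) (use supp in auto)
    also have "\<dots> = A v" by (simp add: sum.reindex[OF inj_idx] f_idx A_def)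
    finally have "0 = (\<Sum>s\<in>{s. f s \<noteq> 0}. f s)" using that by simp
    then have 1: "(\<forall>s. f s \<in> wt M s) \<and> finite {s. f s \<noteq> 0} \<and> 0 = (\<Sum>s\<in>{s. f s \<noteq> 0}. f s)"
      using f_wt fin by blast
    have 2: "(\<forall>s. (\<lambda>_. 0) s \<in> wt M s) \<and> finite {s. (\<lambda>_. 0 :: 'a) s \<noteq> 0} \<and> 0 = (\<Sum>s\<in>{s. (\<lambda>_. 0 :: 'a) s \<noteq> 0}. (\<lambda>_ :: complex. 0 :: 'a) s)"
      using zero_wt by simp
    obtain f0 where unique: "\<And>g. (\<forall>s. g s \<in> wt M s) \<and> finite {s. g s \<noteq> 0} \<and>
        0 = (\<Sum>s\<in>{s. g s \<noteq> 0}. g s) \<Longrightarrow> g = f0"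
      using decomp[OF V.subspace_0[OF sub]] by (elim ex1E) blast
    have "f = f0" by (rule unique[OF 1])
    also have "f0 = (\<lambda>_. 0)" by (rule unique[OF 2, symmetric])
    finally have "f = (\<lambda>_. 0)" .
    then have "scal M (Poly_Mapping.lookup v i) (E i) = 0" for i using f_idx[of i] by simp
    then show ?thesis using E(2) by (intro poly_mapping_eqI) simp
  qed
  have A_diff: "A (v - w) = A v - A w" for v w
    using A_add[of "v - w" w] by (simp add: algebra_simps)
  have "inj A"
    by (rule injI) (metis A_diff A_ker right_minus_eq)
  moreover have "\<exists>v. m = A v" if m: "m \<in> carr M" for m
  proof -
    obtain f where f: "\<And>s. f s \<in> wt M s" "finite {s. f s \<noteq> 0}" "m = (\<Sum>s\<in>{s. f s \<noteq> 0}. f s)"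
      using decomp[OF m] by (elim ex1E) blast
    let ?J = "{i. f (s0 + of_int i) \<noteq> 0}"
    obtain g where g: "\<And>i. f (s0 + of_int i) = scal M (g i) (E i)" using E(3)[OF f(1)] by metis
    have image: "(\<lambda>i. s0 + of_int i) ` ?J = {s. f s \<noteq> 0}" using E(4) f(1) by fastforce
    then have "finite ?J" using f(2) finite_imageD[OF _ inj_idx] by metis
    have "A (\<Sum>i\<in>I. zscale (g i) (basis_vec i)) = (\<Sum>i\<in>I. scal M (g i) (E i))" if "finite I" for I
      using that by (induction I) (simp_all add: A_0 A_add A_scale A_basis)
    from this[OF \<open>finite ?J\<close>] have "A (\<Sum>i\<in>?J. zscale (g i) (basis_vec i)) = (\<Sum>i\<in>?J. f (s0 + of_int i))"
      by (simp add: g)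
    also have "\<dots> = m" unfolding f(3) image[symmetric] by (simp add: sum.reindex[OF inj_idx])
    finally show ?thesis by metis
  qed
  then have "range A = carr M" using A_carr by blast
  ultimately have "witt_iso (coord_mod a) M A"
    by (simp add: witt_iso_def equivariant_linear_def bij_betw_def A_carr A_add A_scale A_act)
  with sc show thesis using that by blast
qed

text \<open>This is the consequence of indecomposability on which the classification rests. If it
  fails, the line of \<open>e_0\<close> and the span of the other \<open>e_i\<close> are
  complementary submodules. For the families \<open>A\<close> and \<open>B\<close> it rules out the
  coordinates \<open>(0, 0)\<close>.\<close>

definition nonsplit :: "(int \<Rightarrow> int \<Rightarrow> complex) \<Rightarrow> bool" where
  "nonsplit a \<longleftrightarrow> (\<exists>k. a k 0 \<noteq> 0 \<or> a k (- k) \<noteq> 0)"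

lemma nonsplit_dual: "nonsplit (dual_coeff a) \<longleftrightarrow> nonsplit a"
  by (auto simp: nonsplit_def dual_coeff_def)

lemma nonsplit_A:
  assumes "rescales r a (A_coeff \<xi>)" "nonsplit a"
  shows "\<xi> \<noteq> (0, 0)"
proof
  assume "\<xi> = (0, 0)"
  moreover obtain k where "a k 0 \<noteq> 0 \<or> a k (- k) \<noteq> 0" using assms(2) nonsplit_def by blast
  moreover have "a k 0 * r (k + 0) = r 0 * A_coeff \<xi> k 0" "a k (- k) * r (k + - k) = r (- k) * A_coeff \<xi> k (- k)"
    "r i \<noteq> 0" for i
    using assms(1) unfolding rescales_def by blast+
  ultimately show False by (auto simp: A_coeff_def split: if_splits)
qed

lemma nonsplit_B:
  assumes "rescales r a (B_coeff \<xi>)" "nonsplit a"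
  shows "\<xi> \<noteq> (0, 0)"
proof
  assume "\<xi> = (0, 0)"
  moreover obtain k where "a k 0 \<noteq> 0 \<or> a k (- k) \<noteq> 0" using assms(2) nonsplit_def by blast
  moreover have "a k 0 * r (k + 0) = r 0 * B_coeff \<xi> k 0" "a k (- k) * r (k + - k) = r (- k) * B_coeff \<xi> k (- k)"
    "r i \<noteq> 0" for i
    using assms(1) unfolding rescales_def by blast+
  ultimately show False by (auto simp: B_coeff_def split: if_splits)
qed

lemma indecomposable_nonsplit:
  assumes ind: "indecomposable M" and iso: "witt_iso (coord_mod a) M A" and "vector_space (scal M)"
  shows "nonsplit a"
proof (rule ccontr)
  assume "\<not> nonsplit a"
  then have z: "a k 0 = 0" "a k (- k) = 0" for k by (auto simp: nonsplit_def)
  note A = witt_iso_coordD[OF iso]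
  interpret V: vector_space "scal M" by fact
  have A_0: "A 0 = 0" using A(3)[of 0 0] by simp
  have sub: "submodule M (A ` W)" if W: "0 \<in> W" "\<And>v w. v \<in> W \<Longrightarrow> w \<in> W \<Longrightarrow> v + w \<in> W"
    "\<And>c v. v \<in> W \<Longrightarrow> zscale c v \<in> W" "\<And>x v. v \<in> W \<Longrightarrow> graded_product a x v \<in> W" for W
    unfolding submodule_def
  proof (intro conjI allI ballI)
    show "V.subspace (A ` W)"
      unfolding V.subspace_def using W A_0 A(2,3) by (auto simp: image_iff) (metis, metis)
    show "A ` W \<subseteq> carr M" using A(1) by blast
    show "act M x v \<in> A ` W" if "v \<in> A ` W" for x v
      using that W(4) A(4) by (auto simp: image_iff) metis
  qed
  let ?U = "range (\<lambda>c. zscale c (basis_vec 0))" and ?V = "{v. Res v = 0}"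
  have lookup_act: "Poly_Mapping.lookup (graded_product a x v) n
      = (\<Sum>i\<in>Poly_Mapping.keys x. Poly_Mapping.lookup x i * Poly_Mapping.lookup v (n - i) * a i (n - i))" for x v n
    by (rule lookup_graded_product) auto
  have "graded_product a x (zscale c (basis_vec 0)) = 0" for x c
    by (rule poly_mapping_eqI) (auto simp: lookup_act lookup_basis_vec z intro!: sum.neutral)
  then have "graded_product a x v \<in> ?U" if "v \<in> ?U" for x v
    using that by (auto intro!: image_eqI[of _ _ 0])
  moreover have "v + w \<in> ?U" if "v \<in> ?U" "w \<in> ?U" for v w
  proof -
    obtain c d where "v = zscale c (basis_vec 0)" "w = zscale d (basis_vec 0)"
      using \<open>v \<in> ?U\<close> \<open>w \<in> ?U\<close> by blast
    then have "v + w = zscale (c + d) (basis_vec 0)"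
      by (intro poly_mapping_eqI) (simp add: lookup_add distrib_right)
    then show ?thesis by blast
  qed
  moreover have "zscale c v \<in> ?U" if "v \<in> ?U" for c v
  proof -
    obtain d where "v = zscale d (basis_vec 0)" using \<open>v \<in> ?U\<close> by blast
    then have "zscale c v = zscale (c * d) (basis_vec 0)" by (intro poly_mapping_eqI) simp
    then show ?thesis by blast
  qed
  moreover have "0 \<in> ?U" by (rule image_eqI[of _ _ 0]) simp_all
  ultimately have U: "submodule M (A ` ?U)" by (intro sub)
  have "Res (graded_product a x v) = 0" for x v
    unfolding Res_def lookup_act by (intro sum.neutral) (simp add: z)
  then have V: "submodule M (A ` ?V)"
    by (intro sub) (simp_all add: Res_def lookup_add)
  have split: "\<exists>u v. u \<in> ?U \<and> v \<in> ?V \<and> w = u + v" for w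
    by (intro exI[of _ "zscale (Res w) (basis_vec 0)"] exI[of _ "w - zscale (Res w) (basis_vec 0)"])
      (auto simp: Res_def lookup_minus lookup_basis_vec)
  have "carr M = {u + v |u v. u \<in> A ` ?U \<and> v \<in> A ` ?V}"
  proof (intro equalityI subsetI)
    fix m assume "m \<in> carr M"
    then have "m = A (inv A m)" using A(6) by simp
    moreover obtain u v where "u \<in> ?U" "v \<in> ?V" "inv A m = u + v" using split by blast
    ultimately have "m = A u + A v" "A u \<in> A ` ?U" "A v \<in> A ` ?V" using A(2) by simp_all
    then show "m \<in> {u + v |u v. u \<in> A ` ?U \<and> v \<in> A ` ?V}" by blast
  next
    fix m assume "m \<in> {u + v |u v. u \<in> A ` ?U \<and> v \<in> A ` ?V}"
    then obtain u v where "m = A u + A v" by blast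
    then show "m \<in> carr M" using A(1)[of "u + v"] A(2) by simp
  qed
  moreover have "A ` ?U \<inter> A ` ?V = {0}"
  proof -
    have "?U \<inter> ?V = {0}"
      using \<open>0 \<in> ?U\<close> by (auto simp: Res_def lookup_basis_vec)
    moreover have "A ` ?U \<inter> A ` ?V = A ` (?U \<inter> ?V)"
      using A(7) by (intro image_Int[symmetric] injI) simp
    ultimately show ?thesis using A_0 by simp
  qed
  ultimately have "A ` ?U = {0} \<or> A ` ?V = {0}"
    using ind U V unfolding indecomposable_def by blast
  moreover have "basis_vec i \<noteq> 0" for i
    using lookup_basis_vec[of i i] by auto
  then have "A (basis_vec i) \<noteq> 0" for i using A(7)[of "basis_vec i" 0] A_0 by simp
  moreover have "A (basis_vec 0) \<in> A ` ?U" by (intro imageI range_eqI[of _ _ 1] poly_mapping_eqI) simp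
  moreover have "A (basis_vec 1) \<in> A ` ?V" by (intro imageI) (simp add: Res_def lookup_basis_vec)
  ultimately show False by (metis singletonD)
qed

section \<open>The classification in coordinates\<close>

text \<open>If \<open>c\<close> describes \<open>P^*\<close>, then \<open>dual_coeff c\<close> describes \<open>P\<close>, and the trilinear form \<open>f\<close>
  becomes the bilinear map with coefficients \<open>f i j (- i - j)\<close>.\<close>

definition listed_form ::
  "(int \<Rightarrow> int \<Rightarrow> complex) \<Rightarrow> (int \<Rightarrow> int \<Rightarrow> complex) \<Rightarrow> (int \<Rightarrow> int \<Rightarrow> complex)
     \<Rightarrow> (int \<Rightarrow> int \<Rightarrow> int \<Rightarrow> complex) \<Rightarrow> bool" where
  "listed_form a b c f \<longleftrightarrow> conj_to_listed (coord_mod a) (coord_mod b) (coord_mod (dual_coeff c))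
     (graded_product (\<lambda>i j. f i j (- i - j)))"

context thin_invariant_form
begin

lemma no_off_listed:
  assumes "\<not> off1" "\<not> off2" "\<not> off3" "f i j l \<noteq> 0" "nonsplit a" "nonsplit b" "nonsplit c"
  shows "listed_form a b c f"
proof -
  obtain r s t \<xi>\<^sub>1 \<xi>\<^sub>2 \<xi>\<^sub>3 where r: "rescales r a (A_coeff \<xi>\<^sub>1)" and s: "rescales s b (A_coeff \<xi>\<^sub>2)"
    and t: "rescales t (dual_coeff c) (B_coeff \<xi>\<^sub>3)" and f0: "\<And>i j l. i \<noteq> 0 \<or> j \<noteq> 0 \<Longrightarrow> f i j l = 0"
    using no_off_normal_form[OF assms(1-4)] by metis
  let ?e = "f 0 0 0 * t 0 / (r 0 * s 0)"
  have nz: "r 0 \<noteq> 0" "s 0 \<noteq> 0" using r s by (simp_all add: rescales_def)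
  have "f i j (- i - j) * t (i + j) = r i * s j * corner_coeff ?e i j" for i j
    using f0[of i j] nz by (cases "i = 0 \<and> j = 0") (auto simp: corner_coeff_def)
  from conjugate_diagonal[OF r s t this]
  have "conj_trivial (coord_mod a) (coord_mod b) (coord_mod (dual_coeff c)) (graded_product (\<lambda>i j. f i j (- i - j)))"
    unfolding conj_trivial_def
    using trivial_map_corner[of \<xi>\<^sub>1 \<xi>\<^sub>2 \<xi>\<^sub>3 ?e] nonsplit_A[OF r] nonsplit_A[OF s] nonsplit_B[OF t]
      assms(5-7) unfolding A_mod_eq B_mod_eq nonsplit_dual by blast
  then show ?thesis by (simp add: listed_form_def conj_to_listed_def)
qed

lemma only_off1_listed:
  assumes "off1" "\<not> off2" "\<not> off3" "nonsplit a"
  shows "listed_form a b c f"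
proof -
  obtain r \<xi> where r: "rescales r a (A_coeff \<xi>)" and i0: "\<And>i j l. i \<noteq> 0 \<Longrightarrow> f i j l = 0"
    and inter: "\<And>k j. b k j * f 0 (j + k) (- j - k) = dual_coeff c k j * f 0 j (- j)"
    and ker: "\<And>j. f 0 j (- j) = 0 \<Longrightarrow> v + of_int j = 0"
    using only_off1_normal_form[OF assms(1-3)] by metis
  have nz: "r 0 \<noteq> 0" using r by (simp add: rescales_def)
  \<comment> \<open>\<open>M\<close> is moved to \<open>A_mod \<xi>\<close> by
    \<open>diagonal r\<close> while \<open>N\<close> and \<open>P\<close> stay fixed; dividing by
    \<open>r 0\<close> compensates the scaling of the vector that \<open>Res\<close>
    detects.\<close>
  define g where "g j = f 0 j (- j) / r 0" for j
  have "equivariant_linear (coord_mod b) (coord_mod (dual_coeff c)) (diagonal g)"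
  proof (rule equivariant_diagonal)
    fix k i :: int
    have "- (k + i) = - i - k" by simp
    then show "b k i * g (k + i) = g i * dual_coeff c k i"
      using inter[of k i] by (simp add: g_def add.commute mult.commute)
  qed
  moreover have "{v. diagonal g v = 0} \<subseteq> module.span zscale {basis_vec 0}"
  proof
    interpret Z: vector_space zscale by (rule vector_space_zscale)
    fix x assume "x \<in> {v. diagonal g v = 0}"
    then have "g j * Poly_Mapping.lookup x j = 0" for j
      using lookup_diagonal[of g x j] by simp
    then have "Poly_Mapping.lookup x j = 0" if "j \<noteq> 0" for j
      using ker[of j] v_normal[of j] that nz by (auto simp: g_def)
    then have "x = zscale (Poly_Mapping.lookup x 0) (basis_vec 0)"
      by (intro poly_mapping_eqI) (simp add: lookup_basis_vec)
    then show "x \<in> Z.span {basis_vec 0}" unfolding Z.span_singleton by blast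
  qed
  ultimately have "almost_iso (coord_mod b) (coord_mod (dual_coeff c)) (diagonal g)"
    unfolding almost_iso_def by (intro conjI exI[of _ "{basis_vec 0}"]) simp_all
  moreover have "conjugate (coord_mod a) (coord_mod b) (coord_mod (dual_coeff c))
      (graded_product (\<lambda>i j. f i j (- i - j))) (A_mod \<xi>) (coord_mod b) (coord_mod (dual_coeff c))
      (\<lambda>m n. zscale (Res m) (diagonal g n))"
    unfolding conjugate_def
  proof (intro exI conjI ballI)
    show "witt_iso (coord_mod a) (A_mod \<xi>) (diagonal r)"
      unfolding A_mod_eq using r by (rule witt_iso_diagonal)
    show "witt_iso (coord_mod b) (coord_mod b) id" "witt_iso (coord_mod (dual_coeff c)) (coord_mod (dual_coeff c)) id"
      by (simp_all add: witt_iso_def equivariant_linear_def)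
    show "id (graded_product (\<lambda>i j. f i j (- i - j)) x y) = zscale (Res (diagonal r x)) (diagonal g (id y))" for x y
      by (rule poly_mapping_eqI)
        (use nz in \<open>simp add: lookup_graded_product_row_0 i0 g_def\<close>, simp add: Res_def)
  qed
  ultimately have "conj_Res_almost_iso (coord_mod a) (coord_mod b) (coord_mod (dual_coeff c))
      (graded_product (\<lambda>i j. f i j (- i - j)))"
    unfolding conj_Res_almost_iso_def using nonsplit_A[OF r assms(4)]
    by (intro exI[of _ \<xi>] exI[of _ "diagonal g"]) simp
  then show ?thesis by (simp add: listed_form_def conj_to_listed_def)
qed

lemma off12_listed:
  assumes "off1" "off2" "\<not> off3" "nonsplit a" "nonsplit b" "nonsplit c"
  shows "listed_form a b c f"
proof -
  obtain r s t \<xi>\<^sub>1 \<xi>\<^sub>2 \<xi>\<^sub>3 x y where r: "rescales r a (A_coeff \<xi>\<^sub>1)" and s: "rescales s b (A_coeff \<xi>\<^sub>2)"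
    and t: "rescales t (dual_coeff c) (A_coeff \<xi>\<^sub>3)"
    and g: "\<And>i j. f i j (- i - j) * t (i + j) = r i * s j * eta_coeff x y (x + y) i j"
    and xy: "x \<noteq> 0" "y \<noteq> 0"
    and rel: "x * fst \<xi>\<^sub>1 + y * fst \<xi>\<^sub>2 = (x + y) * fst \<xi>\<^sub>3" "x * snd \<xi>\<^sub>1 + y * snd \<xi>\<^sub>2 = (x + y) * snd \<xi>\<^sub>3"
    by (rule off12_normal_form[OF assms(1-3)]) (rule that, assumption+)
  have nz: "\<xi>\<^sub>1 \<noteq> (0, 0)" "\<xi>\<^sub>2 \<noteq> (0, 0)" "\<xi>\<^sub>3 \<noteq> (0, 0)"
    using nonsplit_A[OF r] nonsplit_A[OF s] nonsplit_A[OF t] assms(4-6) nonsplit_dual by blast+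
  show ?thesis
  proof (cases "same_point \<xi>\<^sub>3 \<xi>\<^sub>1 \<or> same_point \<xi>\<^sub>3 \<xi>\<^sub>2")
    case False
    have "conj_eta (coord_mod a) (coord_mod b) (coord_mod (dual_coeff c)) (graded_product (\<lambda>i j. f i j (- i - j)))"
      unfolding conj_eta_def
    proof (intro exI conjI)
      show "(fst \<xi>\<^sub>1, snd \<xi>\<^sub>1) \<noteq> (0, 0)" "(fst \<xi>\<^sub>2, snd \<xi>\<^sub>2) \<noteq> (0, 0)" "(fst \<xi>\<^sub>3, snd \<xi>\<^sub>3) \<noteq> (0, 0)"
        using nz by simp_all
      show "\<not> same_point (fst \<xi>\<^sub>3, snd \<xi>\<^sub>3) (fst \<xi>\<^sub>1, snd \<xi>\<^sub>1)" "\<not> same_point (fst \<xi>\<^sub>3, snd \<xi>\<^sub>3) (fst \<xi>\<^sub>2, snd \<xi>\<^sub>2)"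
        using False by simp_all
      show "(x, y, x + y) \<noteq> (0, 0, 0)" using xy by simp
      show "(x + y) * fst \<xi>\<^sub>3 = x * fst \<xi>\<^sub>1 + y * fst \<xi>\<^sub>2" "(x + y) * snd \<xi>\<^sub>3 = x * snd \<xi>\<^sub>1 + y * snd \<xi>\<^sub>2"
        using rel by simp_all
      show "conjugate (coord_mod a) (coord_mod b) (coord_mod (dual_coeff c)) (graded_product (\<lambda>i j. f i j (- i - j)))
        (A_mod (fst \<xi>\<^sub>1, snd \<xi>\<^sub>1)) (A_mod (fst \<xi>\<^sub>2, snd \<xi>\<^sub>2)) (A_mod (fst \<xi>\<^sub>3, snd \<xi>\<^sub>3)) (eta_map x y)"
        using conjugate_diagonal[OF r s t g] by (simp add: A_mod_eq eta_map_eq)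
    qed
    then show ?thesis by (simp add: listed_form_def conj_to_listed_def)
  next
    case True
    \<comment> \<open>As both \<open>x\<close> and \<open>y\<close> are non-zero, the linear
      relation forces the remaining point to coincide with \<open>\<xi>\<^sub>3\<close> as soon as
      one of the first two does. All three points are then equal, and the map is of the type
      \<open>eta_t_map\<close>.\<close>
    have proportional: "\<exists>k. k \<noteq> 0 \<and> fst \<zeta>' = k * fst \<xi>\<^sub>3 \<and> snd \<zeta>' = k * snd \<xi>\<^sub>3"
      if "k \<noteq> 0" "fst \<zeta> = k * fst \<xi>\<^sub>3" "snd \<zeta> = k * snd \<xi>\<^sub>3" "p * fst \<zeta> + q * fst \<zeta>' = (p + q) * fst \<xi>\<^sub>3"
        "p * snd \<zeta> + q * snd \<zeta>' = (p + q) * snd \<xi>\<^sub>3" "q \<noteq> 0" "\<zeta>' \<noteq> (0, 0)" for k p q \<zeta> \<zeta>'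
    proof -
      let ?k = "(p + q - p * k) / q"
      have "q * fst \<zeta>' = (p + q - p * k) * fst \<xi>\<^sub>3" "q * snd \<zeta>' = (p + q - p * k) * snd \<xi>\<^sub>3"
        using that(2-5) by (simp_all add: algebra_simps)
      then have "fst \<zeta>' = ?k * fst \<xi>\<^sub>3" "snd \<zeta>' = ?k * snd \<xi>\<^sub>3"
        using \<open>q \<noteq> 0\<close> by (simp_all add: field_simps)
      moreover from this have "?k \<noteq> 0" using \<open>\<zeta>' \<noteq> (0, 0)\<close> by (metis mult_zero_left prod.collapse)
      ultimately show ?thesis by blast
    qed
    obtain k1 k2 where k: "k1 \<noteq> 0" "fst \<xi>\<^sub>1 = k1 * fst \<xi>\<^sub>3" "snd \<xi>\<^sub>1 = k1 * snd \<xi>\<^sub>3"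
      "k2 \<noteq> 0" "fst \<xi>\<^sub>2 = k2 * fst \<xi>\<^sub>3" "snd \<xi>\<^sub>2 = k2 * snd \<xi>\<^sub>3"
      using True
    proof
      assume "same_point \<xi>\<^sub>3 \<xi>\<^sub>1"
      then obtain k where k: "k \<noteq> 0" "fst \<xi>\<^sub>1 = k * fst \<xi>\<^sub>3" "snd \<xi>\<^sub>1 = k * snd \<xi>\<^sub>3"
        unfolding same_point_def by blast
      from proportional[OF k rel xy(2) nz(2)] k show thesis using that by blast
    next
      assume "same_point \<xi>\<^sub>3 \<xi>\<^sub>2"
      then obtain k where k: "k \<noteq> 0" "fst \<xi>\<^sub>2 = k * fst \<xi>\<^sub>3" "snd \<xi>\<^sub>2 = k * snd \<xi>\<^sub>3"
        unfolding same_point_def by blast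
      have "y * fst \<xi>\<^sub>2 + x * fst \<xi>\<^sub>1 = (y + x) * fst \<xi>\<^sub>3" "y * snd \<xi>\<^sub>2 + x * snd \<xi>\<^sub>1 = (y + x) * snd \<xi>\<^sub>3"
        using rel by (simp_all add: add.commute)
      from proportional[OF k this xy(1) nz(1)] k show thesis using that by blast
    qed
    have sum: "x * k1 + y * k2 = x + y"
    proof -
      have "(x * k1 + y * k2 - (x + y)) * fst \<xi>\<^sub>3 = 0" "(x * k1 + y * k2 - (x + y)) * snd \<xi>\<^sub>3 = 0"
        using rel k by (simp_all add: algebra_simps)
      then show ?thesis using nz(3) by (metis eq_iff_diff_eq_0 mult_eq_0_iff prod.collapse)
    qed
    have r': "rescales (\<lambda>i. r i * (if i = 0 then k1 else 1)) a (A_coeff \<xi>\<^sub>3)"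
      using rescales_A_A[OF r k(1)] k by simp
    have s': "rescales (\<lambda>i. s i * (if i = 0 then k2 else 1)) b (A_coeff \<xi>\<^sub>3)"
      using rescales_A_A[OF s k(4)] k by simp
    \<comment> \<open>Scaling the target as a whole by \<open>k1 / y\<close> makes the coefficient
      of \<open>Res(m) n\<close> equal to 1. The coefficient of \<open>Res(n) m\<close> then becomes
      \<open>?T\<close>, and the relation \<open>sum\<close> ensures that the corner value is
      \<open>?T + 1\<close>.\<close>
    have t': "rescales (\<lambda>i. t i * (k1 / y)) (dual_coeff c) (A_coeff \<xi>\<^sub>3)"
      using t k(1) xy(2) by (simp add: rescales_def)
    let ?T = "x * k1 / (y * k2)"
    have scaled: "eta_coeff x y (x + y) i j * (k1 / y)
        = (if i = 0 then k1 else 1) * (if j = 0 then k2 else 1) * eta_coeff ?T 1 (?T + 1) i j" for i j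
    proof -
      have "(x + y) * (k1 / y) = k1 * k2 * (?T + 1)"
        unfolding sum[symmetric] using k xy by (simp add: field_simps)
      then show ?thesis using k xy by (simp add: eta_coeff_def)
    qed
    have "f i j (- i - j) * (t (i + j) * (k1 / y))
        = r i * (if i = 0 then k1 else 1) * (s j * (if j = 0 then k2 else 1)) * eta_coeff ?T 1 (?T + 1) i j" for i j
    proof -
      have "f i j (- i - j) * (t (i + j) * (k1 / y)) = r i * s j * (eta_coeff x y (x + y) i j * (k1 / y))"
        using g[of i j] by (simp only: mult.assoc[symmetric])
      also note scaled
      finally show ?thesis by (simp only: mult.assoc mult.left_commute)
    qed
    from conjugate_diagonal[OF r' s' t' this]
    have "conj_eta_t (coord_mod a) (coord_mod b) (coord_mod (dual_coeff c)) (graded_product (\<lambda>i j. f i j (- i - j)))"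
      unfolding conj_eta_t_def using nz(3) k xy
      by (intro exI[of _ \<xi>\<^sub>3] exI[of _ ?T]) (simp add: A_mod_eq eta_t_map_eq eta_map_eq)
    then show ?thesis by (simp add: listed_form_def conj_to_listed_def)
  qed
qed

lemma off123_listed:
  assumes "off1" "off2" "off3" "nonsplit a"
  shows "listed_form a b c f"
proof -
  obtain r s t \<xi> e where r: "rescales r a (A_coeff \<xi>)" and s: "rescales s b (A_coeff \<xi>)"
    and t: "rescales t (dual_coeff c) (B_coeff \<xi>)"
    and eq: "\<And>i j. f i j (- i - j) * t (i + j) = r i * s j * theta_coeff e i j"
    by (rule off123_normal_form[OF assms(1-3)]) (rule that, assumption+)
  have "conjugate (coord_mod a) (coord_mod b) (coord_mod (dual_coeff c)) (graded_product (\<lambda>i j. f i j (- i - j)))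
      (A_mod \<xi>) (A_mod \<xi>) (B_mod \<xi>) (\<lambda>m n. Theta m n + graded_product (corner_coeff e) m n)"
    unfolding Theta_plus_corner A_mod_eq B_mod_eq using conjugate_diagonal[OF r s t eq] .
  then have "conj_Theta_plus_trivial (coord_mod a) (coord_mod b) (coord_mod (dual_coeff c))
      (graded_product (\<lambda>i j. f i j (- i - j)))"
    unfolding conj_Theta_plus_trivial_def
    using nonsplit_A[OF r assms(4)] trivial_map_corner[of \<xi> \<xi> \<xi> e] by blast
  then show ?thesis by (simp add: listed_form_def conj_to_listed_def)
qed

text \<open>The lemmas above treat one line as the first and two lines as the first two. Any other
  pattern is brought into one of these positions by a permutation of the three modules, and the
  module placed last is the one whose dual becomes the target.\<close>

lemma some_permutation_listed:
  assumes "f i j l \<noteq> 0" "nonsplit a" "nonsplit b" "nonsplit c"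
  shows "listed_form a b c f \<or> listed_form b a c (\<lambda>j i l. f i j l) \<or> listed_form a c b (\<lambda>i l j. f i j l)
    \<or> listed_form c a b (\<lambda>l i j. f i j l) \<or> listed_form b c a (\<lambda>j l i. f i j l)"
proof -
  interpret S: thin_invariant_form v b u a w c "\<lambda>j i l. f i j l" by (rule swap12)
  interpret T: thin_invariant_form u a w c v b "\<lambda>i l j. f i j l" by (rule swap23)
  interpret TS: thin_invariant_form w c u a v b "\<lambda>l i j. f i j l" by (rule T.swap12)
  interpret ST: thin_invariant_form v b w c u a "\<lambda>j l i. f i j l" by (rule S.swap23)
  have S_off: "S.off1 \<longleftrightarrow> off2" "S.off2 \<longleftrightarrow> off1" "S.off3 \<longleftrightarrow> off3"
    unfolding S.off1_def S.off2_def S.off3_def off1_def off2_def off3_def by blast+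
  have T_off: "T.off1 \<longleftrightarrow> off1" "T.off2 \<longleftrightarrow> off3" "T.off3 \<longleftrightarrow> off2"
    unfolding T.off1_def T.off2_def T.off3_def off1_def off2_def off3_def by blast+
  have TS_off: "TS.off1 \<longleftrightarrow> off3" "TS.off2 \<longleftrightarrow> off1" "TS.off3 \<longleftrightarrow> off2"
    unfolding TS.off1_def TS.off2_def TS.off3_def off1_def off2_def off3_def by blast+
  have ST_off: "ST.off1 \<longleftrightarrow> off2" "ST.off2 \<longleftrightarrow> off3" "ST.off3 \<longleftrightarrow> off1"
    unfolding ST.off1_def ST.off2_def ST.off3_def off1_def off2_def off3_def by blast+
  consider "\<not> off1" "\<not> off2" "\<not> off3" | "off1" "\<not> off2" "\<not> off3" | "\<not> off1" "off2" "\<not> off3"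
    | "\<not> off1" "\<not> off2" "off3" | "off1" "off2" "\<not> off3" | "off1" "\<not> off2" "off3"
    | "\<not> off1" "off2" "off3" | "off1" "off2" "off3" by blast
  then show ?thesis
  proof cases
    case 1 then show ?thesis using no_off_listed assms by blast
  next
    case 2 then show ?thesis using only_off1_listed assms by blast
  next
    case 3 then show ?thesis using S.only_off1_listed assms unfolding S_off by blast
  next
    case 4 then show ?thesis using TS.only_off1_listed assms unfolding TS_off by blast
  next
    case 5 then show ?thesis using off12_listed assms by blast
  next
    case 6 then show ?thesis using T.off12_listed assms unfolding T_off by blast
  next
    case 7 then show ?thesis using ST.off12_listed assms unfolding ST_off by blast
  next
    case 8 then show ?thesis using off123_listed assms by blast
  qed
qed

end

section \<open>Plane curves containing infinitely many points of a line\<close>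

lemma poly2_eq_poly_map_poly: "poly2 p x y = poly (map_poly (\<lambda>q. poly q x) p) y"
  unfolding poly2_def by (induction p) (simp_all add: map_poly_pCons)

text \<open>For vertical lines, the leading coefficient of \<open>p\<close> in the second variable
  must vanish at \<open>x\<close>. For the other two directions, \<open>p\<close> is viewed as a
  polynomial over \<open>\<complex>[X]\<close>: it vanishes at infinitely many points of the line
  \<open>y = q(x)\<close> only if \<open>q\<close> is one of its finitely many roots in that domain,
  with \<open>q\<close> constant or of the form \<open>s - X\<close>.\<close>

lemma poly2_lines:
  assumes "p \<noteq> 0"
  shows "finite {x. infinite {y. poly2 p x y = 0}}" "finite {y. infinite {x. poly2 p x y = 0}}"
    "finite {s. infinite {x. poly2 p x (s - x) = 0}}"
proof -
  have "poly (lead_coeff p) x = 0" if "infinite {y. poly2 p x y = 0}" for x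
  proof -
    have "map_poly (\<lambda>q. poly q x) p = 0"
      using that poly_roots_finite unfolding poly2_eq_poly_map_poly by blast
    then have "coeff (map_poly (\<lambda>q. poly q x) p) (degree p) = 0" by simp
    then show ?thesis by (simp add: coeff_map_poly)
  qed
  then have "{x. infinite {y. poly2 p x y = 0}} \<subseteq> {x. poly (lead_coeff p) x = 0}" by blast
  then show "finite {x. infinite {y. poly2 p x y = 0}}"
    by (rule finite_subset) (rule poly_roots_finite, use assms in simp)
  have roots: "finite {z. poly p (q z) = 0}" if "inj q" for q :: "complex \<Rightarrow> complex poly"
  proof -
    have "q ` {z. poly p (q z) = 0} \<subseteq> {r. poly p r = 0}" by blast
    then have "finite (q ` {z. poly p (q z) = 0})"
      by (rule finite_subset) (rule poly_roots_finite[OF assms])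
    then show ?thesis by (rule finite_imageD) (use that in \<open>auto simp: inj_on_def\<close>)
  qed
  have "{y. infinite {x. poly2 p x y = 0}} \<subseteq> {y. poly p [:y:] = 0}"
    using poly_roots_finite unfolding poly2_def by blast
  then show "finite {y. infinite {x. poly2 p x y = 0}}"
    by (rule finite_subset) (intro roots, simp add: inj_on_def)
  have shift: "poly2 p x (s - x) = poly (poly p [:s, - 1:]) x" for s x
    unfolding poly2_def by (induction p) (simp_all add: left_diff_distrib)
  have "{s. infinite {x. poly2 p x (s - x) = 0}} \<subseteq> {s. poly p [:s, - 1:] = 0}"
    using poly_roots_finite unfolding shift by blast
  then show "finite {s. infinite {x. poly2 p x (s - x) = 0}}"
    by (rule finite_subset) (intro roots, simp add: inj_on_def)
qed

lemma not_zariski_dense_poly: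
  assumes "\<not> zariski_dense S"
  obtains p where "p \<noteq> 0" "\<And>x y. (x, y) \<in> S \<Longrightarrow> poly2 p x y = 0"
proof -
  obtain F where F: "S \<subseteq> {(x, y). \<forall>p\<in>F. poly2 p x y = 0}" "{(x, y). \<forall>p\<in>F. poly2 p x y = 0} \<noteq> UNIV"
    using assms unfolding zariski_dense_def zariski_closed_def by blast
  then obtain p x y where p: "p \<in> F" "poly2 p x y \<noteq> 0" by blast
  then have "p \<noteq> 0" by (auto simp: poly2_def)
  then show thesis using that F(1) p(1) by blast
qed

text \<open>This carries finiteness of the set of heavy lines from the plane to indices:
  \<open>\<phi>\<close> sends an index to the parameter of its line, and \<open>\<psi> i\<close>
  places the points of the support on that line.\<close>

lemma finite_infinite_fibres:
  assumes fin: "finite {x. infinite {y. Q x y}}" and "inj \<phi>" and inj: "\<And>i. inj_on (\<psi> i) {t. R i t}"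
    and RQ: "\<And>i t. R i t \<Longrightarrow> Q (\<phi> i) (\<psi> i t)"
  shows "finite {i. infinite {t. R i t}}"
proof -
  have "\<phi> i \<in> {x. infinite {y. Q x y}}" if "infinite {t. R i t}" for i
  proof -
    have "infinite (\<psi> i ` {t. R i t})" using that inj by (simp add: finite_image_iff)
    moreover have "\<psi> i ` {t. R i t} \<subseteq> {y. Q (\<phi> i) y}" using RQ by blast
    ultimately show ?thesis using infinite_super by blast
  qed
  then have "\<phi> ` {i. infinite {t. R i t}} \<subseteq> {x. infinite {y. Q x y}}" by blast
  then have "finite (\<phi> ` {i. infinite {t. R i t}})" using fin by (rule finite_subset)
  then show ?thesis by (rule finite_imageD) (rule inj_on_subset[OF \<open>inj \<phi>\<close>], simp)
qed

section \<open>Degenerate maps in coordinates\<close>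

lemma class_S_normal_weight:
  assumes "class_S M"
  obtains u where "u \<in> Supp M" "\<And>i. u + of_int i = 0 \<Longrightarrow> i = 0"
proof (cases "0 \<in> Supp M")
  case True
  then show thesis by (rule that) simp
next
  case False
  obtain u where u: "Supp M = {u + of_int n |n. True}" using assms by (auto simp: class_S_def)
  then have "u \<in> Supp M" by (auto intro: exI[of _ 0])
  moreover have "u + of_int i \<noteq> 0" for i using False u by auto
  ultimately show thesis using that by blast
qed

lemma class_S_shift:
  assumes "class_S M"
  shows "s + of_int n \<in> Supp M \<longleftrightarrow> s \<in> Supp M"
proof -
  obtain u where u: "Supp M = {u + of_int n |n. True}" using assms by (auto simp: class_S_def)
  show ?thesis
  proof
    assume "s + of_int n \<in> Supp M"
    then obtain m where "s + of_int n = u + of_int m" using u by auto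
    then have "s = u + of_int (m - n)" by (simp add: algebra_simps)
    then show "s \<in> Supp M" using u by blast
  next
    assume "s \<in> Supp M"
    then obtain m where "s = u + of_int m" using u by auto
    then have "s + of_int n = u + of_int (m + n)" by simp
    then show "s + of_int n \<in> Supp M" using u by blast
  qed
qed

context
  fixes M :: "'m::ab_group_add wmod" and N :: "'n::ab_group_add wmod" and P :: "'p::ab_group_add wmod"
    and \<pi> :: "'m \<Rightarrow> 'n \<Rightarrow> 'p" and u v :: complex and a b :: "int \<Rightarrow> int \<Rightarrow> complex" and A B
  assumes \<pi>: "equivariant_bilinear M N P \<pi>"
    and A: "structure_constants u a" "witt_iso (coord_mod a) M A"
    and B: "structure_constants v b" "witt_iso (coord_mod b) N B"
begin

lemma \<pi>_bilinear:
  "\<pi> (A x) (B y) \<in> carr P"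
  "\<pi> (A (x + x')) (B y) = \<pi> (A x) (B y) + \<pi> (A x') (B y)"
  "\<pi> (A x) (B (y + y')) = \<pi> (A x) (B y) + \<pi> (A x) (B y')"
  "\<pi> (A (zscale k x)) (B y) = scal P k (\<pi> (A x) (B y))"
  "\<pi> (A x) (B (zscale k y)) = scal P k (\<pi> (A x) (B y))"
  using \<pi> witt_iso_coordD(1)[OF A(2)] witt_iso_coordD(1)[OF B(2)]
  unfolding equivariant_bilinear_def witt_iso_coordD(2,3)[OF A(2)] witt_iso_coordD(2,3)[OF B(2)]
  by blast+

lemma \<pi>_act:
  "act P z (\<pi> (A x) (B y)) = \<pi> (A (graded_product a z x)) (B y) + \<pi> (A x) (B (graded_product b z y))"
  using \<pi> witt_iso_coordD(1)[OF A(2)] witt_iso_coordD(1)[OF B(2)]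
  unfolding equivariant_bilinear_def witt_iso_coordD(4)[OF A(2)] witt_iso_coordD(4)[OF B(2)]
  by blast

lemma \<pi>_weight:
  assumes "vector_space (scal P)"
  shows "\<pi> (A (basis_vec i)) (B (basis_vec j)) \<in> wt P (u + v + of_int (i + j))"
proof -
  interpret P: vector_space "scal P" by fact
  interpret sA: structure_constants u a by (rule A(1))
  interpret sB: structure_constants v b by (rule B(1))
  have "act P (witt_L 0) (\<pi> (A (basis_vec i)) (B (basis_vec j)))
      = scal P (u + of_int i) (\<pi> (A (basis_vec i)) (B (basis_vec j)))
        + scal P (v + of_int j) (\<pi> (A (basis_vec i)) (B (basis_vec j)))"
    by (simp only: \<pi>_act witt_L_def graded_product_basis \<pi>_bilinear add_0 sA.L0 sB.L0)
  also have "\<dots> = scal P (u + v + of_int (i + j)) (\<pi> (A (basis_vec i)) (B (basis_vec j)))"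
    by (simp only: P.scale_left_distrib[symmetric] of_int_add ac_simps)
  finally show ?thesis using \<pi>_bilinear(1) by (simp add: wt_def)
qed

lemma \<pi>_nonzero_basis:
  assumes "vector_space (scal P)" "\<pi> (A x) (B y) \<noteq> 0"
  obtains i j where "\<pi> (A (basis_vec i)) (B (basis_vec j)) \<noteq> 0"
proof (rule ccontr)
  assume "\<not> thesis"
  then have z: "\<pi> (A (basis_vec i)) (B (basis_vec j)) = 0" for i j using that by blast
  interpret P: vector_space "scal P" by fact
  have "\<pi> (A x) (B y) = 0"
  proof (induction x rule: zvec_induct)
    case zero
    show ?case using \<pi>_bilinear(4)[of 0 0 y] by simp
  next
    case (basis i)
    show ?case
    proof (induction y rule: zvec_induct)
      case zero
      show ?case using \<pi>_bilinear(5)[of "basis_vec i" 0 0] by simp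
    qed (simp_all add: z \<pi>_bilinear)
  qed (simp_all add: \<pi>_bilinear)
  then show False using assms(2) by simp
qed

lemma \<pi>_coordinates:
  assumes C: "structure_constants (u + v) c" "witt_iso (coord_mod c) P C" and "vector_space (scal P)"
  obtains f where "\<And>x y. \<pi> (A x) (B y) = C (graded_product f x y)"
    "\<And>k i j. c k (i + j) * f i j = a k i * f (i + k) j + b k j * f i (j + k)"
proof -
  interpret P: vector_space "scal P" by fact
  note C' = witt_iso_coordD[OF C(2)]
  have C_0: "C 0 = 0" using C'(3)[of 0 0] by simp
  define f where "f i j = Poly_Mapping.lookup (inv C (\<pi> (A (basis_vec i)) (B (basis_vec j)))) (i + j)" for i j
  have on_basis: "\<pi> (A (basis_vec i)) (B (basis_vec j)) = C (graded_product f (basis_vec i) (basis_vec j))" for i j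
  proof -
    let ?p = "\<pi> (A (basis_vec i)) (B (basis_vec j))"
    have p: "C (inv C ?p) = ?p" by (rule C'(6)[OF \<pi>_bilinear(1)])
    have "Poly_Mapping.lookup (inv C ?p) n = 0" if "n \<noteq> i + j" for n
      using weight_coordinates[OF C(2,1), of "inv C ?p" "u + v + of_int (i + j)" n]
        \<pi>_weight[OF assms(3), of i j] that unfolding p by (simp del: of_int_add)
    then have "inv C ?p = zscale (f i j) (basis_vec (i + j))"
      by (intro poly_mapping_eqI) (auto simp: lookup_basis_vec f_def)
    then show ?thesis using p by (simp add: graded_product_basis)
  qed
  have eq: "\<pi> (A x) (B y) = C (graded_product f x y)" for x y
  proof (induction x rule: zvec_induct)
    case zero
    show ?case using \<pi>_bilinear(4)[of 0 0 y] by (simp add: C_0)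
  next
    case (basis i)
    show ?case
    proof (induction y rule: zvec_induct)
      case zero
      show ?case using \<pi>_bilinear(5)[of "basis_vec i" 0 0] by (simp add: C_0)
    qed (simp_all only: on_basis \<pi>_bilinear graded_product_simps C'(2,3))
  qed (simp_all only: \<pi>_bilinear graded_product_simps C'(2,3))
  have "c k (i + j) * f i j = a k i * f (i + k) j + b k j * f i (j + k)" for k i j
  proof -
    let ?e = basis_vec
    have "C (graded_product c (?e k) (graded_product f (?e i) (?e j)))
        = C (graded_product f (graded_product a (?e k) (?e i)) (?e j) + graded_product f (?e i) (graded_product b (?e k) (?e j)))"
      using \<pi>_act[of "?e k" "?e i" "?e j"] unfolding eq by (simp only: C'(2,4))
    then have "graded_product c (?e k) (graded_product f (?e i) (?e j))
        = graded_product f (graded_product a (?e k) (?e i)) (?e j) + graded_product f (?e i) (graded_product b (?e k) (?e j))"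
      by (simp only: C'(7))
    then have "Poly_Mapping.lookup (graded_product c (?e k) (graded_product f (?e i) (?e j))) (i + j + k)
        = Poly_Mapping.lookup (graded_product f (graded_product a (?e k) (?e i)) (?e j)) (i + j + k)
          + Poly_Mapping.lookup (graded_product f (?e i) (graded_product b (?e k) (?e j))) (i + j + k)"
      by (simp only: lookup_add)
    then show ?thesis
      by (simp add: graded_product_basis graded_product_simps lookup_basis_vec ac_simps)
  qed
  with eq show thesis by (rule that)
qed

end

theorem theorem1:
  fixes M :: "'m::ab_group_add wmod"
    and N :: "'n::ab_group_add wmod"
    and P :: "'p::ab_group_add wmod"
    and \<pi> :: "'m \<Rightarrow> 'n \<Rightarrow> 'p"
  assumes "class_S M" and "class_S N" and "class_S P"
    and "indecomposable M" and "indecomposable N" and "indecomposable P"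
    and "equivariant_bilinear M N P \<pi>"
    and "\<exists>m\<in>carr M. \<exists>n\<in>carr N. \<pi> m n \<noteq> 0"
    and "degenerate M N \<pi>"
  shows "S3_conj_to_listed M N P \<pi>"
proof -
  have vs: "vector_space (scal M)" "vector_space (scal N)" "vector_space (scal P)"
    using assms(1-3) by (simp_all add: class_S_def witt_module_def)
  obtain u where u: "u \<in> Supp M" "\<And>i. u + of_int i = 0 \<Longrightarrow> i = 0"
    using class_S_normal_weight[OF assms(1)] by metis
  \<comment> \<open>The index of weight 0 has to be normalised for all three modules at once,
    although the third origin is determined by the first two. If \<open>- u\<close> is a weight of
    \<open>N\<close>, then \<open>v = - u\<close> achieves this; otherwise \<open>u + v + i\<close>
    never vanishes and the third condition is vacuous.\<close>
  obtain v where v: "v \<in> Supp N" "\<And>i. v + of_int i = 0 \<Longrightarrow> i = 0"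
    "\<And>i. u + v + of_int i = 0 \<Longrightarrow> i = 0"
  proof (cases "- u \<in> Supp N")
    case True
    have "i = 0" if "- u + of_int i = 0" for i using u(2)[of "- i"] that by (simp add: eq_neg_iff_add_eq_0)
    then show thesis using that[of "- u"] True by simp
  next
    case False
    obtain v where v: "v \<in> Supp N" "\<And>i. v + of_int i = 0 \<Longrightarrow> i = 0"
      using class_S_normal_weight[OF assms(2)] by metis
    have "u + v + of_int i \<noteq> 0" for i
    proof
      assume "u + v + of_int i = 0"
      then have "v + of_int i = - u" by (simp add: eq_neg_iff_add_eq_0 ac_simps)
      then show False using class_S_shift[OF assms(2), of v i] v(1) False by simp
    qed
    then show thesis using that v by blast
  qed
  obtain a A where A: "structure_constants u a" "witt_iso (coord_mod a) M A"
    using class_S_coordinates[OF assms(1) u(1)] .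
  obtain b B where B: "structure_constants v b" "witt_iso (coord_mod b) N B"
    using class_S_coordinates[OF assms(2) v(1)] .
  note \<pi> = assms(7) A B
  obtain m n where mn: "m \<in> carr M" "n \<in> carr N" "\<pi> m n \<noteq> 0" using assms(8) by blast
  then have "\<pi> (A (inv A m)) (B (inv B n)) \<noteq> 0"
    using witt_iso_coordD(6)[OF A(2)] witt_iso_coordD(6)[OF B(2)] by simp
  then obtain i0 j0 where nz: "\<pi> (A (basis_vec i0)) (B (basis_vec j0)) \<noteq> 0"
    using \<pi>_nonzero_basis[OF \<pi> vs(3)] by blast
  have "u + v + of_int (i0 + j0) \<in> Supp P"
    using nz \<pi>_weight[OF \<pi> vs(3), of i0 j0] unfolding Supp_def by blast
  then have "u + v \<in> Supp P" using class_S_shift[OF assms(3)] by blast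
  then obtain c C where C: "structure_constants (u + v) c" "witt_iso (coord_mod c) P C"
    by (rule class_S_coordinates[OF assms(3)])
  obtain f where f: "\<And>x y. \<pi> (A x) (B y) = C (graded_product f x y)"
    and inv: "\<And>k i j. c k (i + j) * f i j = a k i * f (i + k) j + b k j * f i (j + k)"
    using \<pi>_coordinates[OF \<pi> C vs(3)] by blast
  define g where "g i j l = (if i + j + l = 0 then f i j else 0)" for i j l
  have C_0: "C 0 = 0" using witt_iso_coordD(2)[OF C(2), of 0 0] by simp
  have in_support: "(u + of_int i, v + of_int j) \<in> bisupport M N \<pi>" if "f i j \<noteq> 0" for i j
  proof -
    have "zscale (f i j) (basis_vec (i + j)) \<noteq> 0"
    proof
      assume "zscale (f i j) (basis_vec (i + j)) = 0"
      from arg_cong[OF this, of "\<lambda>x. Poly_Mapping.lookup x (i + j)"] show False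
        using that by (simp add: lookup_basis_vec)
    qed
    then have "\<pi> (A (basis_vec i)) (B (basis_vec j)) \<noteq> 0"
      unfolding f graded_product_basis using witt_iso_coordD(7)[OF C(2), of _ 0] C_0 by simp
    then show ?thesis
      unfolding bisupport_def using basis_vec_weight[OF A(2,1), of i] basis_vec_weight[OF B(2,1), of j] by blast
  qed
  obtain p where p: "p \<noteq> 0" "\<And>x y. (x, y) \<in> bisupport M N \<pi> \<Longrightarrow> poly2 p x y = 0"
    using not_zariski_dense_poly assms(9) unfolding degenerate_def by blast
  have zero: "poly2 p (u + of_int i) (v + of_int j) = 0" if "g i j l \<noteq> 0" for i j l
    using p(2)[OF in_support] that by (simp add: g_def split: if_splits)
  have sum0: "i + j + l = 0" if "g i j l \<noteq> 0" for i j l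
    using that by (simp add: g_def split: if_splits)
  interpret thin_invariant_form u a v b "- (u + v)" "dual_coeff c" g
  proof (intro thin_invariant_form.intro thin_invariant_form_axioms.intro)
    show "structure_constants u a" "structure_constants v b" "structure_constants (- (u + v)) (dual_coeff c)"
      using A(1) B(1) structure_constants.dual[OF C(1)] .
    show "invariant_form a b (dual_coeff c) g"
      unfolding invariant_form_def
    proof (intro conjI allI impI)
      fix k i j l :: int
      assume k: "i + j + l + k = 0"
      then have l: "l = - i - j - k" by simp
      have "g (i + k) j l = f (i + k) j" "g i (j + k) l = f i (j + k)" "g i j (l + k) = f i j"
        unfolding l by (simp_all add: g_def)
      moreover have "dual_coeff c k l = - c k (i + j)" unfolding l by (simp add: dual_coeff_def add.commute)
      ultimately show "a k i * g (i + k) j l + b k j * g i (j + k) l + dual_coeff c k l * g i j (l + k) = 0"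
        using inv[of k i j] by simp
    qed (simp add: g_def)
    show "u + v + - (u + v) = 0" by simp
    show "u + of_int i = 0 \<Longrightarrow> i = 0" "v + of_int i = 0 \<Longrightarrow> i = 0" for i
      using u(2) v(2) by blast+
    show "i = 0" if "- (u + v) + of_int i = 0" for i
    proof -
      have "u + v + of_int (- i) = - (- (u + v) + of_int i)" by simp
      then have "u + v + of_int (- i) = 0" unfolding that by simp
      then have "- i = 0" by (rule v(3))
      then show ?thesis by simp
    qed
    have inj: "inj (\<lambda>i. z + of_int i)" for z :: complex by (simp add: inj_def)
    have inj': "inj (\<lambda>i. z - of_int i)" for z :: complex by (simp add: inj_def)
    show "finite {i. infinite {(j, l). g i j l \<noteq> 0}}"
      by (rule finite_infinite_fibres[OF poly2_lines(1)[OF p(1)] inj[of u], of "\<lambda>i (j, l). v + of_int j"])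
        ((auto simp: inj_on_def dest!: sum0)[1], auto simp: zero)
    show "finite {j. infinite {(i, l). g i j l \<noteq> 0}}"
      by (rule finite_infinite_fibres[OF poly2_lines(2)[OF p(1)] inj[of v], of "\<lambda>j (i, l). u + of_int i"])
        ((auto simp: inj_on_def dest!: sum0)[1], auto simp: zero)
    \<comment> \<open>A fixed third index means a fixed sum of the first two weights, so the third
      family consists of the lines \<open>x + y = s\<close> with
      \<open>s = u + v - l\<close>.\<close>
    have shift: "v + of_int j = u + v - of_int l - (u + of_int i)" if "g i j l \<noteq> 0" for i j l
    proof -
      have "j = - l - i" using sum0[OF that] by simp
      then show ?thesis by simp
    qed
    show "finite {l. infinite {(i, j). g i j l \<noteq> 0}}"
    proof (rule finite_infinite_fibres[OF poly2_lines(3)[OF p(1)] inj'[of "u + v"], of "\<lambda>l (i, j). u + of_int i"])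
      show "inj_on (\<lambda>(i, j). u + complex_of_int i) {t. case t of (i, j) \<Rightarrow> g i j l \<noteq> 0}" for l
        by (auto simp: inj_on_def dest!: sum0)
      show "poly2 p (case t of (i, j) \<Rightarrow> u + of_int i) (u + v - of_int l - (case t of (i, j) \<Rightarrow> u + of_int i)) = 0"
        if "case t of (i, j) \<Rightarrow> g i j l \<noteq> 0" for l t
        using that zero[of _ _ l] shift[of _ _ l] by (auto split: prod.splits)
    qed
  qed
  have "nonsplit a" "nonsplit b" "nonsplit (dual_coeff c)"
    using indecomposable_nonsplit assms(4-6) A(2) B(2) C(2) vs unfolding nonsplit_dual by blast+
  moreover have "g i0 j0 (- i0 - j0) \<noteq> 0"
    using nz unfolding f graded_product_basis by (auto simp: g_def C_0)
  ultimately have listed: "listed_form a b (dual_coeff c) g \<or> listed_form b a (dual_coeff c) (\<lambda>j i l. g i j l)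
    \<or> listed_form a (dual_coeff c) b (\<lambda>i l j. g i j l) \<or> listed_form (dual_coeff c) a b (\<lambda>l i j. g i j l)
    \<or> listed_form b (dual_coeff c) a (\<lambda>j l i. g i j l)"
    by (intro some_permutation_listed)
  interpret c: coordinates M N P \<pi> a b c f A B C
    by (intro coordinates.intro A B C f vs)
  interpret c_swap: coordinates N M P "\<lambda>n m. \<pi> m n" b a c "\<lambda>j i. f i j" B A C
    by (rule c.swap[OF vs(1)])
  interpret c_rot: coordinates M "rdual P" "rdual N" "rotate_M_Pdual N \<pi>" a "dual_coeff c" "dual_coeff b"
    "\<lambda>i l. f i (- i - l)" A "dual_basis_map P C" "dual_basis_map N B"
    by (rule c.rotate[OF B(1) C(1)])
  interpret c_rot_swap: coordinates "rdual P" M "rdual N" "\<lambda>f m. rotate_M_Pdual N \<pi> m f" "dual_coeff c" a "dual_coeff b"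
    "\<lambda>l i. f i (- i - l)" "dual_basis_map P C" A "dual_basis_map N B"
    by (rule c_rot.swap[OF vs(1)])
  \<comment> \<open>\<open>rotate_N_Pdual M \<pi>\<close> is the rotation of the map with exchanged
    arguments, so the same rotation lemma covers it.\<close>
  interpret c_swap_rot: coordinates N "rdual P" "rdual M" "rotate_M_Pdual M (\<lambda>n m. \<pi> m n)" b "dual_coeff c" "dual_coeff a"
    "\<lambda>j l. f (- j - l) j" B "dual_basis_map P C" "dual_basis_map M A"
    by (rule c_swap.rotate[OF A(1) C(1)])
  have "(\<lambda>i j. g i j (- i - j)) = f" "(\<lambda>j i. g i j (- j - i)) = (\<lambda>j i. f i j)"
    "(\<lambda>i l. g i (- i - l) l) = (\<lambda>i l. f i (- i - l))" "(\<lambda>l i. g i (- l - i) l) = (\<lambda>l i. f i (- i - l))"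
    "(\<lambda>j l. g (- j - l) j l) = (\<lambda>j l. f (- j - l) j)"
    by (simp_all add: g_def fun_eq_iff minus_diff_commute)
  with listed show ?thesis
    unfolding listed_form_def dual_coeff_dual_coeff S3_conj_to_listed_def
    using c.conj_to_listed_transfer c_swap.conj_to_listed_transfer c_rot.conj_to_listed_transfer
      c_rot_swap.conj_to_listed_transfer c_swap_rot.conj_to_listed_transfer
    unfolding rotate_N_Pdual_def rotate_M_Pdual_def by auto
qed

end
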